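(* Let $N\in\mathbb{N}$ and let $\mu,\nu\in\mathcal P(\mathbb{R}^N)$ be absolutely continuous with respect to Lebesgue measure. Then the set of biadapted Monge couplings $$\{(\mathrm{id},T)_\ast\mu \;:\; T:\mathbb{R}^N\to\mathbb{R}^N \text{ biadapted},\ T_\ast\mu=\nu\}$$ is dense in $\mathrm{Cpl}_{bc}(\mu,\nu)$ with respect to the weak topology. In particular, for every continuous bounded $c:\mathbb{R}^N\times\mathbb{R}^N\to\mathbb{R}$, $$\inf_{\pi\in\mathrm{Cpl}_{bc}(\mu,\nu)}\int c\,d\pi=\inf\Big\{\int c(x,T(x))\,d\mu(x)\;:\;T \text{ biadapted},\ T_\ast\mu=\nu\Big\}.$$
   Context: $\mathrm{Cpl}(\mu,\nu)$ denotes the set of probability measures on $\mathbb{R}^N\times\mathbb{R}^N$ with marginals $\mu$ and $\nu$; $T_\ast\mu=\mu\circ T^{-1}$ is the push-forward. All maps are Borel. A map $T=(T_1,\dots,T_N):\mathbb{R}^N\to\mathbb{R}^N$ is adapted if for each $t$, $T_t(x)$ depends only on $(x_1,\dots,x_t)$. $T$ is biadapted if it is bijective and both $T$ and $T^{-1}$ are adapted. For $t<N$ let $\mathcal F_t$ be the $\sigma$-algebra on $\mathbb{R}^N$ generated by the first $t$ coordinates. A coupling $\pi\in\mathrm{Cpl}(\mu,\nu)$ with disintegration $\pi(dx,dy)=\mu(dx)\pi^x(dy)$ is causal if for every $t<N$ and $B\in\mathcal F_t$ the map $x\mapsto\pi^x(B)$ is $\mathcal F_t$-measurable; it is bicausal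 if it is causal and its image under $(x,y)\mapsto(y,x)$ is a causal coupling of $\nu$ and $\mu$. $\mathrm{Cpl}_{bc}(\mu,\nu)$ denotes the set of bicausal couplings. *)

theory Defs
  imports "HOL-Probability.Probability"
begin

text \<open>Points of R^N are vectors \<open>real ^ ('n::{finite,linorder})\<close>, where the index type \<open>'n\<close> is a finite
  linearly ordered type (isomorphic to {1..N}); the order on \<open>'n\<close> gives the time order.\<close>

definition prob_on_borel :: "'a::topological_space measure \<Rightarrow> bool" where
  "prob_on_borel M \<longleftrightarrow> prob_space M \<and> sets M = sets (borel :: 'a measure)"

definition adapted :: "(real ^ ('n::{finite,linorder}) \<Rightarrow> real ^ ('n::{finite,linorder})) \<Rightarrow> bool" where
  "adapted T \<longleftrightarrow> (\<forall>i x y.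
      (\<forall>j\<le>i. x $ j = y $ j) \<longrightarrow> T x $ i = T y $ i)"

definition biadapted :: "(real ^ ('n::{finite,linorder}) \<Rightarrow> real ^ ('n::{finite,linorder})) \<Rightarrow> bool" where
  "biadapted T \<longleftrightarrow> bij T \<and> adapted T \<and> adapted (inv T)
      \<and> T \<in> borel_measurable borel \<and> inv T \<in> borel_measurable borel"

definition filt :: "'n \<Rightarrow> (real ^ ('n::{finite,linorder})) measure" where
  "filt i = sigma UNIV {(\<lambda>x. x $ j) -` A | j A. j \<le> i \<and> A \<in> sets (borel :: real measure)}"

definition cpl :: "(real ^ ('n::{finite,linorder})) measure \<Rightarrow> (real ^ ('n::{finite,linorder})) measure
                   \<Rightarrow> ((real ^ ('n::{finite,linorder})) \<times> (real ^ ('n::{finite,linorder}))) measure set" where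
  "cpl \<mu> \<nu> = {\<pi>. prob_space \<pi> \<and> sets \<pi> = sets (borel \<Otimes>\<^sub>M borel)
               \<and> distr \<pi> borel fst = \<mu> \<and> distr \<pi> borel snd = \<nu>}"

definition causal :: "((real ^ ('n::{finite,linorder})) \<times> (real ^ ('n::{finite,linorder}))) measure \<Rightarrow> (real ^ ('n::{finite,linorder})) measure
                      \<Rightarrow> (real ^ ('n::{finite,linorder})) measure \<Rightarrow> bool" where
  "causal \<pi> \<mu> \<nu> \<longleftrightarrow> \<pi> \<in> cpl \<mu> \<nu> \<and>
     (\<exists>\<kappa> :: real ^ ('n::{finite,linorder}) \<Rightarrow> (real ^ ('n::{finite,linorder})) measure.
        (\<forall>x. prob_on_borel (\<kappa> x)) \<and>
        (\<forall>B\<in>sets borel. (\<lambda>x. emeasure (\<kappa> x) B) \<in> borel_measurable borel) \<and>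
        (\<forall>A\<in>sets borel. \<forall>B\<in>sets borel.
            emeasure \<pi> (A \<times> B) = (\<integral>\<^sup>+ x. indicator A x * emeasure (\<kappa> x) B \<partial>\<mu>)) \<and>
        (\<forall>i. \<forall>B\<in>sets (filt i). (\<lambda>x. emeasure (\<kappa> x) B) \<in> borel_measurable (filt i)))"

definition cpl_bc :: "(real ^ ('n::{finite,linorder})) measure \<Rightarrow> (real ^ ('n::{finite,linorder})) measure
                      \<Rightarrow> ((real ^ ('n::{finite,linorder})) \<times> (real ^ ('n::{finite,linorder}))) measure set" where
  "cpl_bc \<mu> \<nu> = {\<pi>. causal \<pi> \<mu> \<nu>
        \<and> causal (distr \<pi> (borel \<Otimes>\<^sub>M borel) (\<lambda>(x, y). (y, x))) \<nu> \<mu>}"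

definition monge_cpl :: "(real ^ ('n::{finite,linorder})) measure \<Rightarrow> (real ^ ('n::{finite,linorder}) \<Rightarrow> real ^ ('n::{finite,linorder}))
                         \<Rightarrow> ((real ^ ('n::{finite,linorder})) \<times> (real ^ ('n::{finite,linorder}))) measure" where
  "monge_cpl \<mu> T = distr \<mu> (borel \<Otimes>\<^sub>M borel) (\<lambda>x. (x, T x))"

definition bdd_cont :: "('a::topological_space \<Rightarrow> real) \<Rightarrow> bool" where
  "bdd_cont f \<longleftrightarrow> continuous_on UNIV f \<and> (\<exists>B. \<forall>z. \<bar>f z\<bar> \<le> B)"

end

theory Submission
  imports Defs
begin

text \<open>
  A bijective, measurable version of the Knothe--Rosenblatt rearrangement provides biadapted maps
  from the uniform distribution \<open>\<gamma>\<close> on the unit cube to \<open>\<mu>\<close> and to \<open>\<nu>\<close>: the conditional laws of the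
  coordinates are atomless because of absolute continuity, and their quantile functions become
  bijections after a change on null sets. Biadapted changes of coordinates preserve bicausality, so one may assume
  \<open>\<mu> = \<nu> = \<gamma>\<close>. A bicausal coupling of \<open>\<gamma>\<close> with itself makes each new coordinate of either component
  uniform and independent of the past of both components. Hence, conditionally on the dyadic cell
  of the past, the next pair of coordinates is a coupling of two uniform distributions, whose masses
  on the cells of the grid are reproduced exactly by an interval exchange. These exchanges, chosen
  according to the cell of the past, combine to a biadapted map whose Monge coupling gives the same
  mass as the given coupling to all products of dyadic cells. Refining the grid yields convergence
  on all Borel rectangles, because the marginals are fixed, and therefore weak convergence.
\<close>

section \<open>Triangular maps\<close>

text \<open>\<open>biadapted\<close> asks for a bijection of all of R^N with adapted Borel inverse,
  not for one up to null sets. This is why each one-dimensional ingredient is invertible at every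
  point: quantile functions are repaired on null sets, and interval exchanges are the identity
  outside the unit interval. The maps on R^N are assembled by moving coordinate \<open>i\<close>
  with a bijection of the line that may depend on the past of both input and output. On the cube the
  next coordinate is independent of the past, so it stays exactly uniform when one conditions on a
  mere cell of the past. As there are only countably many cells, couplings need not be chosen
  measurably in a continuous parameter. The changes of coordinates are only Borel, so weak
  convergence on the cube alone could not be carried back to \<open>\<mu>\<close> and
  \<open>\<nu>\<close>. Convergence on all Borel rectangles can: a product of two Borel maps pulls
  Borel rectangles back to Borel rectangles.\<close>

definition upd :: "real ^ 'n \<Rightarrow> 'n \<Rightarrow> real \<Rightarrow> real ^ 'n" where
  "upd x i a = (\<chi> j. if j = i then a else x $ j)"

lemma upd_nth [simp]: "upd x i a $ j = (if j = i then a else x $ j)"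
  by (simp add: upd_def)

lemma borel_measurable_vecI:
  fixes f :: "'a \<Rightarrow> real ^ 'n"
  assumes "\<And>i. (\<lambda>x. f x $ i) \<in> borel_measurable M"
  shows "f \<in> borel_measurable M"
  unfolding borel_measurable_euclidean_space[of f]
  using assms by (auto simp: Basis_vec_def inner_axis)

lemma borel_measurable_vec_nth [measurable (raw)]:
  fixes f :: "'a \<Rightarrow> real ^ 'n"
  assumes "f \<in> borel_measurable M"
  shows "(\<lambda>x. f x $ i) \<in> borel_measurable M"
  using assms borel_measurable_continuous_onI[OF continuous_on_component[OF continuous_on_id], of i]
    measurable_compose by blast

lemma borel_measurable_vec_lambda [measurable (raw)]:
  fixes f :: "'n::finite \<Rightarrow> 'a \<Rightarrow> real"
  assumes "\<And>i. f i \<in> borel_measurable M"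
  shows "(\<lambda>x. \<chi> i. f i x) \<in> borel_measurable M"
  using assms by (intro borel_measurable_vecI) simp

lemma borel_measurable_upd [measurable (raw)]:
  assumes [measurable]: "f \<in> borel_measurable M" "g \<in> borel_measurable M"
  shows "(\<lambda>x. upd (f x) i (g x)) \<in> borel_measurable M"
  unfolding upd_def by (intro borel_measurable_vec_lambda) auto

lemma finite_linorder_less_induct [case_names less]:
  fixes i :: "'n::{finite,linorder}"
  assumes step: "\<And>i. (\<And>j. j < i \<Longrightarrow> P j) \<Longrightarrow> P i"
  shows "P i"
proof (induction "card {..<i}" arbitrary: i rule: less_induct)
  case less
  show ?case
  proof (rule step)
    fix j assume "j < i"
    then have "{..<j} \<subset> {..<i}"
      by auto
    then show "P j"
      by (intro less psubset_card_mono) auto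
  qed
qed

text \<open>The fixed point is reached after as many iterations as there are coordinates, because the
  \<open>i\<close>-th coordinate only depends on the earlier ones.\<close>

lemma triangular_fixpoint_exists:
  fixes \<phi> :: "'n::{finite,linorder} \<Rightarrow> (real, 'n) vec \<Rightarrow> (real, 'n) vec \<Rightarrow> real \<Rightarrow> real"
  assumes meas: "\<And>i. (\<lambda>(u, v, a). \<phi> i u v a) \<in> borel_measurable (borel \<Otimes>\<^sub>M borel \<Otimes>\<^sub>M borel)"
    and dep: "\<And>i u u' v v'. (\<And>j. j < i \<Longrightarrow> u $ j = u' $ j) \<Longrightarrow> (\<And>j. j < i \<Longrightarrow> v $ j = v' $ j) \<Longrightarrow>
      \<phi> i u v = \<phi> i u' v'"
  shows "\<exists>T. T \<in> borel_measurable borel \<and> adapted T \<and> (\<forall>u i. T u $ i = \<phi> i u (T u) (u $ i))"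
proof -
  define step where "step u v = (\<chi> i. \<phi> i u v (u $ i))" for u v
  define it where "it m u = (step u ^^ m) 0" for m u
  define T where "T = it CARD('n)"
  have step_meas: "(\<lambda>x. step (f x) (g x)) \<in> borel_measurable M"
    if [measurable]: "f \<in> borel_measurable M" "g \<in> borel_measurable M" for f g and M :: "(real, 'n) vec measure"
  proof -
    have "(\<lambda>x. \<phi> i (f x) (g x) (f x $ i)) \<in> borel_measurable M" for i
      using measurable_compose[OF _ meas[of i], of "\<lambda>x. (f x, g x, f x $ i)" M] by simp
    then show ?thesis
      unfolding step_def by (rule borel_measurable_vec_lambda)
  qed
  have it_meas: "it m \<in> borel_measurable borel" for m
  proof (induction m)
    case 0
    show ?case by (simp add: it_def)
  next
    case (Suc m)
    have "(\<lambda>u. step u (it m u)) \<in> borel_measurable borel"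
      by (rule step_meas) (use Suc in auto)
    then show ?case
      by (simp add: it_def)
  qed
  \<comment> \<open>Coordinate \<open>i\<close> is settled after as many rounds as its position
    \<open>card {..i}\<close> in the order. Earlier coordinates have a strictly smaller position, so
    they are already settled one round before.\<close>
  have stable: "it (Suc m) u $ i = it m u $ i" if "card {..i} \<le> m" for m u i
    using that
  proof (induction i arbitrary: m rule: finite_linorder_less_induct)
    case (less i)
    have "card {..i} > 0"
      by (auto simp: card_gt_0_iff)
    then obtain m' where m': "m = Suc m'"
      using less.prems by (cases m) auto
    have "it (Suc m') u $ j = it m' u $ j" if "j < i" for j
    proof (rule less.IH[OF that])
      have "{..j} \<subset> {..i}"
        using that by auto
      then have "card {..j} < card {..i}"
        by (intro psubset_card_mono) auto
      then show "card {..j} \<le> m'"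
        using less.prems m' by auto
    qed
    then have "\<phi> i u (it (Suc m') u) = \<phi> i u (it m' u)"
      by (intro dep) auto
    then show ?case
      by (simp add: m' it_def step_def)
  qed
  have fp: "T u $ i = \<phi> i u (T u) (u $ i)" for u i
  proof -
    have "it (Suc CARD('n)) u $ i = T u $ i"
      unfolding T_def by (intro stable card_mono) auto
    then show ?thesis
      by (simp add: it_def step_def T_def)
  qed
  have "T x $ i = T y $ i" if "\<forall>j\<le>i. x $ j = y $ j" for x y i
    using that
  proof (induction i rule: finite_linorder_less_induct)
    case (less i)
    have "\<phi> i x (T x) = \<phi> i y (T y)"
      using less by (intro dep) auto
    then show ?case
      using less.prems by (simp add: fp[of x i] fp[of y i])
  qed
  then have "adapted T"
    unfolding adapted_def by blast
  with fp it_meas show ?thesis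
    unfolding T_def by blast
qed

text \<open>Induction over time: the earlier coordinates determine the function that produces the
  next one. It shows that two triangular maps are mutually inverse, since their composite and the
  identity solve the same recursion.\<close>

lemma triangular_fixpoint_unique:
  fixes \<phi> :: "'n::{finite,linorder} \<Rightarrow> (real, 'n) vec \<Rightarrow> real \<Rightarrow> real"
  assumes dep: "\<And>i v v'. (\<And>j. j < i \<Longrightarrow> v $ j = v' $ j) \<Longrightarrow> \<phi> i v = \<phi> i v'"
    and "\<And>i. v $ i = \<phi> i v (u $ i)" and "\<And>i. w $ i = \<phi> i w (u $ i)"
  shows "v = w"
proof -
  have "v $ i = w $ i" for i
  proof (induction i rule: finite_linorder_less_induct)
    case (less i)
    then have "\<phi> i v = \<phi> i w"
      by (rule dep)
    then show ?case
      using assms(2,3)[of i] by metis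
  qed
  then show ?thesis
    by (simp add: vec_eq_iff)
qed

lemma biadaptedI:
  assumes "\<And>x. S (T x) = x" "\<And>y. T (S y) = y" "adapted T" "adapted S"
    "T \<in> borel_measurable borel" "S \<in> borel_measurable borel"
  shows "biadapted T"
proof -
  have inv: "inv T = S"
    using assms(1,2) by (intro inv_equality) auto
  have "bij T"
    using assms(1,2) by (intro bijI') metis+
  then show "biadapted T"
    unfolding biadapted_def inv using assms by auto
qed

text \<open>Dependence on the past of the input \<open>u\<close> and of the output \<open>v\<close>
  makes the setting symmetric: the inverse solves a recursion of the same kind, with
  \<open>\<psi>\<close> for \<open>\<phi>\<close> and the two pasts interchanged. The
  Knothe-Rosenblatt map uses only the past of the output, the grid matching uses both.\<close>

lemma biadapted_triangular_exists:
  fixes \<phi> \<psi> :: "'n::{finite,linorder} \<Rightarrow> (real, 'n) vec \<Rightarrow> (real, 'n) vec \<Rightarrow> real \<Rightarrow> real"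
  assumes meas: "\<And>i. (\<lambda>(u, v, a). \<phi> i u v a) \<in> borel_measurable (borel \<Otimes>\<^sub>M borel \<Otimes>\<^sub>M borel)"
      "\<And>i. (\<lambda>(u, v, a). \<psi> i u v a) \<in> borel_measurable (borel \<Otimes>\<^sub>M borel \<Otimes>\<^sub>M borel)"
    and dep: "\<And>i u u' v v'. (\<And>j. j < i \<Longrightarrow> u $ j = u' $ j) \<Longrightarrow> (\<And>j. j < i \<Longrightarrow> v $ j = v' $ j) \<Longrightarrow>
      \<phi> i u v = \<phi> i u' v'"
      "\<And>i u u' v v'. (\<And>j. j < i \<Longrightarrow> u $ j = u' $ j) \<Longrightarrow> (\<And>j. j < i \<Longrightarrow> v $ j = v' $ j) \<Longrightarrow>
      \<psi> i u v = \<psi> i u' v'"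
    and inv: "\<And>i u v a. \<psi> i u v (\<phi> i u v a) = a" "\<And>i u v a. \<phi> i u v (\<psi> i u v a) = a"
  shows "\<exists>T. biadapted T \<and> (\<forall>u i. T u $ i = \<phi> i u (T u) (u $ i))"
proof -
  obtain T where T: "T \<in> borel_measurable borel" "adapted T"
    "\<And>u i. T u $ i = \<phi> i u (T u) (u $ i)"
    using triangular_fixpoint_exists[of \<phi>] meas dep by blast
  have "(\<lambda>(u, v, a). \<psi> i v u a) \<in> borel_measurable (borel \<Otimes>\<^sub>M borel \<Otimes>\<^sub>M borel)" for i
    using measurable_compose[OF _ meas(2)[of i], of "\<lambda>(u, v, a). (v, u, a)" "borel \<Otimes>\<^sub>M borel \<Otimes>\<^sub>M borel"]
    by (simp add: split_beta')
  then have "\<exists>S. S \<in> borel_measurable borel \<and> adapted S \<and> (\<forall>v i. S v $ i = \<psi> i (S v) v (v $ i))"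
    by (rule triangular_fixpoint_exists) (rule dep(2); assumption)
  then obtain S where S: "S \<in> borel_measurable borel" "adapted S"
    "\<And>v i. S v $ i = \<psi> i (S v) v (v $ i)"
    by blast
  have "S (T x) = x" for x
    by (rule triangular_fixpoint_unique[where \<phi>="\<lambda>i w. \<psi> i w (T x)" and u="T x"])
       (rule dep(2), simp_all add: S(3)[symmetric], subst T(3), simp add: inv(1))
  moreover have "T (S y) = y" for y
    by (rule triangular_fixpoint_unique[where \<phi>="\<lambda>i w. \<phi> i (S y) w" and u="S y"])
       (rule dep(1), simp_all add: T(3)[symmetric], subst S(3), simp add: inv(2))
  ultimately have "biadapted T"
    using S T by (intro biadaptedI)
  with T show ?thesis
    by blast
qed

lemma adapted_compose:
  assumes "adapted S" "adapted T"
  shows "adapted (S \<circ> T)"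
  using assms unfolding adapted_def o_def by (meson order_trans)

lemma biadapted_compose:
  assumes "biadapted S" "biadapted T"
  shows "biadapted (S \<circ> T)"
  using assms unfolding biadapted_def
  by (auto simp: o_inv_distrib bij_comp adapted_compose intro: measurable_comp)

lemma biadapted_inv:
  assumes "biadapted T"
  shows "biadapted (inv T)"
  using assms unfolding biadapted_def by (simp add: bij_imp_bij_inv inv_inv_eq)

section \<open>Product measures on vectors\<close>

definition vec_PiM :: "real measure \<Rightarrow> (real ^ 'n) measure" where
  "vec_PiM P = distr (PiM UNIV (\<lambda>_. P)) borel (\<lambda>f. \<chi> i. f i)"

lemma sets_vec_PiM [measurable_cong, simp]: "sets (vec_PiM P) = sets borel"
  by (simp add: vec_PiM_def)

lemma space_vec_PiM [simp]: "space (vec_PiM P) = UNIV"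
  by (simp add: vec_PiM_def)

lemma box_sets_borel [measurable]:
  fixes A :: "'n::finite \<Rightarrow> real set"
  assumes [measurable]: "\<And>i. A i \<in> sets borel"
  shows "{x :: real ^ 'n. \<forall>i. x $ i \<in> A i} \<in> sets borel"
  by measurable

context
  fixes P :: "real measure"
  assumes P: "real_distribution P"
begin

interpretation P: real_distribution P by (rule P)

lemma vec_lambda_measurable_PiM:
  "(\<lambda>f. \<chi> i. f i) \<in> borel_measurable (PiM UNIV (\<lambda>_::'n::finite. P))"
  by (intro borel_measurable_vec_lambda)
     (use measurable_component_singleton[of _ UNIV "\<lambda>_::'n. P"] P.events_eq_borel
      in \<open>simp cong: measurable_cong_sets\<close>)

lemma prob_space_vec_PiM: "prob_space (vec_PiM P :: (real ^ 'n::finite) measure)"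
  unfolding vec_PiM_def by (intro prob_space.prob_space_distr prob_space_PiM P.prob_space_axioms vec_lambda_measurable_PiM)

lemma emeasure_vec_PiM_box:
  fixes A :: "'n::finite \<Rightarrow> real set"
  assumes [measurable]: "\<And>i. A i \<in> sets borel"
  shows "emeasure (vec_PiM P) {x. \<forall>i. x $ i \<in> A i} = (\<Prod>i\<in>UNIV. emeasure P (A i))"
proof -
  interpret fp: finite_product_prob_space "\<lambda>_::'n. P" UNIV
    by standard auto
  have "(\<lambda>f. \<chi> i. f i) -` {x :: real ^ 'n. \<forall>i. x $ i \<in> A i} \<inter> space (PiM UNIV (\<lambda>_. P)) = Pi\<^sub>E UNIV A"
    by (auto simp: space_PiM P.space_eq_univ)
  then have "emeasure (vec_PiM P) {x. \<forall>i. x $ i \<in> A i} = emeasure (PiM UNIV (\<lambda>_. P)) (Pi\<^sub>E UNIV A)"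
    unfolding vec_PiM_def by (subst emeasure_distr[OF vec_lambda_measurable_PiM]) auto
  also have "\<dots> = (\<Prod>i\<in>UNIV. emeasure P (A i))"
    by (rule fp.measure_times) (simp add: P.events_eq_borel)
  finally show ?thesis .
qed

lemma vec_PiM_unique:
  fixes M :: "(real ^ 'n::finite) measure"
  assumes sets [simp, measurable_cong]: "sets M = sets borel"
    and box: "\<And>A. (\<And>i. A i \<in> sets borel) \<Longrightarrow> emeasure M {x. \<forall>i. x $ i \<in> A i} = (\<Prod>i\<in>UNIV. emeasure P (A i))"
  shows "M = vec_PiM P"
proof -
  interpret PP: product_prob_space "\<lambda>_::'n. P" ..
  have [simp]: "space M = UNIV"
    using sets_eq_imp_space_eq[OF sets] by simp
  have m: "(\<lambda>x i. x $ i) \<in> measurable M (PiM UNIV (\<lambda>_::'n. P))"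
    by (rule measurable_PiM_single') (auto simp: P.space_eq_univ measurable_cong_sets[OF refl P.events_eq_borel])
  have eq: "distr M (PiM UNIV (\<lambda>_::'n. P)) (\<lambda>x i. x $ i) = PiM UNIV (\<lambda>_. P)"
  proof (rule PP.PiM_eqI)
    fix A :: "'n \<Rightarrow> real set" assume A: "\<And>i. i \<in> UNIV \<Longrightarrow> A i \<in> sets P"
    have "(\<lambda>x i. x $ i) -` Pi\<^sub>E UNIV A \<inter> space M = {x. \<forall>i. x $ i \<in> A i}"
      by auto
    moreover have "Pi\<^sub>E UNIV A \<in> sets (PiM UNIV (\<lambda>_::'n. P))"
      using A by (intro sets_PiM_I_finite) auto
    ultimately show "emeasure (distr M (PiM UNIV (\<lambda>_::'n. P)) (\<lambda>x i. x $ i)) (Pi\<^sub>E UNIV A) = (\<Prod>i\<in>UNIV. emeasure P (A i))"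
      using A box[of A] by (simp add: emeasure_distr[OF m] P.events_eq_borel)
  qed auto
  have "vec_PiM P = distr (distr M (PiM UNIV (\<lambda>_::'n. P)) (\<lambda>x i. x $ i)) borel (\<lambda>f. \<chi> i. f i)"
    unfolding eq vec_PiM_def ..
  also have "\<dots> = distr M borel (\<lambda>x. x)"
    by (subst distr_distr[OF vec_lambda_measurable_PiM m]) (simp add: o_def)
  also have "\<dots> = M"
    by (rule distr_id2) simp
  finally show ?thesis ..
qed

text \<open>On a box the constraint at \<open>i\<close> passes from \<open>x\<close> to the fresh
  sample \<open>a\<close>, leaving \<open>x\<close> free at \<open>i\<close> (the sets
  \<open>?B\<close>). The integral form serves as Fubini in coordinate \<open>i\<close> without
  splitting vectors into past, present and future.\<close>

lemma vec_PiM_resample: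
  "distr (vec_PiM P \<Otimes>\<^sub>M P) borel (\<lambda>(x, a). upd x i a) = (vec_PiM P :: (real ^ 'n::finite) measure)"
proof (rule vec_PiM_unique)
  fix A :: "'n \<Rightarrow> real set" assume A [measurable]: "\<And>i. A i \<in> sets borel"
  let ?B = "\<lambda>j. if j = i then UNIV else A j"
  note [measurable_cong] = P.events_eq_borel
  have [measurable]: "?B j \<in> sets borel" for j
    by simp
  have eq: "(\<lambda>(x, a). upd x i a) -` {x. \<forall>i. x $ i \<in> A i} \<inter> space (vec_PiM P \<Otimes>\<^sub>M P) = {x. \<forall>j. x $ j \<in> ?B j} \<times> A i"
    by (auto simp: space_pair_measure P.space_eq_univ split: if_splits)
  have "(\<Prod>j\<in>UNIV. emeasure P (A j)) = (\<Prod>j\<in>UNIV. emeasure P (?B j)) * emeasure P (A i)"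
    using P.emeasure_space_1 P.space_eq_univ
    by (subst (1 2) prod.remove[of UNIV i]) (auto intro!: prod.cong simp: mult.commute)
  moreover have "emeasure (distr (vec_PiM P \<Otimes>\<^sub>M P) borel (\<lambda>(x, a). upd x i a)) {x. \<forall>i. x $ i \<in> A i}
      = emeasure (vec_PiM P \<Otimes>\<^sub>M P) ({x. \<forall>j. x $ j \<in> ?B j} \<times> A i)"
    unfolding eq[symmetric] by (rule emeasure_distr) measurable
  moreover have "\<dots> = emeasure (vec_PiM P) {x. \<forall>j. x $ j \<in> ?B j} * emeasure P (A i)"
    by (rule P.emeasure_pair_measure_Times) (use box_sets_borel[of ?B] in \<open>simp_all add: P.events_eq_borel\<close>)
  ultimately show "emeasure (distr (vec_PiM P \<Otimes>\<^sub>M P) borel (\<lambda>(x, a). upd x i a)) {x. \<forall>i. x $ i \<in> A i} = (\<Prod>j\<in>UNIV. emeasure P (A j))"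
    using emeasure_vec_PiM_box[of ?B] by simp
qed simp

text \<open>Each coordinate of a box constrains exactly one of the two independent copies. With
  \<open>J\<close> an initial segment, integrating over \<open>z\<close> averages out the future,
  which gives conditional expectations given the coordinates in \<open>J\<close>.\<close>

lemma vec_PiM_merge:
  "distr (vec_PiM P \<Otimes>\<^sub>M vec_PiM P) borel (\<lambda>(x, z). \<chi> j. if j \<in> J then x $ j else z $ j)
    = (vec_PiM P :: (real ^ 'n::finite) measure)"
proof (rule vec_PiM_unique)
  interpret V: prob_space "vec_PiM P :: (real ^ 'n::finite) measure"
    by (rule prob_space_vec_PiM)
  fix A :: "'n \<Rightarrow> real set" assume A [measurable]: "\<And>i. A i \<in> sets borel"
  let ?B = "\<lambda>j. if j \<in> J then A j else UNIV" and ?C = "\<lambda>j. if j \<in> J then UNIV else A j"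
  have B: "?B j \<in> sets borel" "?C j \<in> sets borel" for j
    by auto
  have eq: "(\<lambda>(x, z). \<chi> j. if j \<in> J then x $ j else z $ j) -` {x. \<forall>i. x $ i \<in> A i} \<inter> space (vec_PiM P \<Otimes>\<^sub>M vec_PiM P)
      = {x. \<forall>j. x $ j \<in> ?B j} \<times> {x. \<forall>j. x $ j \<in> ?C j}"
    by (auto simp: space_pair_measure split: if_splits)
  have "(\<Prod>j\<in>UNIV. emeasure P (A j)) = (\<Prod>j\<in>UNIV. emeasure P (?B j)) * (\<Prod>j\<in>UNIV. emeasure P (?C j))"
    using P.emeasure_space_1 P.space_eq_univ
    unfolding prod.distrib[symmetric] by (intro prod.cong) auto
  moreover have "emeasure (distr (vec_PiM P \<Otimes>\<^sub>M vec_PiM P) borel (\<lambda>(x, z). \<chi> j. if j \<in> J then x $ j else z $ j)) {x. \<forall>i. x $ i \<in> A i}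
      = emeasure (vec_PiM P \<Otimes>\<^sub>M vec_PiM P) ({x. \<forall>j. x $ j \<in> ?B j} \<times> {x. \<forall>j. x $ j \<in> ?C j})"
    unfolding eq[symmetric] by (rule emeasure_distr) measurable
  moreover have "\<dots> = emeasure (vec_PiM P) {x. \<forall>j. x $ j \<in> ?B j} * emeasure (vec_PiM P) {x. \<forall>j. x $ j \<in> ?C j}"
    using box_sets_borel[of ?B, OF B(1)] box_sets_borel[of ?C, OF B(2)]
    by (intro V.emeasure_pair_measure_Times) simp_all
  ultimately show "emeasure (distr (vec_PiM P \<Otimes>\<^sub>M vec_PiM P) borel (\<lambda>(x, z). \<chi> j. if j \<in> J then x $ j else z $ j)) {x. \<forall>i. x $ i \<in> A i}
      = (\<Prod>j\<in>UNIV. emeasure P (A j))"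
    using emeasure_vec_PiM_box[of ?B, OF B(1)] emeasure_vec_PiM_box[of ?C, OF B(2)] by simp
qed simp

lemma nn_integral_vec_PiM_resample:
  fixes h :: "real ^ 'n::finite \<Rightarrow> ennreal"
  assumes [measurable]: "h \<in> borel_measurable borel"
  shows "(\<integral>\<^sup>+x. h x \<partial>vec_PiM P) = (\<integral>\<^sup>+x. \<integral>\<^sup>+a. h (upd x i a) \<partial>P \<partial>vec_PiM P)"
proof -
  note [measurable_cong] = P.events_eq_borel
  have "(\<integral>\<^sup>+x. h x \<partial>vec_PiM P) = (\<integral>\<^sup>+z. h ((\<lambda>(x, a). upd x i a) z) \<partial>(vec_PiM P \<Otimes>\<^sub>M P))"
    by (subst vec_PiM_resample[symmetric, of i]) (intro nn_integral_distr; measurable)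
  also have "\<dots> = (\<integral>\<^sup>+x. \<integral>\<^sup>+a. h (upd x i a) \<partial>P \<partial>vec_PiM P)"
    by (subst P.nn_integral_fst[symmetric]) (simp_all, measurable)
  finally show ?thesis .
qed

lemma nn_integral_vec_PiM_merge:
  fixes h :: "real ^ 'n::finite \<Rightarrow> ennreal"
  assumes [measurable]: "h \<in> borel_measurable borel"
  shows "(\<integral>\<^sup>+x. h x \<partial>vec_PiM P) = (\<integral>\<^sup>+x. \<integral>\<^sup>+z. h (\<chi> j. if j \<in> J then x $ j else z $ j) \<partial>vec_PiM P \<partial>vec_PiM P)"
proof -
  interpret V: prob_space "vec_PiM P :: (real ^ 'n::finite) measure"
    by (rule prob_space_vec_PiM)
  have "(\<integral>\<^sup>+x. h x \<partial>vec_PiM P) = (\<integral>\<^sup>+z. h ((\<lambda>(x, z). \<chi> j. if j \<in> J then x $ j else z $ j) z) \<partial>(vec_PiM P \<Otimes>\<^sub>M vec_PiM P))"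
    by (subst vec_PiM_merge[symmetric, of J]) (intro nn_integral_distr; measurable)
  also have "\<dots> = (\<integral>\<^sup>+x. \<integral>\<^sup>+z. h (\<chi> j. if j \<in> J then x $ j else z $ j) \<partial>vec_PiM P \<partial>vec_PiM P)"
    by (subst V.nn_integral_fst[symmetric]) (simp_all, measurable)
  finally show ?thesis .
qed

end

section \<open>Disintegration along the coordinates\<close>

text \<open>For real Borel functions this is measurability for \<open>filt i\<close>, by
  \<open>measurable_filt_if_depends_upto\<close> and \<open>measurable_filt_depends_upto\<close>.
  The pointwise form is easy to check for expressions in \<open>upd\<close>.\<close>

definition depends_upto :: "'n::{finite,linorder} \<Rightarrow> ((real, 'n) vec \<Rightarrow> 'b) \<Rightarrow> bool" where
  "depends_upto i h \<longleftrightarrow> (\<forall>x y. (\<forall>j\<le>i. x $ j = y $ j) \<longrightarrow> h x = h y)"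

text \<open>No index stands for the time before the first, so a function of the strict past is
  either constant or, with \<open>Max {..<i}\<close> as the predecessor of \<open>i\<close>, a
  function up to an earlier time. This drives the inductions over time and the use of causality at
  \<open>i\<close>.\<close>

lemma depends_before_cases:
  fixes h :: "(real, 'n::{finite,linorder}) vec \<Rightarrow> 'b"
  assumes "\<And>x y. (\<And>j. j < i \<Longrightarrow> x $ j = y $ j) \<Longrightarrow> h x = h y"
  shows "(\<exists>c. h = (\<lambda>_. c)) \<or> (\<exists>j<i. depends_upto j h)"
proof (cases "{..<i} = {}")
  case True
  then have "h x = h 0" for x
    by (intro assms) auto
  then show ?thesis
    by blast
next
  case False
  then have "Max {..<i} < i" "\<And>j. j < i \<Longrightarrow> j \<le> Max {..<i}"
    using Max_in[of "{..<i}"] by auto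
  then have "depends_upto (Max {..<i}) h"
    unfolding depends_upto_def by (intro allI impI assms) auto
  then show ?thesis
    using \<open>Max {..<i} < i\<close> by blast
qed

text \<open>\<open>k i x\<close> plays the role of the conditional law of the \<open>i\<close>-th coordinate given the coordinates
  of \<open>x\<close> before \<open>i\<close>.\<close>

definition has_kernels :: "(real, 'n::{finite,linorder}) vec measure \<Rightarrow> ('n \<Rightarrow> (real, 'n) vec \<Rightarrow> real measure) \<Rightarrow> bool" where
  "has_kernels \<mu> k \<longleftrightarrow> (\<forall>i. \<forall>h :: (real, 'n) vec \<Rightarrow> ennreal. h \<in> borel_measurable borel \<longrightarrow> depends_upto i h \<longrightarrow>
     (\<integral>\<^sup>+x. h x \<partial>\<mu>) = (\<integral>\<^sup>+x. \<integral>\<^sup>+a. h (upd x i a) \<partial>k i x \<partial>\<mu>))"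

lemma measurable_kernel_integral:
  fixes h :: "(real, 'n::finite) vec \<Rightarrow> ennreal"
  assumes [measurable]: "k \<in> measurable borel (prob_algebra borel)" "h \<in> borel_measurable borel"
  shows "(\<lambda>x. \<integral>\<^sup>+a. h (upd x i a) \<partial>k x) \<in> borel_measurable borel"
proof (rule nn_integral_measurable_subprob_algebra2)
  show "k \<in> measurable borel (subprob_algebra borel)"
    by (rule measurable_prob_algebraD) fact
qed measurable

text \<open>Integrating out coordinate \<open>i\<close> with the common kernel turns a function up
  to \<open>i\<close> into one of the strict past, to which the induction hypothesis applies unless
  it is constant.\<close>

lemma kernels_determine_measure:
  fixes \<mu> \<nu> :: "(real, 'n::{finite,linorder}) vec measure"
  assumes "prob_on_borel \<mu>" "prob_on_borel \<nu>"
    and k: "\<And>i. k i \<in> measurable borel (prob_algebra borel)"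
    and dep: "\<And>i x y. (\<And>j. j < i \<Longrightarrow> x $ j = y $ j) \<Longrightarrow> k i x = k i y"
    and "has_kernels \<mu> k" "has_kernels \<nu> k"
  shows "\<mu> = \<nu>"
proof -
  interpret \<mu>: prob_space \<mu> using assms by (auto simp: prob_on_borel_def)
  interpret \<nu>: prob_space \<nu> using assms by (auto simp: prob_on_borel_def)
  have sets: "sets \<mu> = sets borel" "sets \<nu> = sets borel"
    using assms by (auto simp: prob_on_borel_def)
  have eq: "(\<integral>\<^sup>+x. h x \<partial>\<mu>) = (\<integral>\<^sup>+x. h x \<partial>\<nu>)"
    if "h \<in> borel_measurable borel" "depends_upto i h" for i :: 'n and h
    using that
  proof (induction i arbitrary: h rule: finite_linorder_less_induct)
    case (less i)
    define h' where "h' x = (\<integral>\<^sup>+a. h (upd x i a) \<partial>k i x)" for x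
    have meas: "h' \<in> borel_measurable borel"
      unfolding h'_def using k less.prems by (intro measurable_kernel_integral)
    have "h' x = h' y" if "\<And>j. j < i \<Longrightarrow> x $ j = y $ j" for x y
    proof -
      have "h (upd x i a) = h (upd y i a)" for a
        using less.prems(2)[unfolded depends_upto_def, rule_format, of "upd x i a" "upd y i a"] that
        by auto
      then show ?thesis
        unfolding h'_def using dep[OF that] by simp
    qed
    then consider c where "h' = (\<lambda>_. c)" | j where "j < i" "depends_upto j h'"
      using depends_before_cases[of i h'] by blast
    then have "(\<integral>\<^sup>+x. h' x \<partial>\<mu>) = (\<integral>\<^sup>+x. h' x \<partial>\<nu>)"
      by cases (simp_all add: \<mu>.emeasure_space_1 \<nu>.emeasure_space_1 less.IH meas)
    then show ?case
      using \<open>has_kernels \<mu> k\<close>[unfolded has_kernels_def, rule_format, OF less.prems]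
        \<open>has_kernels \<nu> k\<close>[unfolded has_kernels_def, rule_format, OF less.prems]
      unfolding h'_def by simp
  qed
  show ?thesis
  proof (rule measure_eqI)
    fix A assume A: "A \<in> sets \<mu>"
    \<comment> \<open>Every function depends on the coordinates up to the last one,
      \<open>Max UNIV\<close>.\<close>
    have "(\<integral>\<^sup>+x. indicator A x \<partial>\<mu>) = (\<integral>\<^sup>+x. indicator A x \<partial>\<nu>)"
      using A sets by (intro eq[of _ "Max UNIV"]) (auto simp: depends_upto_def vec_eq_iff[symmetric])
    then show "emeasure \<mu> A = emeasure \<nu> A"
      using A sets by simp
  qed (use sets in simp)
qed

text \<open>Resampling the input coordinate \<open>i\<close> leaves the pasts of \<open>u\<close>
  and \<open>T u\<close> as they are, so the function \<open>\<phi> i u (T u)\<close> is frozen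
  while its argument is a fresh sample of \<open>P\<close>; the output coordinate then has law
  \<open>k i (T u)\<close>.\<close>

lemma triangular_push_has_kernels:
  fixes T :: "(real, 'n::{finite,linorder}) vec \<Rightarrow> (real, 'n) vec"
  assumes P: "real_distribution P"
    and T [measurable]: "T \<in> borel_measurable borel" and "adapted T"
    and fp: "\<And>u i. T u $ i = \<phi> i u (T u) (u $ i)"
    and dep: "\<And>i u u' v v'. (\<And>j. j < i \<Longrightarrow> u $ j = u' $ j) \<Longrightarrow> (\<And>j. j < i \<Longrightarrow> v $ j = v' $ j) \<Longrightarrow>
      \<phi> i u v = \<phi> i u' v'"
    and \<phi>: "\<And>i u v. \<phi> i u v \<in> borel_measurable borel"
    and push: "\<And>i u v. distr P borel (\<phi> i u v) = k i v"
    and k: "\<And>i. k i \<in> measurable borel (prob_algebra borel)"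
  shows "has_kernels (distr (vec_PiM P) borel T) k"
  unfolding has_kernels_def
proof (intro allI impI)
  interpret P: real_distribution P by (rule P)
  fix i and h :: "(real, 'n) vec \<Rightarrow> ennreal"
  assume h [measurable]: "h \<in> borel_measurable borel" and hi: "depends_upto i h"
  have below: "T (upd u i a) $ j = T u $ j" if "j < i" for u j a
    by (rule \<open>adapted T\<close>[unfolded adapted_def, rule_format]) (use that in auto)
  \<comment> \<open>The later coordinates of \<open>T\<close> do change with \<open>a\<close>, but
    \<open>h\<close> does not see them.\<close>
  have *: "h (T (upd u i a)) = h (upd (T u) i (\<phi> i u (T u) a))" for u a
  proof (rule hi[unfolded depends_upto_def, rule_format])
    fix j assume "j \<le> i"
    have "\<phi> i (upd u i a) (T (upd u i a)) = \<phi> i u (T u)"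
      by (rule dep) (auto simp: below)
    then show "T (upd u i a) $ j = upd (T u) i (\<phi> i u (T u) a) $ j"
      using \<open>j \<le> i\<close> below[of j u a] fp[of "upd u i a" i] by (cases "j = i") auto
  qed
  have inner: "(\<integral>\<^sup>+a. h (upd (T u) i (\<phi> i u (T u) a)) \<partial>P) = (\<integral>\<^sup>+b. h (upd (T u) i b) \<partial>k i (T u))" for u
    unfolding push[of i u "T u", symmetric]
    using \<phi> by (subst nn_integral_distr) (auto simp: measurable_cong_sets[OF P.events_eq_borel refl])
  have "(\<integral>\<^sup>+x. h x \<partial>distr (vec_PiM P) borel T) = (\<integral>\<^sup>+u. h (T u) \<partial>vec_PiM P)"
    by (rule nn_integral_distr) auto
  also have "\<dots> = (\<integral>\<^sup>+u. \<integral>\<^sup>+a. h (T (upd u i a)) \<partial>P \<partial>vec_PiM P)"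
    by (rule nn_integral_vec_PiM_resample[OF P]) measurable
  also have "\<dots> = (\<integral>\<^sup>+u. \<integral>\<^sup>+b. h (upd (T u) i b) \<partial>k i (T u) \<partial>vec_PiM P)"
    by (simp add: * inner)
  also have "\<dots> = (\<integral>\<^sup>+x. \<integral>\<^sup>+a. h (upd x i a) \<partial>k i x \<partial>distr (vec_PiM P) borel T)"
    using measurable_kernel_integral[OF k h] by (subst nn_integral_distr) auto
  finally show "(\<integral>\<^sup>+x. h x \<partial>distr (vec_PiM P) borel T)
      = (\<integral>\<^sup>+x. \<integral>\<^sup>+a. h (upd x i a) \<partial>k i x \<partial>distr (vec_PiM P) borel T)" .
qed

section \<open>Gaussian reference measure and existence of conditional kernels\<close>

text \<open>A probability with everywhere positive density: Lebesgue null sets contain the null sets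
  of its product, so an absolutely continuous law has a density relative to a product probability,
  where resampling is available.\<close>

definition std_normal :: "real measure" where
  "std_normal = density lborel std_normal_density"

lemma real_distribution_std_normal: "real_distribution std_normal"
  unfolding std_normal_def real_distribution_def real_distribution_axioms_def
  by (auto intro: prob_space_normal_density)

lemma vec_PiM_std_normal:
  "vec_PiM std_normal = density lborel (\<lambda>x :: (real, 'n::finite) vec. \<Prod>i\<in>UNIV. ennreal (std_normal_density (x $ i)))"
proof (rule vec_PiM_unique[OF real_distribution_std_normal, symmetric])
  fix A :: "'n \<Rightarrow> real set" assume A [measurable]: "\<And>i. A i \<in> sets borel"
  \<comment> \<open>Lebesgue integrals of products factorise over basis vectors, so the index
    \<open>i\<close> has to be recovered from \<open>b = axis i 1\<close>.\<close>
  define F where "F b x = ennreal (std_normal_density x) * indicator (A (THE i. b = axis i 1)) x" 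
    for b :: "(real, 'n) vec" and x
  have the: "(THE j. axis i (1::real) = axis j 1) = i" for i :: 'n
    by (auto simp: axis_eq_axis)
  have Basis: "(\<Prod>b\<in>Basis. G b) = (\<Prod>i\<in>UNIV. G (axis i 1))" for G :: "(real, 'n) vec \<Rightarrow> ennreal"
    unfolding Basis_vec_def
    by (subst prod.reindex[symmetric, unfolded o_def, where h="\<lambda>i. axis i 1"])
       (auto simp: inj_on_def axis_eq_axis intro!: prod.cong)
  have "emeasure (density lborel (\<lambda>x :: (real, 'n) vec. \<Prod>i\<in>UNIV. ennreal (std_normal_density (x $ i)))) {x. \<forall>i. x $ i \<in> A i}
      = (\<integral>\<^sup>+x. (\<Prod>i\<in>UNIV. ennreal (std_normal_density (x $ i))) * indicator {x. \<forall>i. x $ i \<in> A i} x \<partial>lborel)"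
    by (rule emeasure_density) auto
  also have "\<dots> = (\<integral>\<^sup>+x. (\<Prod>b\<in>Basis. F b (x \<bullet> b)) \<partial>lborel)"
    unfolding Basis
  proof (intro nn_integral_cong)
    fix x :: "(real, 'n) vec"
    have "indicator {x. \<forall>i. x $ i \<in> A i} x = (\<Prod>i\<in>UNIV. indicator (A i) (x $ i) :: ennreal)"
      by (auto simp: indicator_def of_bool_def prod_zero_iff)
    then show "(\<Prod>i\<in>UNIV. ennreal (std_normal_density (x $ i))) * indicator {x. \<forall>i. x $ i \<in> A i} x
        = (\<Prod>i\<in>UNIV. F (axis i 1) (x \<bullet> axis i 1))"
      by (simp add: F_def the inner_axis prod.distrib)
  qed
  also have "\<dots> = (\<Prod>b\<in>Basis. \<integral>\<^sup>+x. F b x \<partial>lborel)"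
    by (rule nn_integral_lborel_prod) (auto simp: F_def)
  also have "\<dots> = (\<Prod>i\<in>UNIV. emeasure std_normal (A i))"
    unfolding Basis by (auto simp: F_def[abs_def] the std_normal_def emeasure_density)
  finally show "emeasure (density lborel (\<lambda>x :: (real, 'n) vec. \<Prod>i\<in>UNIV. ennreal (std_normal_density (x $ i)))) {x. \<forall>i. x $ i \<in> A i}
      = (\<Prod>i\<in>UNIV. emeasure std_normal (A i))" .
qed simp

lemma absolutely_continuous_vec_PiM_std_normal:
  fixes \<mu> :: "(real, 'n::finite) vec measure"
  assumes "absolutely_continuous lborel \<mu>"
  shows "absolutely_continuous (vec_PiM std_normal) \<mu>"
proof -
  have "null_sets (vec_PiM std_normal :: (real, 'n) vec measure) \<subseteq> null_sets lborel"
  proof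
    fix A :: "(real, 'n) vec set" assume "A \<in> null_sets (vec_PiM std_normal)"
    then have "A \<in> sets lborel" and "AE x in lborel. x \<in> A \<longrightarrow> (\<Prod>i\<in>UNIV. ennreal (std_normal_density (x $ i))) = 0"
      unfolding vec_PiM_std_normal by (auto simp: null_sets_density_iff)
    moreover have "(\<Prod>i\<in>UNIV. ennreal (std_normal_density (x $ i))) \<noteq> 0" for x :: "(real, 'n) vec"
      using normal_density_pos[of 1 0] by (simp add: prod_zero_iff) (metis less_irrefl)
    ultimately have "AE x in lborel. x \<notin> A"
      by auto
    then show "A \<in> null_sets lborel"
      using \<open>A \<in> sets lborel\<close> by (simp add: AE_iff_null_sets)
  qed
  then show ?thesis
    using assms unfolding absolutely_continuous_def by auto
qed

text \<open>With \<open>f\<close> the density of \<open>\<mu>\<close> relative to the Gaussian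
  product, \<open>F i\<close> is the density of the coordinates up to \<open>i\<close> and
  \<open>g i\<close> that of the coordinates before \<open>i\<close>. The kernel is the usual
  conditional density \<open>F i / g i\<close>, and it has no atoms because the normal law has
  none.\<close>

theorem kernels_exist:
  fixes \<mu> :: "(real, 'n::{finite,linorder}) vec measure"
  assumes \<mu>: "prob_on_borel \<mu>" and ac: "absolutely_continuous lborel \<mu>"
  shows "\<exists>k. (\<forall>i. k i \<in> measurable borel (prob_algebra borel)) \<and>
    (\<forall>i x y. (\<forall>j<i. x $ j = y $ j) \<longrightarrow> k i x = k i y) \<and>
    (\<forall>i x a. emeasure (k i x) {a} = 0) \<and> has_kernels \<mu> k"
proof -
  let ?V = "vec_PiM std_normal :: (real, 'n) vec measure"
  interpret \<mu>: prob_space \<mu> using \<mu> by (simp add: prob_on_borel_def)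
  have sets: "sets \<mu> = sets borel" using \<mu> by (simp add: prob_on_borel_def)
  interpret N: real_distribution std_normal by (rule real_distribution_std_normal)
  interpret V: prob_space ?V by (rule prob_space_vec_PiM[OF real_distribution_std_normal])
  note [measurable_cong] = N.events_eq_borel
  obtain f where f [measurable]: "f \<in> borel_measurable borel" and dens: "density ?V f = \<mu>"
    using V.Radon_Nikodym[OF absolutely_continuous_vec_PiM_std_normal[OF ac]] sets
    by (auto simp: measurable_cong_sets[OF sets_vec_PiM refl])
  define F where "F i x = (\<integral>\<^sup>+z. f (\<chi> j. if j \<in> {..i} then x $ j else z $ j) \<partial>?V)" for i x
  define g where "g i x = (\<integral>\<^sup>+a. F i (upd x i a) \<partial>std_normal)" for i x
  \<comment> \<open>The value 1 where the quotient is meaningless makes \<open>k i x\<close>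
    standard normal there. Thus every \<open>k i x\<close>, not only almost every one, is an
    atomless probability.\<close>
  define d where "d i x b = (if g i x = 0 \<or> g i x = \<infinity> then 1 else F i (upd x i b) / g i x)" for i x b
  define k where "k i x = density std_normal (d i x)" for i x
  have [measurable]: "F i \<in> borel_measurable borel" for i
    unfolding F_def by measurable
  have [measurable]: "g i \<in> borel_measurable borel" for i
    unfolding g_def by measurable
  have d [measurable]: "(\<lambda>(x, b). d i x b) \<in> borel_measurable (borel \<Otimes>\<^sub>M borel)" for i
    unfolding d_def by measurable
  have d' [measurable]: "d i x \<in> borel_measurable borel" for i x
    using measurable_compose[OF _ d, of "\<lambda>b. (x, b)"] by simp
  have F_dep: "F i x = F i y" if "\<forall>j\<le>i. x $ j = y $ j" for i x y
  proof -
    have "(\<chi> j. if j \<in> {..i} then x $ j else z $ j) = (\<chi> j. if j \<in> {..i} then y $ j else z $ j)" for z :: "(real, 'n) vec"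
      using that by (auto simp: vec_eq_iff)
    then show ?thesis
      by (simp add: F_def)
  qed
  have F_dep': "F i (upd x i a) = F i (upd y i a)" if "\<forall>j<i. x $ j = y $ j" for i x y a
    by (rule F_dep) (use that in auto)
  have k_dep: "k i x = k i y" if "\<forall>j<i. x $ j = y $ j" for i x y
  proof -
    have "g i x = g i y"
      unfolding g_def F_dep'[OF that] ..
    then have "d i x = d i y"
      using F_dep'[OF that] by (simp add: fun_eq_iff d_def)
    then show ?thesis
      by (simp add: k_def)
  qed
  have prob: "emeasure (k i x) UNIV = 1" for i x
  proof -
    have "emeasure (k i x) UNIV = (\<integral>\<^sup>+b. d i x b \<partial>std_normal)"
      unfolding k_def by (subst emeasure_density) auto
    also have "\<dots> = 1"
    proof (cases "g i x = 0 \<or> g i x = \<infinity>")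
      case True
      then have "d i x = (\<lambda>_. 1)"
        by (auto simp: d_def)
      then show ?thesis
        using N.emeasure_space_1 by simp
    next
      case False
      then have "(\<integral>\<^sup>+b. d i x b \<partial>std_normal) = (\<integral>\<^sup>+b. F i (upd x i b) / g i x \<partial>std_normal)"
        by (simp add: d_def)
      also have "\<dots> = g i x / g i x"
        unfolding g_def by (rule nn_integral_divide) measurable
      finally show ?thesis
        using False by (simp add: ennreal_divide_self less_top)
    qed
    finally show ?thesis .
  qed
  have k_prob: "prob_space (k i x)" for i x
    using prob[of i x] by (intro prob_spaceI) (simp add: k_def N.space_eq_univ)
  have k_meas: "k i \<in> measurable borel (prob_algebra borel)" for i
  proof (rule measurable_prob_algebraI)
    show "k i \<in> measurable borel (subprob_algebra borel)"
    proof (rule measurable_subprob_algebra)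
      fix A :: "real set" assume A [measurable]: "A \<in> sets borel"
      have "(\<lambda>x. emeasure (k i x) A) = (\<lambda>x. \<integral>\<^sup>+b. d i x b * indicator A b \<partial>std_normal)"
        unfolding k_def by (subst emeasure_density) auto
      also have "\<dots> \<in> borel_measurable borel"
        by measurable
      finally show "(\<lambda>x. emeasure (k i x) A) \<in> borel_measurable borel" .
    qed (use k_prob in \<open>auto intro: prob_space_imp_subprob_space simp: k_def N.events_eq_borel\<close>)
  qed (rule k_prob)
  have null: "emeasure (k i x) {a} = 0" for i x a
  proof -
    have "emeasure std_normal {a} = 0"
      unfolding std_normal_def by (subst emeasure_density) (auto simp: nn_integral_0_iff_AE intro!: AE_mp[OF AE_lborel_singleton[of a]])
    then have "{a} \<in> null_sets std_normal"
      by (auto simp: N.events_eq_borel)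
    then have "{a} \<in> null_sets (k i x)"
      using absolutely_continuousI_density[of "d i x" std_normal] unfolding k_def absolutely_continuous_def by auto
    then show ?thesis
      by auto
  qed
  \<comment> \<open>\<open>F i\<close> is the conditional expectation of \<open>f\<close> given the
    coordinates up to \<open>i\<close>. It is applied below to \<open>h\<close> and also to
    \<open>K\<close>, which depends on the strict past only.\<close>
  have int_F: "(\<integral>\<^sup>+x. f x * h x \<partial>?V) = (\<integral>\<^sup>+x. F i x * h x \<partial>?V)"
    if [measurable]: "h \<in> borel_measurable borel" and hi: "depends_upto i h" for i h
  proof -
    have "h (\<chi> j. if j \<in> {..i} then x $ j else z $ j) = h x" for x z
      by (rule hi[unfolded depends_upto_def, rule_format]) auto
    then have "(\<integral>\<^sup>+x. f x * h x \<partial>?V) = (\<integral>\<^sup>+x. \<integral>\<^sup>+z. f (\<chi> j. if j \<in> {..i} then x $ j else z $ j) * h x \<partial>?V \<partial>?V)"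
      by (subst nn_integral_vec_PiM_merge[OF real_distribution_std_normal, of _ "{..i}"]) simp_all
    also have "\<dots> = (\<integral>\<^sup>+x. F i x * h x \<partial>?V)"
      unfolding F_def by (intro nn_integral_cong nn_integral_multc) measurable
    finally show ?thesis .
  qed
  have "has_kernels \<mu> k"
    unfolding has_kernels_def
  proof (intro allI impI)
    fix i and h :: "(real, 'n) vec \<Rightarrow> ennreal"
    assume h [measurable]: "h \<in> borel_measurable borel" and hi: "depends_upto i h"
    define K where "K x = (\<integral>\<^sup>+a. h (upd x i a) \<partial>k i x)" for x
    have K [measurable]: "K \<in> borel_measurable borel"
      unfolding K_def by (rule measurable_kernel_integral[OF k_meas h])
    have hu: "h (upd x i a) = h (upd y i a)" if "\<forall>j<i. x $ j = y $ j" for x y a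
      by (rule hi[unfolded depends_upto_def, rule_format]) (use that in auto)
    have K_dep: "K x = K y" if "\<forall>j<i. x $ j = y $ j" for x y
      unfolding K_def using k_dep[OF that] hu[OF that] by simp
    have Ki: "depends_upto i K"
      unfolding depends_upto_def by (intro allI impI K_dep) auto
    have K_upd: "K (upd x i a) = K x" for x a
      by (rule K_dep) auto
    have "(\<integral>\<^sup>+x. g i x \<partial>?V) = (\<integral>\<^sup>+x. F i x \<partial>?V)"
      unfolding g_def by (rule nn_integral_vec_PiM_resample[OF real_distribution_std_normal, symmetric]) measurable
    also have "\<dots> = (\<integral>\<^sup>+x. f x \<partial>?V)"
      using int_F[of "\<lambda>_. 1" i] by (simp add: depends_upto_def)
    also have "\<dots> = emeasure \<mu> UNIV"
      unfolding dens[symmetric] by (subst emeasure_density) auto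
    also have "\<dots> = 1"
      using \<mu>.emeasure_space_1 sets_eq_imp_space_eq[OF sets] by simp
    finally have "AE x in ?V. g i x \<noteq> \<infinity>"
      by (intro nn_integral_PInf_AE) auto
    \<comment> \<open>Where \<open>g i x = 0\<close>, the nonnegative \<open>F i (upd x i a)\<close>
      vanishes for almost every \<open>a\<close>, so the default kernel contributes nothing.\<close>
    moreover have "g i x * K x = (\<integral>\<^sup>+a. F i (upd x i a) * h (upd x i a) \<partial>std_normal)" if fin: "g i x \<noteq> \<infinity>" for x
    proof (cases "g i x = 0")
      case True
      then have "AE a in std_normal. F i (upd x i a) = 0"
        unfolding g_def by (subst (asm) nn_integral_0_iff_AE) auto
      then have "(\<integral>\<^sup>+a. F i (upd x i a) * h (upd x i a) \<partial>std_normal) = 0"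
        by (subst nn_integral_0_iff_AE) auto
      with True show ?thesis
        by simp
    next
      case False
      have "g i x * K x = g i x * (\<integral>\<^sup>+a. d i x a * h (upd x i a) \<partial>std_normal)"
        unfolding K_def k_def by (subst nn_integral_density) auto
      also have "\<dots> = (\<integral>\<^sup>+a. g i x * (d i x a * h (upd x i a)) \<partial>std_normal)"
        by (rule nn_integral_cmult[symmetric]) measurable
      also have "\<dots> = (\<integral>\<^sup>+a. F i (upd x i a) * h (upd x i a) \<partial>std_normal)"
      proof (intro nn_integral_cong)
        fix a
        have "g i x * d i x a = F i (upd x i a)"
          using False fin ennreal_mult_divide_eq[of "g i x" "F i (upd x i a)"]
          by (simp add: d_def ennreal_times_divide mult.commute[of "g i x"])
        then show "g i x * (d i x a * h (upd x i a)) = F i (upd x i a) * h (upd x i a)"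
          by (simp add: mult.assoc[symmetric])
      qed
      finally show ?thesis .
    qed
    ultimately have *: "(\<integral>\<^sup>+x. g i x * K x \<partial>?V) = (\<integral>\<^sup>+x. \<integral>\<^sup>+a. F i (upd x i a) * h (upd x i a) \<partial>std_normal \<partial>?V)"
      by (intro nn_integral_cong_AE) auto
    have "(\<integral>\<^sup>+x. h x \<partial>\<mu>) = (\<integral>\<^sup>+x. F i x * h x \<partial>?V)"
      unfolding dens[symmetric] using int_F[OF h hi] by (subst nn_integral_density) auto
    also have "\<dots> = (\<integral>\<^sup>+x. \<integral>\<^sup>+a. F i (upd x i a) * h (upd x i a) \<partial>std_normal \<partial>?V)"
      by (rule nn_integral_vec_PiM_resample[OF real_distribution_std_normal]) measurable
    also have "\<dots> = (\<integral>\<^sup>+x. g i x * K x \<partial>?V)"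
      by (rule *[symmetric])
    also have "\<dots> = (\<integral>\<^sup>+x. \<integral>\<^sup>+a. F i (upd x i a) * K (upd x i a) \<partial>std_normal \<partial>?V)"
      unfolding g_def K_upd by (intro nn_integral_cong nn_integral_multc[symmetric]) measurable
    also have "\<dots> = (\<integral>\<^sup>+x. F i x * K x \<partial>?V)"
      by (rule nn_integral_vec_PiM_resample[OF real_distribution_std_normal, symmetric]) measurable
    also have "\<dots> = (\<integral>\<^sup>+x. K x \<partial>\<mu>)"
      unfolding dens[symmetric] using int_F[OF K Ki] by (subst nn_integral_density) auto
    finally show "(\<integral>\<^sup>+x. h x \<partial>\<mu>) = (\<integral>\<^sup>+x. \<integral>\<^sup>+a. h (upd x i a) \<partial>k i x \<partial>\<mu>)"
      unfolding K_def .
  qed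
  with k_meas k_dep null show ?thesis
    by blast
qed

section \<open>Measurable families of bijections\<close>

text \<open>The generalised inverse \<open>G\<close> undoes \<open>h\<close> and is monotone, hence
  Borel, as long as its supremum is over a nonempty set bounded above. \<open>W\<close> is a
  countable union of intervals on which this holds and which contains the range of
  \<open>h\<close>.\<close>

lemma strict_mono_borel_left_inverse:
  fixes h :: "real \<Rightarrow> real"
  assumes "strict_mono h"
  shows "\<exists>g \<in> borel_measurable borel. \<forall>x. g (h x) = x"
proof -
  have less: "h x < h y \<longleftrightarrow> x < y" and le: "h x \<le> h y \<longleftrightarrow> x \<le> y" for x y
    using assms by (auto simp: strict_mono_less strict_mono_less_eq)
  define W where "W = (\<Union>m::int. \<Union>n::int. {h m ..< h n})"
  define G where "G w = Sup {u. h u \<le> w}" for w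
  have W [measurable]: "W \<in> sets borel"
    unfolding W_def by measurable
  have hW: "h x \<in> W" for x
  proof -
    have "of_int \<lfloor>x\<rfloor> \<le> x" "x < of_int (\<lfloor>x\<rfloor> + 1)"
      by linarith+
    then have "h x \<in> {h \<lfloor>x\<rfloor> ..< h (\<lfloor>x\<rfloor> + 1 :: int)}"
      unfolding atLeastLessThan_iff less le by blast
    then show ?thesis
      unfolding W_def by blast
  qed
  have mono: "mono_on W G"
  proof (rule mono_onI)
    fix v w assume vw: "v \<in> W" "w \<in> W" "v \<le> w"
    obtain m where "h m \<le> v"
      using vw(1) by (auto simp: W_def)
    moreover obtain n where "w < h n"
      using vw(2) by (auto simp: W_def)
    then have "bdd_above {u. h u \<le> w}"
      by (intro bdd_aboveI[of _ n]) (metis le mem_Collect_eq less_imp_le order_trans)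
    ultimately show "G v \<le> G w"
      unfolding G_def using vw by (intro cSup_subset_mono) (auto intro: order_trans)
  qed
  have "(\<lambda>w. if w \<in> W then G w else 0) \<in> borel_measurable borel"
    using borel_measurable_mono_on_fnc[OF mono] by (intro measurable_If_restrict_space_iff[THEN iffD2]) auto
  moreover have "G (h x) = x" for x
    using le by (simp add: G_def atMost_def[symmetric])
  ultimately show ?thesis
    using hW by (intro bexI[of _ "\<lambda>w. if w \<in> W then G w else 0"]) auto
qed

text \<open>A pure jump function that jumps at every rational: the jumps exhaust the unit interval, so
  its range is negligible although the function is injective.\<close>

lemma strict_mono_null_range_exists:
  "\<exists>h :: real \<Rightarrow> real. strict_mono h \<and> range h \<subseteq> {0<..<1} \<and> (\<exists>N \<in> null_sets lborel. range h \<subseteq> N)"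
proof -
  have "infinite (\<rat> :: real set)"
    by (rule Rats_infinite)
  then obtain q :: "nat \<Rightarrow> real" where q: "bij_betw q UNIV \<rat>"
    using bij_betw_from_nat_into[OF countable_rat] by blast
  define w :: "nat \<Rightarrow> real" where "w n = (1/2) ^ Suc n" for n
  define h where "h u = (\<Sum>n. w n * of_bool (q n < u))" for u
  have w: "w sums 1" "\<And>n. 0 < w n"
    using power_half_series by (auto simp: w_def[abs_def])
  have sm: "summable (\<lambda>n. w n * of_bool (q n < u))" for u
    by (rule summable_comparison_test'[OF sums_summable[OF w(1)], of 0]) (use w(2) in \<open>auto intro: less_imp_le\<close>)
  have h0: "0 \<le> h u" for u
    unfolding h_def by (intro suminf_nonneg sm) (use w(2) in \<open>auto intro: less_imp_le\<close>)
  have h1: "h u \<le> 1" for u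
    unfolding h_def sums_unique[OF w(1)]
    by (intro suminf_le sm sums_summable[OF w(1)]) (use w(2) in \<open>auto intro: less_imp_le\<close>)
  have jump: "h u + w n \<le> h v" if "u \<le> q n" "q n < v" for u v n
  proof -
    have "(\<lambda>m. w m * of_bool (q m < u) + (if m = n then w m else 0)) sums (h u + w n)"
      unfolding h_def by (intro sums_add summable_sums sm sums_single)
    then show ?thesis
    proof (rule sums_le[rotated])
      show "(\<lambda>m. w m * of_bool (q m < v)) sums h v"
        unfolding h_def by (intro summable_sums sm)
    next
      fix m
      show "w m * of_bool (q m < u) + (if m = n then w m else 0) \<le> w m * of_bool (q m < v)"
        using that w(2)[of m] by (auto simp: of_bool_def)
    qed
  qed
  have smono: "strict_mono h"
  proof (rule strict_monoI)
    fix u v :: real assume "u < v"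
    then obtain r where "r \<in> \<rat>" "u < r" "r < v"
      using Rats_dense_in_real by blast
    then obtain n where "u \<le> q n" "q n < v"
      using q unfolding bij_betw_def by (metis imageE less_imp_le)
    then show "h u < h v"
      using jump w(2)[of n] by fastforce
  qed
  have "h u \<in> {0<..<1}" for u
    using strict_monoD[OF smono, of "u - 1" u] strict_monoD[OF smono, of u "u + 1"] h0[of "u - 1"] h1[of "u + 1"]
    by auto
  \<comment> \<open>The strict inequality in \<open>h\<close> places the jump immediately after
    \<open>q n\<close>, so the values in \<open>J n\<close> are skipped. These gaps are disjoint,
    lie in the unit interval and have total length 1, hence the rest, which contains the range, is
    null.\<close>
  define J where "J n = {h (q n) <..< h (q n) + w n}" for n
  have "disjoint_family J"
  proof -
    have "J m \<inter> J n = {}" if "q m < q n" for m n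
      using jump[of "q m" m "q n"] that by (auto simp: J_def)
    moreover have "q m < q n \<or> q n < q m" if "m \<noteq> n" for m n
      using that q by (auto simp: bij_betw_def inj_on_def neq_iff[symmetric])
    ultimately show ?thesis
      unfolding disjoint_family_on_def by (metis Int_commute)
  qed
  have J_sub: "(\<Union>n. J n) \<subseteq> {0..1}"
  proof -
    have "h (q n) + w n \<le> 1" for n
      using jump[of "q n" n "q n + 1"] h1[of "q n + 1"] by simp
    then have "J n \<subseteq> {0..1}" for n
      using h0[of "q n"] by (auto simp: J_def) (smt (verit))
    then show ?thesis
      by blast
  qed
  have "emeasure lborel (\<Union>n. J n) = (\<Sum>n. emeasure lborel (J n))"
    using \<open>disjoint_family J\<close> by (intro suminf_emeasure[symmetric]) (simp_all add: image_subset_iff, simp add: J_def)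
  also have "\<dots> = (\<Sum>n. ennreal (w n))"
    using w(2) by (auto simp: J_def less_imp_le)
  also have "\<dots> = ennreal 1"
    using w by (subst suminf_ennreal2) (auto simp: less_imp_le sums_iff)
  finally have "emeasure lborel ({0..1} - (\<Union>n. J n)) = 0"
    using J_sub by (subst emeasure_Diff) (auto simp: J_def)
  then have "{0..1} - (\<Union>n. J n) \<in> null_sets lborel"
    by (auto simp: null_sets_def J_def)
  moreover have "h u \<notin> J n" for u n
  proof (cases "u \<le> q n")
    case True
    then show ?thesis
      using strict_mono_mono[OF smono] by (auto simp: J_def mono_def not_less)
  next
    case False
    then show ?thesis
      using jump[of "q n" n u] by (auto simp: J_def)
  qed
  ultimately show ?thesis
    using smono \<open>\<And>u. h u \<in> {0<..<1}\<close> h0 h1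
    by (intro exI[of _ h] conjI bexI[of _ "{0..1} - (\<Union>n. J n)"]) auto
qed

section \<open>Uniform law and bijections realising a family of atomless laws\<close>

text \<open>The half-open interval is tiled exactly by floor cells and by the intervals of an
  exchange.\<close>

abbreviation unif01 :: "real measure" where
  "unif01 \<equiv> uniform_measure lborel {0..<1}"

lemma real_distribution_unif01: "real_distribution unif01"
  unfolding real_distribution_def real_distribution_axioms_def
  by (auto intro!: prob_space_uniform_measure)

lemma emeasure_unif01:
  assumes "A \<in> sets borel"
  shows "emeasure unif01 A = emeasure lborel ({0..<1} \<inter> A)"
  using assms by (simp add: emeasure_uniform_measure divide_ennreal_def)

text \<open>Each \<open>\<phi> \<theta>\<close> is a bijection of the open unit interval onto the
  whole line. By the last clause the choice depends on \<open>\<theta>\<close> only through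
  \<open>K \<theta>\<close>, so dependence of a kernel on the past alone is inherited by the
  bijections.\<close>

definition kernel_bijections ::
    "'a measure \<Rightarrow> ('a \<Rightarrow> real measure) \<Rightarrow> ('a \<Rightarrow> real \<Rightarrow> real) \<Rightarrow> ('a \<Rightarrow> real \<Rightarrow> real) \<Rightarrow> bool" where
  "kernel_bijections M K \<phi> \<psi> \<longleftrightarrow>
    (\<lambda>(\<theta>, u). \<phi> \<theta> u) \<in> borel_measurable (M \<Otimes>\<^sub>M borel) \<and>
    (\<lambda>(\<theta>, y). \<psi> \<theta> y) \<in> borel_measurable (M \<Otimes>\<^sub>M borel) \<and>
    (\<forall>\<theta> u. 0 < u \<and> u < 1 \<longrightarrow> \<psi> \<theta> (\<phi> \<theta> u) = u) \<and>
    (\<forall>\<theta> y. \<phi> \<theta> (\<psi> \<theta> y) = y \<and> 0 < \<psi> \<theta> y \<and> \<psi> \<theta> y < 1) \<and>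
    (\<forall>\<theta>. distr unif01 borel (\<phi> \<theta>) = K \<theta>) \<and>
    (\<forall>\<theta> \<theta>'. K \<theta> = K \<theta>' \<longrightarrow> \<phi> \<theta> = \<phi> \<theta>' \<and> \<psi> \<theta> = \<psi> \<theta>')"

text \<open>The quantile functions are injective on the unit interval and the cumulative distribution
  functions are left inverses. The Cantor--Schroeder--Bernstein construction, carried out
  measurably in the parameter and with an injection of negligible range in the other direction,
  turns them into bijections while changing them only on a null set.\<close>

theorem kernel_bijections_exist:
  fixes K :: "'a \<Rightarrow> real measure"
  assumes K [measurable]: "K \<in> measurable M (prob_algebra borel)" and [simp]: "space M = UNIV"
    and atomless: "\<And>\<theta> x. emeasure (K \<theta>) {x} = 0"
  shows "\<exists>\<phi> \<psi>. kernel_bijections M K \<phi> \<psi>"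
proof -
  have "real_distribution (K \<theta>)" for \<theta>
    using measurable_space[OF K, of \<theta>]
    by (auto simp: space_prob_algebra real_distribution_def real_distribution_axioms_def)
  then interpret K: cdf_distribution "K \<theta>" for \<theta>
    unfolding cdf_distribution_def .
  obtain h :: "real \<Rightarrow> real" and N where h: "strict_mono h" "\<And>x. 0 < h x \<and> h x < 1"
    and N: "N \<in> null_sets lborel" "\<And>x. h x \<in> N"
    using strict_mono_null_range_exists unfolding image_subset_iff greaterThanLessThan_iff by blast
  obtain g where g [measurable]: "g \<in> borel_measurable borel" and gh: "\<And>x. g (h x) = x"
    using strict_mono_borel_left_inverse[OF h(1)] by blast
  have [measurable]: "h \<in> borel_measurable borel"
    using h(1) by (intro borel_measurable_mono strict_mono_mono)
  have [measurable]: "(\<lambda>x. K (fst x)) \<in> measurable (M \<Otimes>\<^sub>M borel) (subprob_algebra borel)"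
    by (rule measurable_compose[OF measurable_fst measurable_prob_algebraD[OF K]])
  have "(\<lambda>x. measure (K (fst x)) {..snd x}) \<in> borel_measurable (M \<Otimes>\<^sub>M borel)"
  proof (rule measure_measurable_subprob_algebra2)
    have "{z \<in> space ((M \<Otimes>\<^sub>M borel) \<Otimes>\<^sub>M borel). snd z \<le> (snd (fst z) :: real)} \<in> sets ((M \<Otimes>\<^sub>M borel) \<Otimes>\<^sub>M borel)"
      by measurable
    moreover have "(SIGMA x:space (M \<Otimes>\<^sub>M borel). {..snd x})
        = {z \<in> space ((M \<Otimes>\<^sub>M borel) \<Otimes>\<^sub>M borel). snd z \<le> (snd (fst z) :: real)}"
      by (auto simp: space_pair_measure)
    ultimately show "(SIGMA x:space (M \<Otimes>\<^sub>M borel). {..snd x}) \<in> sets ((M \<Otimes>\<^sub>M borel) \<Otimes>\<^sub>M (borel :: real measure))"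
      by metis
  qed measurable
  then have C': "(\<lambda>(\<theta>, y). cdf (K \<theta>) y) \<in> borel_measurable (M \<Otimes>\<^sub>M borel)"
    by (simp add: cdf_def split_beta')
  have C [measurable (raw)]: "(\<lambda>x. cdf (K (s x)) (t x)) \<in> borel_measurable L"
    if "s \<in> measurable L M" "t \<in> borel_measurable L" for s t and L :: "('a \<times> real) measure"
    using measurable_compose[OF measurable_Pair[OF that] C'] by simp
  define Q where "Q \<theta> u = (if 0 < u \<and> u < 1 then K.I \<theta> u else 0)" for \<theta> u
  have Q_le: "Q \<theta> u \<le> y \<longleftrightarrow> u \<le> cdf (K \<theta>) y" if "0 < u" "u < 1" for \<theta> u y
    using K.pseudoinverse[of u \<theta> y] that by (simp add: Q_def)
  have Q': "(\<lambda>(\<theta>, u). Q \<theta> u) \<in> borel_measurable (M \<Otimes>\<^sub>M borel)"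
    unfolding borel_measurable_iff_le
  proof
    fix a
    have "{w \<in> space (M \<Otimes>\<^sub>M borel). (case w of (\<theta>, u) \<Rightarrow> Q \<theta> u) \<le> a} =
      {w \<in> space (M \<Otimes>\<^sub>M borel). if 0 < snd w \<and> snd w < 1 then snd w \<le> cdf (K (fst w)) a else 0 \<le> a}"
      using Q_le by (auto simp: Q_def)
    also have "\<dots> \<in> sets (M \<Otimes>\<^sub>M borel)"
      by measurable
    finally show "{w \<in> space (M \<Otimes>\<^sub>M borel). (case w of (\<theta>, u) \<Rightarrow> Q \<theta> u) \<le> a} \<in> sets (M \<Otimes>\<^sub>M borel)" .
  qed
  have Q [measurable (raw)]: "(\<lambda>x. Q (s x) (t x)) \<in> borel_measurable L"
    if "s \<in> measurable L M" "t \<in> borel_measurable L" for s t and L :: "('a \<times> real) measure"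
    using measurable_compose[OF measurable_Pair[OF that] Q'] by simp
  \<comment> \<open>The absence of atoms enters here: were the cdf above \<open>u\<close> at the
    quantile, continuity would keep it above \<open>u\<close> a little to the left, against the
    minimality of the quantile.\<close>
  have CQ: "cdf (K \<theta>) (Q \<theta> u) = u" if u: "0 < u" "u < 1" for \<theta> u
  proof (rule antisym)
    show "u \<le> cdf (K \<theta>) (Q \<theta> u)"
      using Q_le[OF u, of \<theta> "Q \<theta> u"] by simp
    show "cdf (K \<theta>) (Q \<theta> u) \<le> u"
    proof (rule ccontr)
      assume *: "\<not> cdf (K \<theta>) (Q \<theta> u) \<le> u"
      have "isCont (cdf (K \<theta>)) (Q \<theta> u)"
        unfolding K.isCont_cdf by (simp add: measure_def atomless)
      then have "(cdf (K \<theta>) \<longlongrightarrow> cdf (K \<theta>) (Q \<theta> u)) (at_left (Q \<theta> u))"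
        unfolding isCont_def by (rule tendsto_within_subset) auto
      then have "\<forall>\<^sub>F y in at_left (Q \<theta> u). u < cdf (K \<theta>) y"
        by (rule order_tendstoD) (use * in auto)
      moreover have "\<forall>\<^sub>F y in at_left (Q \<theta> u). y < Q \<theta> u"
        by (simp add: eventually_at_filter)
      ultimately have "\<forall>\<^sub>F y in at_left (Q \<theta> u). False"
        by eventually_elim (metis Q_le[OF u] less_imp_le not_le)
      then show False
        by simp
    qed
  qed
  \<comment> \<open>This says that \<open>y\<close> is a value of the quantile function on the open
    unit interval. By \<open>CQ\<close> the only possible preimage is
    \<open>cdf (K \<theta>) y\<close>, so no quantifier over the reals endangers
    measurability.\<close>
  define im where "im \<theta> y \<longleftrightarrow> 0 < cdf (K \<theta>) y \<and> cdf (K \<theta>) y < 1 \<and> Q \<theta> (cdf (K \<theta>) y) = y" for \<theta> y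
  \<comment> \<open>The Cantor--Schroeder--Bernstein chains: \<open>A 0\<close> holds the points of
    the open unit interval outside the range of \<open>h\<close>, and \<open>A (Suc n)\<close> is
    the image of \<open>A n\<close> under the quantile function followed by \<open>h\<close>. On the
    union of the chains \<open>\<phi>\<close> is the quantile function, elsewhere it is
    \<open>g\<close>, the inverse of \<open>h\<close>.\<close>
  define A where "A = rec_nat (\<lambda>\<theta> u. 0 < u \<and> u < 1 \<and> h (g u) \<noteq> u)
    (\<lambda>n P \<theta> u. h (g u) = u \<and> im \<theta> (g u) \<and> P \<theta> (cdf (K \<theta>) (g u)))"
  have A0: "A 0 \<theta> u \<longleftrightarrow> 0 < u \<and> u < 1 \<and> h (g u) \<noteq> u" for \<theta> u
    by (simp add: A_def)
  have A_Suc: "A (Suc n) \<theta> u \<longleftrightarrow> h (g u) = u \<and> im \<theta> (g u) \<and> A n \<theta> (cdf (K \<theta>) (g u))" for n \<theta> u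
    by (simp add: A_def)
  have A_meas: "Measurable.pred L (\<lambda>x. A n (s x) (t x))"
    if "s \<in> measurable L M" "t \<in> borel_measurable L" for s t n and L :: "('a \<times> real) measure"
    using that
  proof (induction n arbitrary: s t)
    case 0
    note [measurable] = 0
    show ?case unfolding A0 by measurable
  next
    case (Suc n)
    note [measurable] = Suc.prems
    have [measurable]: "Measurable.pred L (\<lambda>x. A n (s x) (cdf (K (s x)) (g (t x))))"
      by (rule Suc.IH) measurable
    show ?case unfolding A_Suc im_def by measurable
  qed
  have A_unit: "0 < u \<and> u < 1" if "A n \<theta> u" for n \<theta> u
    using that h(2)[of "g u"] by (cases n) (auto simp: A0 A_Suc)
  define \<phi> where "\<phi> \<theta> u = (if \<exists>n. A n \<theta> u then Q \<theta> u else g u)" for \<theta> u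
  define \<psi> where "\<psi> \<theta> y = (if im \<theta> y \<and> (\<exists>n. A n \<theta> (cdf (K \<theta>) y)) then cdf (K \<theta>) y else h y)" for \<theta> y
  note [measurable (raw)] = A_meas
  have "(\<lambda>(\<theta>, u). \<phi> \<theta> u) \<in> borel_measurable (M \<Otimes>\<^sub>M borel)"
    unfolding \<phi>_def by measurable
  moreover have "(\<lambda>(\<theta>, y). \<psi> \<theta> y) \<in> borel_measurable (M \<Otimes>\<^sub>M borel)"
    unfolding \<psi>_def im_def by measurable
  moreover have "\<psi> \<theta> (\<phi> \<theta> u) = u" if u: "0 < u" "u < 1" for \<theta> u
  proof (cases "\<exists>n. A n \<theta> u")
    case True
    then show ?thesis
      using u by (auto simp: \<phi>_def \<psi>_def im_def CQ)
  next
    case False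
    then have "h (g u) = u"
      using A0[of \<theta> u] u by blast
    then have "\<not> (im \<theta> (g u) \<and> (\<exists>n. A n \<theta> (cdf (K \<theta>) (g u))))"
      using False A_Suc[of _ \<theta> u] by blast
    then show ?thesis
      using False \<open>h (g u) = u\<close> by (auto simp: \<phi>_def \<psi>_def)
  qed
  moreover have "\<phi> \<theta> (\<psi> \<theta> y) = y \<and> 0 < \<psi> \<theta> y \<and> \<psi> \<theta> y < 1" for \<theta> y
  proof (cases "im \<theta> y \<and> (\<exists>n. A n \<theta> (cdf (K \<theta>) y))")
    case True
    then show ?thesis
      by (auto simp: \<phi>_def \<psi>_def im_def)
  next
    case False
    have "\<not> A n \<theta> (h y)" for n
      using False by (cases n) (auto simp: A0 A_Suc gh)
    then show ?thesis
      using False h(2) by (auto simp: \<phi>_def \<psi>_def gh)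
  qed
  moreover have "distr unif01 borel (\<phi> \<theta>) = K \<theta>" for \<theta>
  proof -
    have \<phi>m: "\<phi> \<theta> \<in> borel_measurable borel"
      using measurable_compose[OF _ \<open>(\<lambda>(\<theta>, u). \<phi> \<theta> u) \<in> _\<close>, of "\<lambda>u. (\<theta>, u)" borel] by simp
    have "distr unif01 borel (\<phi> \<theta>) = distr (restrict_space lborel {0<..<1}) borel (K.I \<theta>)"
    proof (rule measure_eqI)
      fix B assume "B \<in> sets (distr unif01 borel (\<phi> \<theta>))"
      then have B [measurable]: "B \<in> sets borel"
        by simp
      have I: "K.I \<theta> \<in> borel_measurable (restrict_space lborel {0<..<1})"
        using K.measurable_CI[of \<theta>] by (simp add: measurable_def space_restrict_space sets_restrict_space)
      have IB: "{u \<in> {0<..<1}. K.I \<theta> u \<in> B} \<in> sets borel"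
        using measurable_sets[OF I B]
        by (subst (asm) sets_restrict_space_iff) (auto simp: space_restrict_space vimage_def Int_def conj_commute)
      have "emeasure (distr unif01 borel (\<phi> \<theta>)) B = emeasure lborel ({0..<1} \<inter> \<phi> \<theta> -` B)"
        using \<phi>m B measurable_sets[OF \<phi>m B]
        by (subst emeasure_distr) (auto simp: divide_ennreal_def measurable_cong_sets[OF sets_uniform_measure refl])
      also have "\<dots> = emeasure lborel {u \<in> {0<..<1}. K.I \<theta> u \<in> B}"
      proof (rule emeasure_eq_AE)
        \<comment> \<open>Points of the open unit interval outside \<open>N\<close> are not values
          of \<open>h\<close>, so they belong to \<open>A 0\<close> and keep their quantile.\<close>
        have "AE u in lborel. u \<noteq> 0 \<and> u \<notin> N"
          using AE_lborel_singleton[of "0::real"] AE_not_in[OF N(1)] by eventually_elim auto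
        then show "AE u in lborel. u \<in> {0..<1} \<inter> \<phi> \<theta> -` B \<longleftrightarrow> u \<in> {u \<in> {0<..<1}. K.I \<theta> u \<in> B}"
        proof eventually_elim
          case (elim u)
          have "\<phi> \<theta> u = K.I \<theta> u" if "0 < u" "u < 1"
          proof -
            have "A 0 \<theta> u"
              using elim N(2)[of "g u"] that by (auto simp: A0)
            then have "\<exists>n. A n \<theta> u" ..
            then show ?thesis
              using that by (simp add: \<phi>_def Q_def)
          qed
          then show ?case
            using elim by auto
        qed
      qed (use measurable_sets[OF \<phi>m B] IB in auto)
      also have "\<dots> = emeasure (distr (restrict_space lborel {0<..<1}) borel (K.I \<theta>)) B"
        by (subst emeasure_distr[OF I B], subst emeasure_restrict_space)
           (auto simp: space_restrict_space intro!: arg_cong[where f="emeasure lborel"])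
      finally show "emeasure (distr unif01 borel (\<phi> \<theta>)) B = emeasure (distr (restrict_space lborel {0<..<1}) borel (K.I \<theta>)) B" .
    qed simp
    then show ?thesis
      by (simp add: K.distr_I_eq_M)
  qed
  moreover have "\<phi> \<theta> = \<phi> \<theta>' \<and> \<psi> \<theta> = \<psi> \<theta>'" if "K \<theta> = K \<theta>'" for \<theta> \<theta>'
  proof -
    have Q_eq: "Q \<theta> = Q \<theta>'"
      by (simp add: fun_eq_iff Q_def that)
    then have im_eq: "im \<theta> = im \<theta>'"
      by (simp add: fun_eq_iff im_def that)
    have "A n \<theta> u = A n \<theta>' u" for n u
      by (induction n arbitrary: u) (auto simp: A0 A_Suc im_eq that)
    then show ?thesis
      by (auto simp: fun_eq_iff \<phi>_def \<psi>_def Q_eq im_eq that)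
  qed
  ultimately show ?thesis
    unfolding kernel_bijections_def by blast
qed

section \<open>A bijective Knothe--Rosenblatt map\<close>

lemma unif01_singleton: "emeasure unif01 {a} = 0"
  by (simp add: emeasure_unif01 emeasure_lborel_countable)

text \<open>Kernel bijections start from the open unit interval, whereas a biadapted map must be
  bijective on the whole line. Precomposition with \<open>e'\<close>, which maps the line onto that
  interval and preserves \<open>unif01\<close>, bridges this. It is the inverse of the kernel
  bijection for the constant kernel \<open>unif01\<close>.\<close>

lemma unif01_automorphism_onto_unit_interval:
  "\<exists>e e'. e \<in> borel_measurable borel \<and> e' \<in> borel_measurable borel \<and>
    (\<forall>u. 0 < u \<and> u < 1 \<longrightarrow> e' (e u) = u) \<and> (\<forall>y. e (e' y) = y \<and> 0 < e' y \<and> e' y < (1::real)) \<and>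
    distr unif01 borel e' = unif01"
proof -
  have "(\<lambda>_::real. unif01) \<in> measurable borel (prob_algebra borel)"
    using real_distribution_unif01
    by (intro measurable_const) (auto simp: space_prob_algebra real_distribution_def)
  from kernel_bijections_exist[OF this] obtain \<phi> \<psi> where *: "kernel_bijections borel (\<lambda>_::real. unif01) \<phi> \<psi>"
    by (auto simp: unif01_singleton)
  define e where "e = \<phi> 0"
  define e' where "e' = \<psi> 0"
  have meas [measurable]: "e \<in> borel_measurable borel" "e' \<in> borel_measurable borel"
    using * measurable_compose[of "\<lambda>u. (0, u)" borel "borel \<Otimes>\<^sub>M borel" "\<lambda>(\<theta>, u). \<phi> \<theta> u" borel]
      measurable_compose[of "\<lambda>u. (0, u)" borel "borel \<Otimes>\<^sub>M borel" "\<lambda>(\<theta>, u). \<psi> \<theta> u" borel]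
    unfolding e_def e'_def kernel_bijections_def by auto
  have inv: "\<And>u. 0 < u \<and> u < 1 \<Longrightarrow> e' (e u) = u" "\<And>y. e (e' y) = y \<and> 0 < e' y \<and> e' y < (1::real)"
    and push: "distr unif01 borel e = unif01"
    using * unfolding e_def e'_def kernel_bijections_def by blast+
  have "AE u in lborel. u \<in> {0..<1} \<longrightarrow> e' (e u) = u"
    using AE_lborel_singleton[of "0::real"] by eventually_elim (use inv(1) in force)
  then have AE: "AE u in unif01. e' (e u) = u"
    by (intro AE_uniform_measureI) auto
  have "distr unif01 borel e' = distr (distr unif01 borel e) borel e'"
    by (simp add: push)
  also have "\<dots> = distr unif01 borel (\<lambda>u. e' (e u))"
    by (subst distr_distr) (auto simp: o_def measurable_cong_sets[OF sets_uniform_measure refl])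
  also have "\<dots> = distr unif01 borel (\<lambda>u. u)"
    by (rule distr_cong_AE) (use AE in \<open>auto simp: measurable_cong_sets[OF sets_uniform_measure refl]\<close>)
  also have "\<dots> = unif01"
    by (rule distr_id2) simp
  finally show ?thesis
    using meas inv by blast
qed

text \<open>Coordinate \<open>i\<close> applies the bijection for the conditional law at the output
  built so far. The image of the cube therefore has the kernels of \<open>\<mu>\<close>, and kernels
  determine the measure.\<close>

theorem knothe_rosenblatt_biadapted:
  fixes \<mu> :: "(real, 'n::{finite,linorder}) vec measure"
  assumes \<mu>: "prob_on_borel \<mu>" and ac: "absolutely_continuous lborel \<mu>"
  shows "\<exists>\<Phi>. biadapted \<Phi> \<and> distr (vec_PiM unif01) borel \<Phi> = \<mu>"
proof -
  obtain k where k: "\<And>i. k i \<in> measurable borel (prob_algebra borel)"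
    and k_dep': "\<And>i x y. (\<forall>j<i. x $ j = y $ j) \<Longrightarrow> k i x = k i y"
    and atomless: "\<And>i x a. emeasure (k i x) {a} = 0" and ker: "has_kernels \<mu> k"
    using kernels_exist[OF assms] by blast
  have k_dep: "k i x = k i y" if "\<And>j. j < i \<Longrightarrow> x $ j = y $ j" for i x y
    using that by (intro k_dep') auto
  have "\<exists>\<phi> \<psi>. kernel_bijections borel (k i) \<phi> \<psi>" for i
    by (rule kernel_bijections_exist[OF k]) (auto simp: atomless)
  then obtain \<phi> \<psi> where *: "\<And>i. kernel_bijections borel (k i) (\<phi> i) (\<psi> i)"
    by metis
  obtain e e' where [measurable]: "e \<in> borel_measurable borel" "e' \<in> borel_measurable borel"
    and e: "\<And>u. 0 < u \<and> u < 1 \<Longrightarrow> e' (e u) = u" "\<And>y. e (e' y) = y \<and> 0 < e' y \<and> e' y < (1::real)"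
    and e_push: "distr unif01 borel e' = unif01"
    using unif01_automorphism_onto_unit_interval by blast
  have meas: "\<And>i. (\<lambda>(\<theta>, u). \<phi> i \<theta> u) \<in> borel_measurable (borel \<Otimes>\<^sub>M borel)"
      "\<And>i. (\<lambda>(\<theta>, u). \<psi> i \<theta> u) \<in> borel_measurable (borel \<Otimes>\<^sub>M borel)"
    and inv1: "\<And>i \<theta> u. 0 < u \<and> u < 1 \<Longrightarrow> \<psi> i \<theta> (\<phi> i \<theta> u) = u"
    and inv2: "\<And>i \<theta> y. \<phi> i \<theta> (\<psi> i \<theta> y) = y \<and> 0 < \<psi> i \<theta> y \<and> \<psi> i \<theta> y < 1"
    and push: "\<And>i \<theta>. distr unif01 borel (\<phi> i \<theta>) = k i \<theta>"
    and cong: "\<And>i \<theta> \<theta>'. k i \<theta> = k i \<theta>' \<Longrightarrow> \<phi> i \<theta> = \<phi> i \<theta>' \<and> \<psi> i \<theta> = \<psi> i \<theta>'"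
    using * unfolding kernel_bijections_def by blast+
  define f where "f i u v a = \<phi> i v (e' a)" for i and u v :: "(real, 'n) vec" and a
  define f' where "f' i u v b = e (\<psi> i v b)" for i and u v :: "(real, 'n) vec" and b
  have \<phi>m: "\<phi> i v \<in> borel_measurable borel" for i v
    using measurable_compose[OF _ meas(1), of "\<lambda>u. (v, u)" borel] by simp
  have fm: "f i u v \<in> borel_measurable borel" for i u v
    unfolding f_def using measurable_compose[OF _ \<phi>m, of e' borel] by simp
  have dep: "f i u v = f i u' v'" "f' i u v = f' i u' v'" if "\<And>j. j < i \<Longrightarrow> v $ j = v' $ j" for i u u' v v'
    using cong[OF k_dep[OF that]] by (simp_all add: f_def f'_def fun_eq_iff)
  have "\<exists>T. biadapted T \<and> (\<forall>u i. T u $ i = f i u (T u) (u $ i))"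
  proof (rule biadapted_triangular_exists[where \<psi>=f'])
    show "(\<lambda>(u, v, a). f i u v a) \<in> borel_measurable (borel \<Otimes>\<^sub>M borel \<Otimes>\<^sub>M borel)" for i
      using measurable_compose[OF _ meas(1), of "\<lambda>(u, v, a). (v, e' a)" "borel \<Otimes>\<^sub>M borel \<Otimes>\<^sub>M borel" i]
      by (simp add: f_def split_beta')
    have "(\<lambda>(u, v, a). \<psi> i v a) \<in> borel_measurable (borel \<Otimes>\<^sub>M borel \<Otimes>\<^sub>M borel)" for i
      using measurable_compose[OF _ meas(2), of "\<lambda>(u, v, a). (v, a)" "borel \<Otimes>\<^sub>M borel \<Otimes>\<^sub>M borel" i]
      by (simp add: split_beta')
    from measurable_compose[OF this, of e borel]
    show "(\<lambda>(u, v, a). f' i u v a) \<in> borel_measurable (borel \<Otimes>\<^sub>M borel \<Otimes>\<^sub>M borel)" for i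
      by (simp add: f'_def split_beta')
    show "f' i u v (f i u v a) = a" "f i u v (f' i u v a) = a" for i u v a
      by (simp_all add: f_def f'_def inv1 inv2 e)
  qed (rule dep; assumption)+
  then obtain T where T: "biadapted T" "\<And>u i. T u $ i = f i u (T u) (u $ i)"
    by blast
  have Tm: "T \<in> borel_measurable borel" "adapted T"
    using T by (auto simp: biadapted_def)
  have "has_kernels (distr (vec_PiM unif01) borel T) k"
  proof (rule triangular_push_has_kernels[where \<phi>=f, OF real_distribution_unif01 Tm T(2) _ fm _ k])
    fix i u v
    have "distr unif01 borel (f i u v) = distr (distr unif01 borel e') borel (\<phi> i v)"
      using \<phi>m by (subst distr_distr) (auto simp: o_def f_def[abs_def] measurable_cong_sets[OF sets_uniform_measure refl])
    then show "distr unif01 borel (f i u v) = k i v"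
      by (simp add: e_push push)
  qed (rule dep; assumption)
  moreover have "prob_on_borel (distr (vec_PiM unif01) borel T)"
    unfolding prob_on_borel_def
    using Tm by (auto intro!: prob_space.prob_space_distr prob_space_vec_PiM[OF real_distribution_unif01])
  ultimately have "distr (vec_PiM unif01) borel T = \<mu>"
    by (intro kernels_determine_measure[where k=k, OF _ \<mu> k k_dep _ ker])
  with T show ?thesis
    by blast
qed

section \<open>Interval exchanges realising one-dimensional couplings\<close>

text \<open>The identity plus finitely many shifts: Borel by construction, and fixing every point
  outside the tiles, which makes it a bijection of the whole line.\<close>

definition exchange :: "'i set \<Rightarrow> ('i \<Rightarrow> real) \<Rightarrow> ('i \<Rightarrow> real) \<Rightarrow> ('i \<Rightarrow> real) \<Rightarrow> real \<Rightarrow> real" where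
  "exchange \<Lambda> w p q a = a + (\<Sum>\<alpha>\<in>\<Lambda>. (q \<alpha> - p \<alpha>) * indicator {p \<alpha> ..< p \<alpha> + w \<alpha>} a)"

text \<open>Uniqueness is required per point and not per interval, so tiles may be empty; pairs of
  cells without mass need no special treatment.\<close>

definition tiles_unit :: "'i set \<Rightarrow> ('i \<Rightarrow> real) \<Rightarrow> ('i \<Rightarrow> real) \<Rightarrow> bool" where
  "tiles_unit \<Lambda> w p \<longleftrightarrow> finite \<Lambda> \<and> (\<forall>\<alpha>\<in>\<Lambda>. {p \<alpha> ..< p \<alpha> + w \<alpha>} \<subseteq> {0..<1}) \<and>
    (\<forall>a\<in>{0..<1}. \<exists>!\<alpha>. \<alpha> \<in> \<Lambda> \<and> a \<in> {p \<alpha> ..< p \<alpha> + w \<alpha>})"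

lemma exchange_measurable [measurable]: "exchange \<Lambda> w p q \<in> borel_measurable borel"
  unfolding exchange_def[abs_def] by measurable

lemma exchange_on_tile:
  assumes tl: "tiles_unit \<Lambda> w p" and \<alpha>: "\<alpha> \<in> \<Lambda>" and a: "a \<in> {p \<alpha> ..< p \<alpha> + w \<alpha>}"
  shows "exchange \<Lambda> w p q a = a + q \<alpha> - p \<alpha>"
proof -
  have "a \<in> {0..<1}"
    using assms unfolding tiles_unit_def by blast
  then have "a \<notin> {p \<beta> ..< p \<beta> + w \<beta>}" if "\<beta> \<in> \<Lambda>" "\<beta> \<noteq> \<alpha>" for \<beta>
    using assms that unfolding tiles_unit_def by blast
  then have "(\<Sum>\<beta>\<in>\<Lambda>. (q \<beta> - p \<beta>) * indicator {p \<beta> ..< p \<beta> + w \<beta>} a)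
      = (\<Sum>\<beta>\<in>\<Lambda>. if \<beta> = \<alpha> then q \<alpha> - p \<alpha> else 0)"
    using a by (intro sum.cong) auto
  also have "\<dots> = q \<alpha> - p \<alpha>"
    using tl \<alpha> by (simp add: tiles_unit_def)
  finally show ?thesis
    by (simp add: exchange_def)
qed

lemma exchange_outside:
  assumes "tiles_unit \<Lambda> w p" and "a \<notin> {0..<1}"
  shows "exchange \<Lambda> w p q a = a"
proof -
  have "(\<Sum>\<alpha>\<in>\<Lambda>. (q \<alpha> - p \<alpha>) * indicator {p \<alpha> ..< p \<alpha> + w \<alpha>} a) = 0"
    using assms by (intro sum.neutral) (auto simp: tiles_unit_def indicator_def)
  then show ?thesis
    by (simp add: exchange_def)
qed

lemma exchange_inverse:
  assumes p: "tiles_unit \<Lambda> w p" and q: "tiles_unit \<Lambda> w q"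
  shows "exchange \<Lambda> w q p (exchange \<Lambda> w p q a) = a"
proof (cases "a \<in> {0..<1}")
  case True
  then obtain \<alpha> where \<alpha>: "\<alpha> \<in> \<Lambda>" "a \<in> {p \<alpha> ..< p \<alpha> + w \<alpha>}"
    using p unfolding tiles_unit_def by blast
  have *: "exchange \<Lambda> w p q a = a + q \<alpha> - p \<alpha>"
    by (rule exchange_on_tile[OF p \<alpha>])
  have "exchange \<Lambda> w q p (a + q \<alpha> - p \<alpha>) = a"
    by (subst exchange_on_tile[OF q \<alpha>(1)]) (use \<alpha> in auto)
  then show ?thesis
    by (simp add: *)
next
  case False
  then show ?thesis
    by (simp add: exchange_outside[OF p] exchange_outside[OF q])
qed

text \<open>The exchange is a translation on each tile, and Lebesgue measure is translation
  invariant; the contributions of the tiles are then added up.\<close>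

lemma distr_exchange_unif01:
  assumes p: "tiles_unit \<Lambda> w p" and q: "tiles_unit \<Lambda> w q"
  shows "distr unif01 borel (exchange \<Lambda> w p q) = unif01"
proof (rule measure_eqI)
  fix B assume "B \<in> sets (distr unif01 borel (exchange \<Lambda> w p q))"
  then have B [measurable]: "B \<in> sets borel"
    by simp
  let ?s = "exchange \<Lambda> w p q"
  have sB [measurable]: "?s -` B \<in> sets borel"
    using measurable_sets[OF exchange_measurable B, of \<Lambda> w p q] by simp
  have split: "emeasure lborel ({0..<1} \<inter> X) = (\<Sum>\<alpha>\<in>\<Lambda>. emeasure lborel ({r \<alpha> ..< r \<alpha> + w \<alpha>} \<inter> X))"
    if r: "tiles_unit \<Lambda> w r" and [measurable]: "X \<in> sets borel" for r X
  proof -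
    have "{0..<1} \<inter> X = (\<Union>\<alpha>\<in>\<Lambda>. {r \<alpha> ..< r \<alpha> + w \<alpha>} \<inter> X)"
      using r unfolding tiles_unit_def by blast
    moreover have "disjoint_family_on (\<lambda>\<alpha>. {r \<alpha> ..< r \<alpha> + w \<alpha>} \<inter> X) \<Lambda>"
      using r unfolding tiles_unit_def disjoint_family_on_def by blast
    ultimately show ?thesis
      using r by (simp only: ) (subst sum_emeasure, auto simp: tiles_unit_def)
  qed
  have "emeasure lborel ({p \<alpha> ..< p \<alpha> + w \<alpha>} \<inter> ?s -` B) = emeasure lborel ({q \<alpha> ..< q \<alpha> + w \<alpha>} \<inter> B)"
    if \<alpha>: "\<alpha> \<in> \<Lambda>" for \<alpha>
  proof -
    have "?s a = (q \<alpha> - p \<alpha>) + a" if "a \<in> {p \<alpha> ..< p \<alpha> + w \<alpha>}" for a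
      using exchange_on_tile[OF p \<alpha> that, of q] by simp
    moreover have "a \<in> {p \<alpha> ..< p \<alpha> + w \<alpha>} \<longleftrightarrow> (q \<alpha> - p \<alpha>) + a \<in> {q \<alpha> ..< q \<alpha> + w \<alpha>}" for a
      by auto
    ultimately have "a \<in> {p \<alpha> ..< p \<alpha> + w \<alpha>} \<inter> ?s -` B \<longleftrightarrow> a \<in> (+) (q \<alpha> - p \<alpha>) -` ({q \<alpha> ..< q \<alpha> + w \<alpha>} \<inter> B)" for a
      by (metis Int_iff vimage_eq)
    then have "{p \<alpha> ..< p \<alpha> + w \<alpha>} \<inter> ?s -` B = (+) (q \<alpha> - p \<alpha>) -` ({q \<alpha> ..< q \<alpha> + w \<alpha>} \<inter> B)"
      by blast
    moreover have "emeasure lborel ({q \<alpha> ..< q \<alpha> + w \<alpha>} \<inter> B)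
        = emeasure (distr lborel borel ((+) (q \<alpha> - p \<alpha>))) ({q \<alpha> ..< q \<alpha> + w \<alpha>} \<inter> B)"
      by (simp add: lborel_distr_plus)
    moreover have "\<dots> = emeasure lborel ((+) (q \<alpha> - p \<alpha>) -` ({q \<alpha> ..< q \<alpha> + w \<alpha>} \<inter> B))"
      by (subst emeasure_distr) auto
    ultimately show ?thesis
      by simp
  qed
  then have "emeasure lborel ({0..<1} \<inter> ?s -` B) = emeasure lborel ({0..<1} \<inter> B)"
    by (simp add: split[OF p sB] split[OF q B])
  then show "emeasure (distr unif01 borel ?s) B = emeasure unif01 B"
    by (subst emeasure_distr) (auto simp: divide_ennreal_def measurable_cong_sets[OF sets_uniform_measure refl])
qed simp

text \<open>A later block starts only after an earlier one has ended, hence uniqueness; existence is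
  by induction on the number of blocks. Used to find the tile of a point inside its grid
  cell.\<close>

lemma partial_sums_partition:
  fixes c :: "nat \<Rightarrow> real"
  assumes c: "\<And>j. 0 \<le> c j" and a: "L \<le> a" "a < L + (\<Sum>j<n. c j)"
  shows "\<exists>!j. j < n \<and> L + (\<Sum>i<j. c i) \<le> a \<and> a < L + (\<Sum>i<j. c i) + c j"
proof -
  have "\<exists>j<n. L + (\<Sum>i<j. c i) \<le> a \<and> a < L + (\<Sum>i<j. c i) + c j"
    using a(2)
  proof (induction n)
    case (Suc n)
    show ?case
    proof (cases "a < L + (\<Sum>j<n. c j)")
      case True
      then show ?thesis
        using Suc.IH less_SucI by blast
    next
      case False
      then show ?thesis
        using Suc.prems by (intro exI[of _ n]) auto
    qed
  qed (use a(1) in auto)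
  moreover have False if "i < j" "a < L + (\<Sum>k<i. c k) + c i" "L + (\<Sum>k<j. c k) \<le> a" for i j
  proof -
    have "(\<Sum>k<Suc i. c k) \<le> (\<Sum>k<j. c k)"
      using that(1) c by (intro sum_mono2) auto
    then show False
      using that by simp
  qed
  ultimately show ?thesis
    by (metis linorder_neqE_nat)
qed

lemma floor_mult_eq_iff:
  fixes a :: real
  assumes "m > 0"
  shows "\<lfloor>real m * a\<rfloor> = I \<longleftrightarrow> real_of_int I / m \<le> a \<and> a < (real_of_int I + 1) / m"
  using assms by (auto simp: floor_eq_iff field_simps)

lemma unif01_cell:
  assumes "m > 0"
  shows "emeasure unif01 {a. \<lfloor>real m * a\<rfloor> = I} = (if 0 \<le> I \<and> I < int m then ennreal (1 / m) else 0)"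
proof -
  have "emeasure unif01 {a. \<lfloor>real m * a\<rfloor> = I} = emeasure lborel ({0..<1} \<inter> {a. \<lfloor>real m * a\<rfloor> = I})"
    by (rule emeasure_unif01) measurable
  also have "{0..<1} \<inter> {a. \<lfloor>real m * a\<rfloor> = I} =
      (if 0 \<le> I \<and> I < int m then {real_of_int I / m ..< (real_of_int I + 1) / m} else {})"
  proof -
    have "a \<in> {0..<1} \<longleftrightarrow> 0 \<le> I \<and> I < int m" if I: "\<lfloor>real m * a\<rfloor> = I" for a
    proof -
      have "0 \<le> a \<longleftrightarrow> 0 \<le> real m * a" "a < 1 \<longleftrightarrow> real m * a < real m"
        using assms by (auto simp: zero_le_mult_iff)
      then have "0 \<le> a \<longleftrightarrow> 0 \<le> I" "a < 1 \<longleftrightarrow> I < int m"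
        unfolding I[symmetric] by linarith+
      then show ?thesis
        by auto
    qed
    moreover have "\<lfloor>real m * a\<rfloor> = I \<longleftrightarrow> a \<in> {real_of_int I / m ..< (real_of_int I + 1) / m}" for a
      unfolding floor_mult_eq_iff[OF assms] atLeastLessThan_iff ..
    ultimately show ?thesis
      by (intro set_eqI) (simp, blast)
  qed
  finally show ?thesis
    using assms by (simp add: diff_divide_distrib[symmetric] divide_right_mono)
qed

text \<open>Each grid cell \<open>I\<close> is cut into consecutive intervals of lengths \<open>\<rho> (I \<times> J)\<close>, each grid cell
  \<open>J\<close> into consecutive intervals of the same lengths, and corresponding intervals are exchanged.\<close>

theorem interval_exchange_coupling:
  fixes \<rho> :: "(real \<times> real) measure" and m :: nat
  assumes \<rho>: "prob_space \<rho>" and sets [measurable_cong]: "sets \<rho> = sets (borel \<Otimes>\<^sub>M borel)"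
    and fst: "distr \<rho> borel fst = unif01" and snd: "distr \<rho> borel snd = unif01" and m: "m > 0"
  shows "\<exists>s s'. s \<in> borel_measurable borel \<and> s' \<in> borel_measurable borel \<and> (\<forall>a. s' (s a) = a) \<and> (\<forall>a. s (s' a) = a) \<and>
    distr unif01 borel s = unif01 \<and>
    (\<forall>I J. emeasure unif01 {a. \<lfloor>real m * a\<rfloor> = I \<and> \<lfloor>real m * s a\<rfloor> = J}
      = emeasure \<rho> {z. \<lfloor>real m * fst z\<rfloor> = I \<and> \<lfloor>real m * snd z\<rfloor> = J})"
proof -
  interpret \<rho>: prob_space \<rho> by (rule \<rho>)
  have space: "space \<rho> = UNIV"
    using sets_eq_imp_space_eq[OF sets] by (simp add: space_pair_measure)
  define E where "E I J = {z. \<lfloor>real m * fst z\<rfloor> = I \<and> \<lfloor>real m * snd z\<rfloor> = J}" for I J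
  have E [measurable]: "E I J \<in> sets \<rho>" for I J
  proof -
    have "{z \<in> space \<rho>. \<lfloor>real m * fst z\<rfloor> = I \<and> \<lfloor>real m * snd z\<rfloor> = J} \<in> sets \<rho>"
      by measurable
    then show ?thesis
      by (simp add: space E_def)
  qed
  have row: "emeasure \<rho> {z. \<lfloor>real m * fst z\<rfloor> = I} = (if 0 \<le> I \<and> I < int m then ennreal (1 / m) else 0)" for I
    unfolding unif01_cell[OF m, symmetric] fst[symmetric]
    by (subst emeasure_distr) (auto simp: space intro!: arg_cong[where f="emeasure \<rho>"])
  have col: "emeasure \<rho> {z. \<lfloor>real m * snd z\<rfloor> = J} = (if 0 \<le> J \<and> J < int m then ennreal (1 / m) else 0)" for J
    unfolding unif01_cell[OF m, symmetric] snd[symmetric]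
    by (subst emeasure_distr) (auto simp: space intro!: arg_cong[where f="emeasure \<rho>"])
  have meas_row: "{z. \<lfloor>real m * fst z\<rfloor> = I} \<in> sets \<rho>" and meas_col: "{z. \<lfloor>real m * snd z\<rfloor> = I} \<in> sets \<rho>" for I
  proof -
    have "{z \<in> space \<rho>. \<lfloor>real m * fst z\<rfloor> = I} \<in> sets \<rho>" "{z \<in> space \<rho>. \<lfloor>real m * snd z\<rfloor> = I} \<in> sets \<rho>"
      by measurable
    then show "{z. \<lfloor>real m * fst z\<rfloor> = I} \<in> sets \<rho>" "{z. \<lfloor>real m * snd z\<rfloor> = I} \<in> sets \<rho>"
      by (simp_all add: space)
  qed
  have E_null: "emeasure \<rho> (E I J) = 0" if "\<not> (0 \<le> I \<and> I < int m \<and> 0 \<le> J \<and> J < int m)" for I J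
  proof -
    have "emeasure \<rho> (E I J) \<le> emeasure \<rho> {z. \<lfloor>real m * fst z\<rfloor> = I}"
         "emeasure \<rho> (E I J) \<le> emeasure \<rho> {z. \<lfloor>real m * snd z\<rfloor> = J}"
      using meas_row meas_col by (auto intro!: emeasure_mono simp: E_def)
    then show ?thesis
      using that row[of I] col[of J] by (auto split: if_splits)
  qed
  define W where "W I J = measure \<rho> (E (int I) (int J))" for I J
  have W0: "0 \<le> W I J" for I J
    by (simp add: W_def)
  have null_set: "{z. \<not> (0 \<le> \<lfloor>real m * fst z\<rfloor> \<and> \<lfloor>real m * fst z\<rfloor> < int m)} \<in> null_sets \<rho>"
       "{z. \<not> (0 \<le> \<lfloor>real m * snd z\<rfloor> \<and> \<lfloor>real m * snd z\<rfloor> < int m)} \<in> null_sets \<rho>"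
  proof -
    have "{z. \<not> (0 \<le> \<lfloor>real m * fst z\<rfloor> \<and> \<lfloor>real m * fst z\<rfloor> < int m)}
        = (\<Union>I\<in>{I. \<not> (0 \<le> I \<and> I < int m)}. {z. \<lfloor>real m * fst z\<rfloor> = I})" by auto
    also have "\<dots> \<in> null_sets \<rho>"
      by (rule null_sets_UN') (use row meas_row in \<open>auto simp: null_sets_def\<close>)
    finally show "{z. \<not> (0 \<le> \<lfloor>real m * fst z\<rfloor> \<and> \<lfloor>real m * fst z\<rfloor> < int m)} \<in> null_sets \<rho>" .
    have "{z. \<not> (0 \<le> \<lfloor>real m * snd z\<rfloor> \<and> \<lfloor>real m * snd z\<rfloor> < int m)}
        = (\<Union>I\<in>{I. \<not> (0 \<le> I \<and> I < int m)}. {z. \<lfloor>real m * snd z\<rfloor> = I})" by auto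
    also have "\<dots> \<in> null_sets \<rho>"
      by (rule null_sets_UN') (use col meas_col in \<open>auto simp: null_sets_def\<close>)
    finally show "{z. \<not> (0 \<le> \<lfloor>real m * snd z\<rfloor> \<and> \<lfloor>real m * snd z\<rfloor> < int m)} \<in> null_sets \<rho>" .
  qed
  \<comment> \<open>The first marginal gives the cell \<open>I\<close> mass \<open>1 / m\<close>; by
    the second marginal almost all of it lies over the columns \<open>J < m\<close>.\<close>
  have row_sum: "(\<Sum>J<m. W I J) = 1 / m" if I: "I < m" for I
  proof -
    have "(\<Sum>J<m. W I J) = measure \<rho> (\<Union>J<m. E (int I) (int J))"
    proof -
      have "disjoint_family_on (\<lambda>J. E (int I) (int J)) {..<m}"
        by (auto simp: disjoint_family_on_def E_def)
      then show ?thesis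
        unfolding W_def by (intro \<rho>.finite_measure_finite_Union[symmetric]) auto
    qed
    also have "\<dots> = measure \<rho> {z. \<lfloor>real m * fst z\<rfloor> = int I}"
    proof (rule \<rho>.finite_measure_eq_AE)
      show "AE z in \<rho>. z \<in> (\<Union>J<m. E (int I) (int J)) \<longleftrightarrow> z \<in> {z. \<lfloor>real m * fst z\<rfloor> = int I}"
        using AE_not_in[OF null_set(2)]
      proof eventually_elim
        case (elim z)
        then obtain J where "\<lfloor>real m * snd z\<rfloor> = int J" "J < m"
          by (metis (mono_tags) mem_Collect_eq nonneg_int_cases of_nat_less_iff)
        then show ?case
          by (auto simp: E_def)
      qed
    qed (use meas_row in auto)
    also have "\<dots> = 1 / m"
      using row[of "int I"] I by (simp add: measure_def)
    finally show ?thesis .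
  qed
  have col_sum: "(\<Sum>I<m. W I J) = 1 / m" if J: "J < m" for J
  proof -
    have "(\<Sum>I<m. W I J) = measure \<rho> (\<Union>I<m. E (int I) (int J))"
    proof -
      have "disjoint_family_on (\<lambda>I. E (int I) (int J)) {..<m}"
        by (auto simp: disjoint_family_on_def E_def)
      then show ?thesis
        unfolding W_def by (intro \<rho>.finite_measure_finite_Union[symmetric]) auto
    qed
    also have "\<dots> = measure \<rho> {z. \<lfloor>real m * snd z\<rfloor> = int J}"
    proof (rule \<rho>.finite_measure_eq_AE)
      show "AE z in \<rho>. z \<in> (\<Union>I<m. E (int I) (int J)) \<longleftrightarrow> z \<in> {z. \<lfloor>real m * snd z\<rfloor> = int J}"
        using AE_not_in[OF null_set(1)]
      proof eventually_elim
        case (elim z)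
        then obtain I where "\<lfloor>real m * fst z\<rfloor> = int I" "I < m"
          by (metis (mono_tags) mem_Collect_eq nonneg_int_cases of_nat_less_iff)
        then show ?case
          by (auto simp: E_def)
      qed
    qed (use meas_col in auto)
    also have "\<dots> = 1 / m"
      using col[of "int J"] J by (simp add: measure_def)
    finally show ?thesis .
  qed
  define \<Lambda> where "\<Lambda> = {..<m} \<times> {..<m}"
  \<comment> \<open>For \<open>p\<close> the tile of \<open>(I, J)\<close> lies in cell
    \<open>I\<close> after the tiles with smaller \<open>J\<close>; for \<open>q\<close> it lies in
    cell \<open>J\<close> after those with smaller \<open>I\<close>. Row and column sums
    \<open>1 / m\<close> make both fillings exact.\<close>
  define p where "p = (\<lambda>(I, J). real I / m + (\<Sum>J'<J. W I J'))"
  define q where "q = (\<lambda>(I, J). real J / m + (\<Sum>I'<I. W I' J))"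
  define w where "w = (\<lambda>(I, J). W I J)"
  have tile_in_cell: "real I / m \<le> real I / m + (\<Sum>j<J. c j) \<and> real I / m + (\<Sum>j<J. c j) + c J \<le> (real I + 1) / m"
    if "\<And>j. 0 \<le> c j" "(\<Sum>j<m. c j) = 1 / m" "J < m" for c :: "nat \<Rightarrow> real" and I J
  proof -
    have "(\<Sum>j<Suc J. c j) \<le> (\<Sum>j<m. c j)"
      using that by (intro sum_mono2) auto
    then show ?thesis
      using that by (simp add: sum_nonneg add_divide_distrib)
  qed
  have p_cell: "\<lfloor>real m * a\<rfloor> = int I" if "I < m" "J < m" "a \<in> {p (I, J) ..< p (I, J) + w (I, J)}" for a I J
    using tile_in_cell[of "W I" J I] that W0 row_sum[of I]
    unfolding floor_mult_eq_iff[OF m] by (auto simp: p_def w_def)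
  have q_cell: "\<lfloor>real m * a\<rfloor> = int J" if "I < m" "J < m" "a \<in> {q (I, J) ..< q (I, J) + w (I, J)}" for a I J
    using tile_in_cell[of "\<lambda>I. W I J" I J] that W0 col_sum[of J]
    unfolding floor_mult_eq_iff[OF m] by (auto simp: q_def w_def)
  have cell_unit: "a \<in> {0..<1} \<longleftrightarrow> (\<exists>I<m. \<lfloor>real m * a\<rfloor> = int I)" for a
  proof -
    have "0 \<le> a \<longleftrightarrow> 0 \<le> real m * a" "a < 1 \<longleftrightarrow> real m * a < real m"
      using m by (auto simp: zero_le_mult_iff)
    then have "0 \<le> a \<longleftrightarrow> 0 \<le> \<lfloor>real m * a\<rfloor>" "a < 1 \<longleftrightarrow> \<lfloor>real m * a\<rfloor> < int m"
      by linarith+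
    then show ?thesis
      by (metis atLeastLessThan_iff nonneg_int_cases of_nat_0_le_iff of_nat_less_iff)
  qed
  have tp: "tiles_unit \<Lambda> w p"
    unfolding tiles_unit_def
  proof (intro conjI ballI)
    show "finite \<Lambda>"
      by (simp add: \<Lambda>_def)
    show "{p \<alpha> ..< p \<alpha> + w \<alpha>} \<subseteq> {0..<1}" if "\<alpha> \<in> \<Lambda>" for \<alpha>
      using p_cell that cell_unit unfolding \<Lambda>_def by blast
    fix a :: real assume "a \<in> {0..<1}"
    then obtain I where I: "I < m" "\<lfloor>real m * a\<rfloor> = int I"
      using cell_unit by blast
    have "\<exists>!J. J < m \<and> real I / m + (\<Sum>i<J. W I i) \<le> a \<and> a < real I / m + (\<Sum>i<J. W I i) + W I J"
      by (rule partial_sums_partition[OF W0])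
         (use I(2) in \<open>auto simp: floor_mult_eq_iff[OF m] row_sum[OF I(1)] add_divide_distrib\<close>)
    then obtain J where J: "J < m" "a \<in> {p (I, J) ..< p (I, J) + w (I, J)}"
      and uniq: "\<And>J'. J' < m \<Longrightarrow> a \<in> {p (I, J') ..< p (I, J') + w (I, J')} \<Longrightarrow> J' = J"
      unfolding p_def w_def atLeastLessThan_iff case_prod_conv by blast
    show "\<exists>!\<alpha>. \<alpha> \<in> \<Lambda> \<and> a \<in> {p \<alpha> ..< p \<alpha> + w \<alpha>}"
    proof (rule ex1I[of _ "(I, J)"])
      fix \<alpha> assume *: "\<alpha> \<in> \<Lambda> \<and> a \<in> {p \<alpha> ..< p \<alpha> + w \<alpha>}"
      obtain I' J' where \<alpha>: "\<alpha> = (I', J')" by (cases \<alpha>)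
      then have "I' < m" "J' < m" "a \<in> {p (I', J') ..< p (I', J') + w (I', J')}"
        using * by (auto simp: \<Lambda>_def)
      then show "\<alpha> = (I, J)"
        using p_cell[of I' J' a] I(2) uniq[of J'] \<alpha> by auto
    qed (use I J in \<open>simp add: \<Lambda>_def\<close>)
  qed
  have tq: "tiles_unit \<Lambda> w q"
    unfolding tiles_unit_def
  proof (intro conjI ballI)
    show "finite \<Lambda>"
      by (simp add: \<Lambda>_def)
    show "{q \<alpha> ..< q \<alpha> + w \<alpha>} \<subseteq> {0..<1}" if "\<alpha> \<in> \<Lambda>" for \<alpha>
      using q_cell that cell_unit unfolding \<Lambda>_def by blast
    fix a :: real assume "a \<in> {0..<1}"
    then obtain J where J: "J < m" "\<lfloor>real m * a\<rfloor> = int J"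
      using cell_unit by blast
    have "\<exists>!I. I < m \<and> real J / m + (\<Sum>i<I. W i J) \<le> a \<and> a < real J / m + (\<Sum>i<I. W i J) + W I J"
      by (rule partial_sums_partition[OF W0])
         (use J(2) in \<open>auto simp: floor_mult_eq_iff[OF m] col_sum[OF J(1)] add_divide_distrib\<close>)
    then obtain I where I: "I < m" "a \<in> {q (I, J) ..< q (I, J) + w (I, J)}"
      and uniq: "\<And>I'. I' < m \<Longrightarrow> a \<in> {q (I', J) ..< q (I', J) + w (I', J)} \<Longrightarrow> I' = I"
      unfolding q_def w_def atLeastLessThan_iff case_prod_conv by blast
    show "\<exists>!\<alpha>. \<alpha> \<in> \<Lambda> \<and> a \<in> {q \<alpha> ..< q \<alpha> + w \<alpha>}"
    proof (rule ex1I[of _ "(I, J)"])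
      fix \<alpha> assume *: "\<alpha> \<in> \<Lambda> \<and> a \<in> {q \<alpha> ..< q \<alpha> + w \<alpha>}"
      obtain I' J' where \<alpha>: "\<alpha> = (I', J')" by (cases \<alpha>)
      then have "I' < m" "J' < m" "a \<in> {q (I', J') ..< q (I', J') + w (I', J')}"
        using * by (auto simp: \<Lambda>_def)
      then show "\<alpha> = (I, J)"
        using q_cell[of I' J' a] J(2) uniq[of I'] \<alpha> by auto
    qed (use I J in \<open>simp add: \<Lambda>_def\<close>)
  qed
  define s where "s = exchange \<Lambda> w p q"
  \<comment> \<open>The points of cell \<open>I\<close> that are moved into cell \<open>J\<close>
    form exactly the tile of \<open>(I, J)\<close>, whose length is the prescribed mass.\<close>
  have s_cells: "{a \<in> {0..<1}. \<lfloor>real m * a\<rfloor> = I \<and> \<lfloor>real m * s a\<rfloor> = J}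
      = (if 0 \<le> I \<and> I < int m \<and> 0 \<le> J \<and> J < int m
         then {p (nat I, nat J) ..< p (nat I, nat J) + w (nat I, nat J)} else {})" for I J
  proof -
    have *: "\<exists>I' J'. I' < m \<and> J' < m \<and> a \<in> {p (I', J') ..< p (I', J') + w (I', J')}" if "a \<in> {0..<1}" for a
      using tp that unfolding tiles_unit_def \<Lambda>_def by fast
    have **: "\<lfloor>real m * a\<rfloor> = int I'" "\<lfloor>real m * s a\<rfloor> = int J'" "a \<in> {0..<1}"
      if "I' < m" "J' < m" "a \<in> {p (I', J') ..< p (I', J') + w (I', J')}" for a I' J'
    proof -
      show "\<lfloor>real m * a\<rfloor> = int I'"
        using p_cell that by blast
      then show "a \<in> {0..<1}"
        using cell_unit that(1) by blast
      have "s a = a + q (I', J') - p (I', J')"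
        unfolding s_def using that by (intro exchange_on_tile[OF tp]) (auto simp: \<Lambda>_def)
      then have "s a \<in> {q (I', J') ..< q (I', J') + w (I', J')}"
        using that(3) by auto
      then show "\<lfloor>real m * s a\<rfloor> = int J'"
        using q_cell that by blast
    qed
    show ?thesis
    proof (intro set_eqI iffI)
      fix a assume a: "a \<in> {a \<in> {0..<1}. \<lfloor>real m * a\<rfloor> = I \<and> \<lfloor>real m * s a\<rfloor> = J}"
      then obtain I' J' where IJ: "I' < m" "J' < m" "a \<in> {p (I', J') ..< p (I', J') + w (I', J')}"
        using * by blast
      then have "I = int I'" "J = int J'"
        using **[OF IJ] a by auto
      then show "a \<in> (if 0 \<le> I \<and> I < int m \<and> 0 \<le> J \<and> J < int m
         then {p (nat I, nat J) ..< p (nat I, nat J) + w (nat I, nat J)} else {})"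
        using IJ by simp
    next
      fix a assume a: "a \<in> (if 0 \<le> I \<and> I < int m \<and> 0 \<le> J \<and> J < int m
         then {p (nat I, nat J) ..< p (nat I, nat J) + w (nat I, nat J)} else {})"
      then have b: "0 \<le> I \<and> I < int m \<and> 0 \<le> J \<and> J < int m"
        "a \<in> {p (nat I, nat J) ..< p (nat I, nat J) + w (nat I, nat J)}"
        by (auto split: if_splits)
      then show "a \<in> {a \<in> {0..<1}. \<lfloor>real m * a\<rfloor> = I \<and> \<lfloor>real m * s a\<rfloor> = J}"
        using **[of "nat I" "nat J" a] by auto
    qed
  qed
  have [measurable]: "s \<in> borel_measurable borel"
    unfolding s_def by measurable
  have "emeasure unif01 {a. \<lfloor>real m * a\<rfloor> = I \<and> \<lfloor>real m * s a\<rfloor> = J} = emeasure \<rho> (E I J)" for I J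
  proof -
    have "emeasure unif01 {a. \<lfloor>real m * a\<rfloor> = I \<and> \<lfloor>real m * s a\<rfloor> = J}
        = emeasure lborel ({0..<1} \<inter> {a. \<lfloor>real m * a\<rfloor> = I \<and> \<lfloor>real m * s a\<rfloor> = J})"
      by (rule emeasure_unif01) measurable
    also have "{0..<1} \<inter> {a. \<lfloor>real m * a\<rfloor> = I \<and> \<lfloor>real m * s a\<rfloor> = J}
        = {a \<in> {0..<1}. \<lfloor>real m * a\<rfloor> = I \<and> \<lfloor>real m * s a\<rfloor> = J}"
      by auto
    also have "emeasure lborel \<dots> = emeasure \<rho> (E I J)"
    proof (cases "0 \<le> I \<and> I < int m \<and> 0 \<le> J \<and> J < int m")
      case True
      then have "emeasure lborel {a \<in> {0..<1}. \<lfloor>real m * a\<rfloor> = I \<and> \<lfloor>real m * s a\<rfloor> = J}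
          = ennreal (W (nat I) (nat J))"
        unfolding s_cells using W0 by (simp add: w_def)
      also have "\<dots> = emeasure \<rho> (E I J)"
        using True by (simp add: W_def \<rho>.emeasure_eq_measure)
      finally show ?thesis .
    next
      case False
      then show ?thesis
        using E_null[OF False] unfolding s_cells by (simp only: if_False emeasure_empty)
    qed
    finally show ?thesis .
  qed
  moreover have "\<forall>a. exchange \<Lambda> w q p (s a) = a" "\<forall>a. s (exchange \<Lambda> w q p a) = a"
    using exchange_inverse[OF tp tq] exchange_inverse[OF tq tp] by (auto simp: s_def)
  moreover have "distr unif01 borel s = unif01"
    unfolding s_def by (rule distr_exchange_unif01[OF tp tq])
  ultimately show ?thesis
    using \<open>s \<in> borel_measurable borel\<close> exchange_measurable unfolding E_def by blast
qed

section \<open>Matching the grid masses of a bicausal coupling\<close>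

lemma space_filt [simp]: "space (filt i) = UNIV"
  by (simp add: filt_def space_measure_of_conv)

lemma sets_filt:
  "sets (filt i) = sigma_sets UNIV {(\<lambda>x. x $ j) -` A | j A. j \<le> i \<and> A \<in> sets (borel :: real measure)}"
  unfolding filt_def by (intro sets_measure_of) auto

lemma vec_nth_measurable_filt:
  fixes i :: "'n::{finite,linorder}"
  assumes "j \<le> i"
  shows "(\<lambda>x. x $ j) \<in> borel_measurable (filt i)"
proof (rule measurableI)
  fix A :: "real set" assume "A \<in> sets borel"
  then have "(\<lambda>x. x $ j) -` A \<in> sets (filt i)"
    unfolding sets_filt using assms by (intro sigma_sets.Basic) auto
  then show "(\<lambda>x. x $ j) -` A \<inter> space (filt i) \<in> sets (filt i)"
    by simp
qed simp

text \<open>Such an \<open>f\<close> is unchanged by first setting all later coordinates to 0, and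
  that projection \<open>p\<close> is measurable from \<open>filt i\<close>.\<close>

lemma measurable_filt_if_depends_upto:
  assumes f: "f \<in> measurable borel N" and dep: "depends_upto i f"
  shows "f \<in> measurable (filt i) N"
proof -
  define p where "p x = (\<chi> j. if j \<le> i then x $ j else (0::real))" for x
  have "p \<in> borel_measurable (filt i)"
    unfolding p_def
  proof (rule borel_measurable_vec_lambda)
    show "(\<lambda>x. if j \<le> i then x $ j else 0) \<in> borel_measurable (filt i)" for j
      using vec_nth_measurable_filt[of j i] by (cases "j \<le> i") auto
  qed
  from measurable_compose[OF this f] have "(\<lambda>x. f (p x)) \<in> measurable (filt i) N" .
  moreover have "f (p x) = f x" for x
    by (rule dep[unfolded depends_upto_def, rule_format]) (auto simp: p_def)
  ultimately show ?thesis
    by simp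
qed

lemma sets_filt_borel: "S \<in> sets (filt i) \<Longrightarrow> S \<in> sets borel"
proof -
  have "{(\<lambda>x. x $ j) -` A | j A. j \<le> i \<and> A \<in> sets (borel :: real measure)} \<subseteq> sets borel"
  proof safe
    fix j and A :: "real set" assume [measurable]: "A \<in> sets borel"
    have "{x. x $ j \<in> A} \<in> sets borel"
      by measurable
    then show "(\<lambda>x. x $ j) -` A \<in> sets borel"
      by (simp add: vimage_def)
  qed
  then have "sets (filt i) \<subseteq> sets borel"
    unfolding sets_filt using sets.sigma_sets_subset[of _ borel] by auto
  then show "S \<in> sets (filt i) \<Longrightarrow> S \<in> sets borel"
    by blast
qed

lemma sets_filt_depends_upto:
  assumes "S \<in> sets (filt i)"
  shows "depends_upto i (\<lambda>x. x \<in> S)"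
  using assms unfolding sets_filt
proof induction
  case (Union a)
  then show ?case
    unfolding depends_upto_def UN_iff by blast
qed (auto simp: depends_upto_def)

text \<open>Points are closed, so each level set of \<open>f\<close> belongs to
  \<open>filt i\<close> and cannot separate vectors that agree up to \<open>i\<close>.\<close>

lemma measurable_filt_depends_upto:
  fixes f :: "(real, 'n::{finite,linorder}) vec \<Rightarrow> 'b::t1_space"
  assumes "f \<in> borel_measurable (filt i)"
  shows "depends_upto i f"
  unfolding depends_upto_def
proof (intro allI impI)
  fix x y :: "(real, 'n) vec" assume *: "\<forall>j\<le>i. x $ j = y $ j"
  have "f -` {f x} \<in> sets (filt i)"
    using measurable_sets[OF assms, of "{f x}"] by simp
  from sets_filt_depends_upto[OF this, unfolded depends_upto_def, rule_format, of x y] *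
  show "f x = f y"
    by simp
qed

text \<open>By causality the conditional mass of \<open>Y\<close> given \<open>x\<close> depends on
  the strict past of \<open>x\<close> only, like membership in \<open>X\<close>. Resampling
  coordinate \<open>i\<close> of the first component therefore splits off the factor
  \<open>emeasure P A\<close>.\<close>

lemma causal_next_coordinate_independent:
  fixes \<pi> :: "((real, 'n::{finite,linorder}) vec \<times> (real, 'n) vec) measure"
  assumes P: "real_distribution P" and causal: "causal \<pi> (vec_PiM P) \<nu>"
    and [measurable]: "A \<in> sets borel" "X \<in> sets borel" "Y \<in> sets borel"
    and X: "\<And>x y. (\<And>j. j < i \<Longrightarrow> x $ j = y $ j) \<Longrightarrow> x \<in> X \<longleftrightarrow> y \<in> X"
    and Y: "\<And>x y. (\<And>j. j < i \<Longrightarrow> x $ j = y $ j) \<Longrightarrow> x \<in> Y \<longleftrightarrow> y \<in> Y"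
  shows "emeasure \<pi> ((X \<inter> {x. x $ i \<in> A}) \<times> Y) = emeasure P A * emeasure \<pi> (X \<times> Y)"
proof -
  interpret P: real_distribution P by (rule P)
  note [measurable_cong] = P.events_eq_borel
  obtain \<kappa> where prob: "\<And>x. prob_on_borel (\<kappa> x)"
    and meas: "\<And>B. B \<in> sets borel \<Longrightarrow> (\<lambda>x. emeasure (\<kappa> x) B) \<in> borel_measurable borel"
    and dis: "\<And>A B. A \<in> sets borel \<Longrightarrow> B \<in> sets borel \<Longrightarrow>
      emeasure \<pi> (A \<times> B) = (\<integral>\<^sup>+ x. indicator A x * emeasure (\<kappa> x) B \<partial>vec_PiM P)"
    and filt: "\<And>i B. B \<in> sets (filt i) \<Longrightarrow> (\<lambda>x. emeasure (\<kappa> x) B) \<in> borel_measurable (filt i)"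
    using causal unfolding causal_def by blast
  have [measurable]: "(\<lambda>x. emeasure (\<kappa> x) Y) \<in> borel_measurable borel"
    by (rule meas) fact
  have \<kappa>Y: "emeasure (\<kappa> (upd x i a)) Y = emeasure (\<kappa> x) Y" for x a
  proof -
    \<comment> \<open>Causality compares both components at the same time, so it is applied at a
      time \<open>j\<close> before \<open>i\<close>. At the first time \<open>Y\<close> is trivial
      and its conditional mass is 0 or 1.\<close>
    consider c where "(\<lambda>x. x \<in> Y) = (\<lambda>_. c)" | j where "j < i" "depends_upto j (\<lambda>x. x \<in> Y)"
      using depends_before_cases[of i "\<lambda>x. x \<in> Y"] Y by blast
    then show ?thesis
    proof cases
      case (1 c)
      then have "Y = (if c then UNIV else {})"
        by (auto simp: fun_eq_iff)
      moreover have "emeasure (\<kappa> x) UNIV = 1" for x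
        using prob[of x] prob_space.emeasure_space_1[of "\<kappa> x"] sets_eq_imp_space_eq[of "\<kappa> x" borel]
        by (simp add: prob_on_borel_def)
      ultimately show ?thesis
        by simp
    next
      case (2 j)
      have "Measurable.pred (filt j) (\<lambda>x. x \<in> Y)"
        using 2(2) by (intro measurable_filt_if_depends_upto) measurable
      then have "Y \<in> sets (filt j)"
        by (simp add: pred_def)
      then have "depends_upto j (\<lambda>x. emeasure (\<kappa> x) Y)"
        by (intro measurable_filt_depends_upto filt)
      then show ?thesis
        using 2(1) unfolding depends_upto_def by (metis leD upd_nth)
    qed
  qed
  have XU: "upd x i a \<in> X \<longleftrightarrow> x \<in> X" for x a
    by (rule X) auto
  have "emeasure \<pi> ((X \<inter> {x. x $ i \<in> A}) \<times> Y)
      = (\<integral>\<^sup>+x. indicator (X \<inter> {x. x $ i \<in> A}) x * emeasure (\<kappa> x) Y \<partial>vec_PiM P)"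
    by (intro dis) measurable
  also have "\<dots> = (\<integral>\<^sup>+x. \<integral>\<^sup>+a. indicator (X \<inter> {x. x $ i \<in> A}) (upd x i a) * emeasure (\<kappa> (upd x i a)) Y \<partial>P \<partial>vec_PiM P)"
    by (rule nn_integral_vec_PiM_resample[OF P]) measurable
  also have "\<dots> = (\<integral>\<^sup>+x. \<integral>\<^sup>+a. (indicator X x * emeasure (\<kappa> x) Y) * indicator A a \<partial>P \<partial>vec_PiM P)"
    by (intro nn_integral_cong) (auto simp: \<kappa>Y XU indicator_def)
  also have "\<dots> = (\<integral>\<^sup>+x. (indicator X x * emeasure (\<kappa> x) Y) * emeasure P A \<partial>vec_PiM P)"
    by (intro nn_integral_cong) (simp add: nn_integral_cmult_indicator P.events_eq_borel)
  also have "\<dots> = (\<integral>\<^sup>+x. indicator X x * emeasure (\<kappa> x) Y \<partial>vec_PiM P) * emeasure P A"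
    by (rule nn_integral_multc) measurable
  also have "\<dots> = emeasure P A * emeasure \<pi> (X \<times> Y)"
    by (simp add: dis mult.commute)
  finally show ?thesis .
qed

section \<open>Grid cells and the matching map\<close>

definition cells :: "nat \<Rightarrow> 'n::finite set \<Rightarrow> ('n \<Rightarrow> int) \<Rightarrow> (real, 'n) vec set" where
  "cells m J C = {x. \<forall>j\<in>J. \<lfloor>real m * x $ j\<rfloor> = C j}"

lemma cells_sets [measurable]:
  fixes C :: "'n::finite \<Rightarrow> int"
  shows "cells m J C \<in> sets borel"
proof -
  have "cells m J C = (\<Inter>j\<in>J. {x. \<lfloor>real m * x $ j\<rfloor> = C j})"
    by (auto simp: cells_def)
  also have "\<dots> \<in> sets borel"
    by (cases "J = {}") (auto intro!: sets.finite_INT)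
  finally show ?thesis .
qed

lemma vec_PiM_has_kernels:
  assumes P: "real_distribution P"
  shows "has_kernels (vec_PiM P) (\<lambda>_ _. P)"
  unfolding has_kernels_def using nn_integral_vec_PiM_resample[OF P] by blast

text \<open>Under a bicausal coupling of two product measures, the next pair of coordinates has the right
  marginals conditionally on the grid cell of the past. Realising these conditional couplings by
  interval exchanges that depend only on the cell of the past reproduces the mass of all cells.\<close>

theorem grid_matching_biadapted:
  fixes \<pi> :: "((real, 'n::{finite,linorder}) vec \<times> (real, 'n) vec) measure"
  defines "\<gamma> \<equiv> vec_PiM unif01 :: (real, 'n) vec measure"
  assumes c1: "causal \<pi> \<gamma> \<gamma>" and c2: "causal (distr \<pi> (borel \<Otimes>\<^sub>M borel) (\<lambda>(x, y). (y, x))) \<gamma> \<gamma>" and m: "m > 0"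
  shows "\<exists>T. biadapted T \<and> distr \<gamma> borel T = \<gamma> \<and>
    (\<forall>C D. emeasure \<gamma> {x \<in> cells m UNIV C. T x \<in> cells m UNIV D} = emeasure \<pi> (cells m UNIV C \<times> cells m UNIV D))"
proof -
  interpret U: real_distribution unif01 by (rule real_distribution_unif01)
  interpret \<gamma>: prob_space \<gamma> unfolding \<gamma>_def by (rule prob_space_vec_PiM[OF real_distribution_unif01])
  have [simp, measurable_cong]: "sets \<gamma> = sets borel" and [simp]: "space \<gamma> = UNIV"
    by (simp_all add: \<gamma>_def)
  have \<pi>: "prob_space \<pi>" and sets [measurable_cong]: "sets \<pi> = sets (borel \<Otimes>\<^sub>M borel)"
    using c1 by (auto simp: causal_def cpl_def)
  interpret \<pi>: prob_space \<pi> by (rule \<pi>)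
  have space: "space \<pi> = UNIV"
    using sets_eq_imp_space_eq[OF sets] by (simp add: space_pair_measure)
  have UU: "prob_space (unif01 \<Otimes>\<^sub>M unif01)"
    by (rule prob_space_pair) (rule U.prob_space_axioms)+
  define E where "E J C D = cells m J C \<times> cells m J D" for J :: "'n set" and C D
  have E [measurable]: "E J C D \<in> sets \<pi>" for J C D
    unfolding E_def sets by measurable
  have below: "x \<in> cells m {..<i} C \<longleftrightarrow> y \<in> cells m {..<i} C" if "\<And>j. j < i \<Longrightarrow> x $ j = y $ j" for i C x y
    using that by (auto simp: cells_def)
  have ind1: "emeasure \<pi> (E {..<i} C D \<inter> {z. fst z $ i \<in> A}) = emeasure unif01 A * emeasure \<pi> (E {..<i} C D)"
    if A [measurable]: "A \<in> sets borel" for i C D A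
  proof -
    have "E {..<i} C D \<inter> {z. fst z $ i \<in> A} = (cells m {..<i} C \<inter> {x. x $ i \<in> A}) \<times> cells m {..<i} D"
      by (auto simp: E_def)
    moreover have "emeasure \<pi> \<dots> = emeasure unif01 A * emeasure \<pi> (cells m {..<i} C \<times> cells m {..<i} D)"
      by (rule causal_next_coordinate_independent[OF real_distribution_unif01 c1[unfolded \<gamma>_def] A]) (auto intro!: below)
    ultimately show ?thesis
      by (simp add: E_def)
  qed
  \<comment> \<open>Here the causality of the swapped coupling enters.\<close>
  have ind2: "emeasure \<pi> (E {..<i} C D \<inter> {z. snd z $ i \<in> A}) = emeasure unif01 A * emeasure \<pi> (E {..<i} C D)"
    if A [measurable]: "A \<in> sets borel" for i C D A
  proof -
    let ?\<pi> = "distr \<pi> (borel \<Otimes>\<^sub>M borel) (\<lambda>(x, y). (y, x))"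
    have swap: "emeasure ?\<pi> (Y \<times> X) = emeasure \<pi> (X \<times> Y)" if "X \<in> sets borel" "Y \<in> sets borel" for X Y
      using that by (subst emeasure_distr) (auto simp: space intro!: arg_cong[where f="emeasure \<pi>"])
    have "E {..<i} C D \<inter> {z. snd z $ i \<in> A} = cells m {..<i} C \<times> (cells m {..<i} D \<inter> {x. x $ i \<in> A})"
      by (auto simp: E_def)
    then have "emeasure \<pi> (E {..<i} C D \<inter> {z. snd z $ i \<in> A}) = emeasure ?\<pi> ((cells m {..<i} D \<inter> {x. x $ i \<in> A}) \<times> cells m {..<i} C)"
      by (subst swap) (simp, measurable)
    also have "\<dots> = emeasure unif01 A * emeasure ?\<pi> (cells m {..<i} D \<times> cells m {..<i} C)"
      by (rule causal_next_coordinate_independent[OF real_distribution_unif01 c2[unfolded \<gamma>_def] A]) (auto intro!: below)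
    also have "\<dots> = emeasure unif01 A * emeasure \<pi> (E {..<i} C D)"
      by (subst swap) (auto simp: E_def)
    finally show ?thesis .
  qed
  \<comment> \<open>The law of the next pair of coordinates, given the cell of the past. Cells
    without mass get the product coupling, so that \<open>interval_exchange_coupling\<close> applies
    to all \<open>C\<close> and \<open>D\<close>.\<close>
  define \<rho> where "\<rho> i C D = (if emeasure \<pi> (E {..<i} C D) = 0 then unif01 \<Otimes>\<^sub>M unif01
    else distr (uniform_measure \<pi> (E {..<i} C D)) (borel \<Otimes>\<^sub>M borel) (\<lambda>z. (fst z $ i, snd z $ i)))" for i C D
  have \<rho>_meas: "(\<lambda>z. (fst z $ i, snd z $ i)) \<in> measurable (uniform_measure \<pi> (E J C D)) (borel \<Otimes>\<^sub>M borel)" for i J C D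
    by measurable
  have \<rho>_emeasure: "emeasure (\<rho> i C D) B = emeasure \<pi> (E {..<i} C D \<inter> {z. (fst z $ i, snd z $ i) \<in> B}) / emeasure \<pi> (E {..<i} C D)"
    if nz: "emeasure \<pi> (E {..<i} C D) \<noteq> 0" and B [measurable]: "B \<in> sets (borel \<Otimes>\<^sub>M borel)" for i C D B
  proof -
    have "emeasure (\<rho> i C D) B = emeasure (uniform_measure \<pi> (E {..<i} C D)) {z. (fst z $ i, snd z $ i) \<in> B}"
      using nz by (simp add: \<rho>_def emeasure_distr[OF \<rho>_meas B] space vimage_def)
    also have "{z \<in> space \<pi>. (fst z $ i, snd z $ i) \<in> B} \<in> sets \<pi>"
      by measurable
    then have "emeasure (uniform_measure \<pi> (E {..<i} C D)) {z. (fst z $ i, snd z $ i) \<in> B}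
        = emeasure \<pi> (E {..<i} C D \<inter> {z. (fst z $ i, snd z $ i) \<in> B}) / emeasure \<pi> (E {..<i} C D)"
      by (intro emeasure_uniform_measure E) (simp add: space)
    finally show ?thesis .
  qed
  have \<rho>_sets: "sets (\<rho> i C D) = sets (borel \<Otimes>\<^sub>M borel)" for i C D
    unfolding \<rho>_def by (auto intro!: sets_pair_measure_cong)
  have \<rho>_prob: "prob_space (\<rho> i C D)" for i C D
    unfolding \<rho>_def using UU
    by (auto intro!: prob_space.prob_space_distr[OF prob_space_uniform_measure \<rho>_meas])
  have \<rho>_fst: "distr (\<rho> i C D) borel fst = unif01" for i C D
  proof (cases "emeasure \<pi> (E {..<i} C D) = 0")
    case True
    then show ?thesis
      using U.distr_pair_fst[of unif01] U.emeasure_space_1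
      by (simp add: \<rho>_def cong: distr_cong)
  next
    case False
    show ?thesis
    proof (rule measure_eqI)
      fix A assume "A \<in> sets (distr (\<rho> i C D) borel fst)"
      then have A [measurable]: "A \<in> sets borel"
        by simp
      have "emeasure (distr (\<rho> i C D) borel fst) A = emeasure (\<rho> i C D) (A \<times> UNIV)"
        using sets_eq_imp_space_eq[OF \<rho>_sets, of i C D]
        by (subst emeasure_distr)
           (auto simp: measurable_cong_sets[OF \<rho>_sets refl] space_pair_measure intro!: arg_cong[where f="emeasure (\<rho> i C D)"])
      also have "\<dots> = emeasure unif01 A * emeasure \<pi> (E {..<i} C D) / emeasure \<pi> (E {..<i} C D)"
        using ind1[OF A, of i C D] False by (subst \<rho>_emeasure) auto
      also have "\<dots> = emeasure unif01 A"
        using False by (intro ennreal_mult_divide_eq) (auto simp: \<pi>.emeasure_eq_measure)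
      finally show "emeasure (distr (\<rho> i C D) borel fst) A = emeasure unif01 A" .
    qed simp
  qed
  have \<rho>_snd: "distr (\<rho> i C D) borel snd = unif01" for i C D
  proof (rule measure_eqI)
    fix A assume "A \<in> sets (distr (\<rho> i C D) borel snd)"
    then have A [measurable]: "A \<in> sets borel"
      by simp
    have *: "emeasure (distr (\<rho> i C D) borel snd) A = emeasure (\<rho> i C D) (UNIV \<times> A)"
      using sets_eq_imp_space_eq[OF \<rho>_sets, of i C D]
      by (subst emeasure_distr)
         (auto simp: measurable_cong_sets[OF \<rho>_sets refl] space_pair_measure intro!: arg_cong[where f="emeasure (\<rho> i C D)"])
    show "emeasure (distr (\<rho> i C D) borel snd) A = emeasure unif01 A"
    proof (cases "emeasure \<pi> (E {..<i} C D) = 0")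
      case True
      then have "emeasure (\<rho> i C D) (UNIV \<times> A) = emeasure unif01 UNIV * emeasure unif01 A"
        unfolding \<rho>_def by (simp add: U.emeasure_pair_measure_Times del: emeasure_uniform_measure)
      then show ?thesis
        using * U.emeasure_space_1 by simp
    next
      case False
      have "emeasure (\<rho> i C D) (UNIV \<times> A) = emeasure unif01 A * emeasure \<pi> (E {..<i} C D) / emeasure \<pi> (E {..<i} C D)"
        using ind2[OF A, of i C D] False by (subst \<rho>_emeasure) auto
      also have "\<dots> = emeasure unif01 A"
        using False by (intro ennreal_mult_divide_eq) (auto simp: \<pi>.emeasure_eq_measure)
      finally show ?thesis
        using * by simp
    qed
  qed simp
  define good where "good \<rho> s s' \<longleftrightarrow> s \<in> borel_measurable borel \<and> s' \<in> borel_measurable borel \<and>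
    (\<forall>a. s' (s a) = a) \<and> (\<forall>a. s (s' a) = a) \<and> distr unif01 borel s = unif01 \<and>
    (\<forall>I J. emeasure unif01 {a. \<lfloor>real m * a\<rfloor> = I \<and> \<lfloor>real m * s a\<rfloor> = J}
      = emeasure \<rho> {z. \<lfloor>real m * fst z\<rfloor> = I \<and> \<lfloor>real m * snd z\<rfloor> = J})" for \<rho> s s'
  have "\<exists>s s'. good (\<rho> i C D) s s'" for i C D
    unfolding good_def by (rule interval_exchange_coupling[OF \<rho>_prob \<rho>_sets \<rho>_fst \<rho>_snd m])
  then obtain s s' where good: "\<And>i C D. good (\<rho> i C D) (s i C D) (s' i C D)"
    by metis
  have s_meas: "\<And>i C D. s i C D \<in> borel_measurable borel" "\<And>i C D. s' i C D \<in> borel_measurable borel"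
    and s_inv: "\<And>i C D a. s' i C D (s i C D a) = a" "\<And>i C D a. s i C D (s' i C D a) = a"
    and s_push: "\<And>i C D. distr unif01 borel (s i C D) = unif01"
    and s_cell: "\<And>i C D I J. emeasure unif01 {a. \<lfloor>real m * a\<rfloor> = I \<and> \<lfloor>real m * s i C D a\<rfloor> = J}
      = emeasure (\<rho> i C D) {z. \<lfloor>real m * fst z\<rfloor> = I \<and> \<lfloor>real m * snd z\<rfloor> = J}"
    using good unfolding good_def by blast+
  \<comment> \<open>Coding the coordinates from \<open>i\<close> on by 0 yields a function of the
    strict past with values in a countable type.\<close>
  define past where "past i x = (\<lambda>j. if j < i then \<lfloor>real m * x $ j\<rfloor> else 0)" for i :: 'n and x
  have past_dep: "past i x = past i y" if "\<And>j. j < i \<Longrightarrow> x $ j = y $ j" for i x y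
    using that by (auto simp: past_def)
  have past_meas [measurable]: "past i \<in> measurable borel (count_space UNIV)" for i
    unfolding measurable_count_space_eq_countable[OF countableI_type]
  proof (intro conjI ballI)
    fix C :: "'n \<Rightarrow> int"
    have "past i -` {C} \<inter> space borel = {x. \<forall>j. (if j < i then \<lfloor>real m * x $ j\<rfloor> else 0) = C j}"
      by (simp add: past_def fun_eq_iff vimage_def)
    also have "\<dots> \<in> sets borel"
      by measurable
    finally show "past i -` {C} \<inter> space borel \<in> sets borel" .
  qed simp
  define \<phi> where "\<phi> i u v = s i (past i u) (past i v)" for i u v
  define \<psi> where "\<psi> i u v = s' i (past i u) (past i v)" for i u v
  have dep: "\<phi> i u v = \<phi> i u' v'" "\<psi> i u v = \<psi> i u' v'"
    if "\<And>j. j < i \<Longrightarrow> u $ j = u' $ j" "\<And>j. j < i \<Longrightarrow> v $ j = v' $ j" for i u u' v v'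
    using past_dep[OF that(1)] past_dep[OF that(2)] by (simp_all add: \<phi>_def \<psi>_def)
  \<comment> \<open>Joint measurability is glued from countably many pieces, one for each pair of
    past cells.\<close>
  have joint: "(\<lambda>(u, v, a). r (past i u) (past i v) a) \<in> borel_measurable (borel \<Otimes>\<^sub>M borel \<Otimes>\<^sub>M borel)"
    if r: "\<And>C D. r C D \<in> borel_measurable borel" for r :: "('n \<Rightarrow> int) \<Rightarrow> ('n \<Rightarrow> int) \<Rightarrow> real \<Rightarrow> real" and i
  proof -
    have 1: "(\<lambda>z. r C D (snd (snd z))) \<in> borel_measurable (borel \<Otimes>\<^sub>M borel \<Otimes>\<^sub>M borel)" for C D
      using measurable_compose[OF _ r, of "\<lambda>z. snd (snd z)"] by measurable
    have 2: "(\<lambda>z. r C (past i (fst (snd z))) (snd (snd z))) \<in> borel_measurable (borel \<Otimes>\<^sub>M borel \<Otimes>\<^sub>M borel)" for C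
      by (rule measurable_compose_countable[where f="\<lambda>D z. r C D (snd (snd z))" and g="\<lambda>z. past i (fst (snd z))", OF 1]) measurable
    have "(\<lambda>z. r (past i (fst z)) (past i (fst (snd z))) (snd (snd z))) \<in> borel_measurable (borel \<Otimes>\<^sub>M borel \<Otimes>\<^sub>M borel)"
      by (rule measurable_compose_countable[where f="\<lambda>C z. r C (past i (fst (snd z))) (snd (snd z))" and g="\<lambda>z. past i (fst z)", OF 2]) measurable
    then show ?thesis
      by (simp add: split_beta')
  qed
  have "\<exists>T. biadapted T \<and> (\<forall>u i. T u $ i = \<phi> i u (T u) (u $ i))"
  proof (rule biadapted_triangular_exists[where \<psi>=\<psi>])
    show "(\<lambda>(u, v, a). \<phi> i u v a) \<in> borel_measurable (borel \<Otimes>\<^sub>M borel \<Otimes>\<^sub>M borel)" for i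
      unfolding \<phi>_def by (rule joint) (rule s_meas)
    show "(\<lambda>(u, v, a). \<psi> i u v a) \<in> borel_measurable (borel \<Otimes>\<^sub>M borel \<Otimes>\<^sub>M borel)" for i
      unfolding \<psi>_def by (rule joint) (rule s_meas)
    show "\<psi> i u v (\<phi> i u v a) = a" "\<phi> i u v (\<psi> i u v a) = a" for i u v a
      by (simp_all add: \<phi>_def \<psi>_def s_inv)
  qed (rule dep; assumption)+
  then obtain T where T: "biadapted T" "\<And>u i. T u $ i = \<phi> i u (T u) (u $ i)"
    by blast
  have Tm [measurable]: "T \<in> borel_measurable borel" and Ta: "adapted T"
    using T by (auto simp: biadapted_def)
  have \<phi>_meas: "\<phi> i u v \<in> borel_measurable borel" and \<phi>_push: "distr unif01 borel (\<phi> i u v) = unif01" for i u v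
    using s_meas s_push by (simp_all add: \<phi>_def)
  have const: "(\<lambda>_. unif01) \<in> measurable borel (prob_algebra borel)"
    using U.prob_space_axioms by (intro measurable_const) (simp add: space_prob_algebra)
  have "has_kernels (distr \<gamma> borel T) (\<lambda>_ _. unif01)"
    unfolding \<gamma>_def
    by (rule triangular_push_has_kernels[where \<phi>=\<phi> and k="\<lambda>_ _. unif01",
          OF real_distribution_unif01 Tm Ta T(2) dep(1) \<phi>_meas \<phi>_push const])
  moreover have "has_kernels \<gamma> (\<lambda>_ _. unif01)"
    unfolding \<gamma>_def by (rule vec_PiM_has_kernels[OF real_distribution_unif01])
  moreover have "prob_on_borel \<gamma>" "prob_on_borel (distr \<gamma> borel T)"
    unfolding prob_on_borel_def using \<gamma>.prob_space_axioms \<gamma>.prob_space_distr[of T borel] by auto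
  ultimately have "distr \<gamma> borel T = \<gamma>"
    by (intro kernels_determine_measure[where k="\<lambda>_ _. unif01", OF _ _ const refl])
  define S where "S J C D = {x \<in> cells m J C. T x \<in> cells m J D}" for J :: "'n set" and C D
  have S_meas [measurable]: "S J C D \<in> sets borel" for J C D
    unfolding S_def by measurable
  have mass: "emeasure \<gamma> (S {..i} C D) = emeasure \<pi> (E {..i} C D)" for i C D
  proof (induction i rule: finite_linorder_less_induct)
    case (less i)
    have prev: "emeasure \<gamma> (S {..<i} C D) = emeasure \<pi> (E {..<i} C D)"
    proof (cases "{..<i} = {}")
      case True
      then have "S {..<i} C D = UNIV" "E {..<i} C D = UNIV"
        by (auto simp: S_def E_def cells_def)
      then show ?thesis
        using \<gamma>.emeasure_space_1 \<pi>.emeasure_space_1 space by simp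
    next
      case False
      then have "Max {..<i} < i" "{..<i} = {..Max {..<i}}"
        using Max_in[of "{..<i}"] by (auto simp del: Max_less_iff intro: order.strict_trans1)
      then show ?thesis
        using less by metis
    qed
    \<comment> \<open>\<open>C'\<close> and \<open>D'\<close> are \<open>C\<close> and
      \<open>D\<close> in the normal form produced by \<open>past i\<close>, so that
      \<open>s i C' D'\<close> is the exchange acting over \<open>S {..<i} C D\<close>.\<close>
    define C' where "C' = (\<lambda>j. if j < i then C j else 0)"
    define D' where "D' = (\<lambda>j. if j < i then D j else 0)"
    have E': "E {..<i} C' D' = E {..<i} C D"
      by (auto simp: E_def cells_def C'_def D'_def)
    define G where "G = {a. \<lfloor>real m * a\<rfloor> = C i \<and> \<lfloor>real m * s i C' D' a\<rfloor> = D i}"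
    have [measurable]: "G \<in> sets borel"
      using s_meas[measurable] unfolding G_def by measurable
    have Tb: "T (upd x i a) $ j = T x $ j" if "j < i" for x a j
      by (rule Ta[unfolded adapted_def, rule_format]) (use that in auto)
    have Ti: "T (upd x i a) $ i = s i (past i x) (past i (T x)) a" for x a
    proof -
      have "\<phi> i (upd x i a) (T (upd x i a)) = \<phi> i x (T x)"
        by (rule dep) (auto simp: Tb)
      then show ?thesis
        using T(2)[of "upd x i a" i] by (simp add: \<phi>_def)
    qed
    have past_cell: "past i x = C'" "past i (T x) = D'" if "x \<in> S {..<i} C D" for x
      using that by (auto simp: S_def cells_def past_def C'_def D'_def)
    have upto: "{..i} = insert i {..<i}"
      by auto
    \<comment> \<open>Over one past cell a single exchange acts, so the event is a condition on the
      past together with one on the fresh coordinate, and the integral factorises.\<close>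
    have ind: "upd x i a \<in> S {..i} C D \<longleftrightarrow> x \<in> S {..<i} C D \<and> a \<in> G" for x a
    proof -
      have "upd x i a \<in> S {..i} C D \<longleftrightarrow> x \<in> S {..<i} C D \<and> \<lfloor>real m * a\<rfloor> = C i \<and>
          \<lfloor>real m * s i (past i x) (past i (T x)) a\<rfloor> = D i"
        unfolding S_def cells_def upto by (auto simp: Tb Ti)
      then show ?thesis
        using past_cell[of x] by (auto simp: G_def)
    qed
    have "emeasure \<gamma> (S {..i} C D) = (\<integral>\<^sup>+x. indicator (S {..i} C D) x \<partial>\<gamma>)"
      by simp
    also have "\<dots> = (\<integral>\<^sup>+x. \<integral>\<^sup>+a. indicator (S {..i} C D) (upd x i a) \<partial>unif01 \<partial>\<gamma>)"
      unfolding \<gamma>_def by (rule nn_integral_vec_PiM_resample[OF real_distribution_unif01]) measurable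
    also have "\<dots> = (\<integral>\<^sup>+x. \<integral>\<^sup>+a. indicator (S {..<i} C D) x * indicator G a \<partial>unif01 \<partial>\<gamma>)"
      by (intro nn_integral_cong) (auto simp: ind indicator_def)
    also have "\<dots> = (\<integral>\<^sup>+x. indicator (S {..<i} C D) x * emeasure unif01 G \<partial>\<gamma>)"
      by (intro nn_integral_cong nn_integral_cmult_indicator) simp
    also have "\<dots> = (\<integral>\<^sup>+x. indicator (S {..<i} C D) x \<partial>\<gamma>) * emeasure unif01 G"
      by (rule nn_integral_multc) measurable
    also have "(\<integral>\<^sup>+x. indicator (S {..<i} C D) x \<partial>\<gamma>) = emeasure \<pi> (E {..<i} C D)"
      by (simp add: prev)
    also have "emeasure \<pi> (E {..<i} C D) * emeasure unif01 G
        = emeasure (\<rho> i C' D') {z. \<lfloor>real m * fst z\<rfloor> = C i \<and> \<lfloor>real m * snd z\<rfloor> = D i} * emeasure \<pi> (E {..<i} C D)"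
      unfolding G_def s_cell by (rule mult.commute)
    also have "\<dots> = emeasure \<pi> (E {..i} C D)"
    proof (cases "emeasure \<pi> (E {..<i} C D) = 0")
      case True
      have "emeasure \<pi> (E {..i} C D) \<le> emeasure \<pi> (E {..<i} C D)"
        by (rule emeasure_mono) (auto simp: E_def cells_def)
      with True show ?thesis
        by simp
    next
      case False
      have "{z :: real \<times> real. \<lfloor>real m * fst z\<rfloor> = C i \<and> \<lfloor>real m * snd z\<rfloor> = D i} \<in> sets (borel \<Otimes>\<^sub>M borel)"
      proof -
        have "{z \<in> space (borel \<Otimes>\<^sub>M borel). \<lfloor>real m * fst z\<rfloor> = C i \<and> \<lfloor>real m * snd z\<rfloor> = D i} \<in> sets (borel \<Otimes>\<^sub>M borel)"
          by measurable
        then show ?thesis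
          by (simp add: space_pair_measure)
      qed
      moreover have "E {..<i} C D \<inter> {z. (fst z $ i, snd z $ i) \<in> {z. \<lfloor>real m * fst z\<rfloor> = C i \<and> \<lfloor>real m * snd z\<rfloor> = D i}} = E {..i} C D"
        unfolding upto E_def cells_def by auto
      ultimately have "emeasure (\<rho> i C' D') {z. \<lfloor>real m * fst z\<rfloor> = C i \<and> \<lfloor>real m * snd z\<rfloor> = D i}
          = emeasure \<pi> (E {..i} C D) / emeasure \<pi> (E {..<i} C D)"
        using False by (subst \<rho>_emeasure) (simp_all add: E')
      then show ?thesis
        using False ennreal_mult_divide_eq[of "emeasure \<pi> (E {..<i} C D)" "emeasure \<pi> (E {..i} C D)"]
        by (simp add: ennreal_times_divide mult.commute \<pi>.emeasure_eq_measure)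
    qed
    finally show ?case .
  qed
  have "{..Max UNIV} = (UNIV :: 'n set)"
    by auto
  then have "emeasure \<gamma> {x \<in> cells m UNIV C. T x \<in> cells m UNIV D} = emeasure \<pi> (cells m UNIV C \<times> cells m UNIV D)" for C D
    using mass[of "Max UNIV" C D] by (simp add: S_def E_def)
  with T \<open>distr \<gamma> borel T = \<gamma>\<close> show ?thesis
    by blast
qed

section \<open>Convergence of couplings with fixed marginals\<close>

text \<open>The sets with convergence form a Dynkin system. For disjoint unions the limit passes
  through the series by Tannery's theorem: the fixed marginal \<open>\<mu>\<close> bounds the terms
  by the summable \<open>measure \<mu> (A i)\<close>, uniformly in \<open>n\<close>.\<close>

lemma tendsto_measure_vimage_inter:
  fixes Q :: "nat \<Rightarrow> 'c measure" and h :: "'c \<Rightarrow> 'a::topological_space"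
  assumes prob: "\<And>n. prob_space (Q n)" "prob_space L"
    and sets: "\<And>n. sets (Q n) = sets L" and [simp]: "space L = UNIV"
    and h: "h \<in> borel_measurable L" and R: "R \<in> sets L"
    and marg: "\<And>n. distr (Q n) borel h = \<mu>"
    and G: "Int_stable G" "sets borel = sigma_sets UNIV G"
    and R_conv: "(\<lambda>n. measure (Q n) R) \<longlonglongrightarrow> measure L R"
    and conv: "\<And>A. A \<in> G \<Longrightarrow> (\<lambda>n. measure (Q n) (h -` A \<inter> R)) \<longlonglongrightarrow> measure L (h -` A \<inter> R)"
    and A: "A \<in> sets borel"
  shows "(\<lambda>n. measure (Q n) (h -` A \<inter> R)) \<longlonglongrightarrow> measure L (h -` A \<inter> R)"
proof -
  interpret Q: prob_space "Q n" for n by (rule prob)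
  interpret L: prob_space L by (rule prob)
  have spaceQ [simp]: "space (Q n) = UNIV" for n
    using sets_eq_imp_space_eq[OF sets, of n] by simp
  have hR: "h -` A \<inter> R \<in> sets L" "h -` A \<in> sets L" if "A \<in> sets borel" for A
    using measurable_sets[OF h that] R by auto
  have hQ: "h \<in> borel_measurable (Q n)" for n
    using h by (simp add: measurable_cong_sets[OF sets refl])
  have \<mu>: "measure (Q n) (h -` A) = measure \<mu> A" if "A \<in> sets borel" for A n
    unfolding marg[symmetric, of n] using that hQ by (subst measure_distr) auto
  have fin\<mu>: "finite_measure \<mu>"
    unfolding marg[symmetric, of 0] by (intro Q.finite_measure_distr hQ)
  have sets\<mu>: "sets \<mu> = sets borel"
    unfolding marg[symmetric, of 0] by simp
  have "G \<subseteq> Pow UNIV"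
    by simp
  from G(1) this A[unfolded G(2)] show ?thesis
  proof (induction rule: sigma_sets_induct_disjoint)
    case (basic A)
    then show ?case by (rule conv)
  next
    case empty
    then show ?case by simp
  next
    case (compl A)
    then have A: "A \<in> sets borel"
      by (simp add: G(2))
    have eq: "h -` (UNIV - A) \<inter> R = R - (h -` A \<inter> R)"
      by auto
    have "measure (Q n) (R - (h -` A \<inter> R)) = measure (Q n) R - measure (Q n) (h -` A \<inter> R)" for n
      using hR[OF A] R sets by (intro Q.finite_measure_Diff) auto
    moreover have "measure L (R - (h -` A \<inter> R)) = measure L R - measure L (h -` A \<inter> R)"
      using hR[OF A] R by (intro L.finite_measure_Diff) auto
    ultimately show ?case
      unfolding eq using compl.IH R_conv by (auto intro: tendsto_diff)
  next
    case (union A)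
    then have A: "A i \<in> sets borel" for i
      by (auto simp: G(2))
    have dis: "disjoint_family (\<lambda>i. h -` A i \<inter> R)"
      using union(1) by (auto simp: disjoint_family_on_def)
    have eq: "h -` (\<Union>i. A i) \<inter> R = (\<Union>i. h -` A i \<inter> R)"
      by auto
    have "(\<lambda>i. measure (Q n) (h -` A i \<inter> R)) sums measure (Q n) (\<Union>i. h -` A i \<inter> R)" for n
      using hR[OF A] sets dis by (intro Q.finite_measure_UNION) auto
    then have Qs: "measure (Q n) (h -` (\<Union>i. A i) \<inter> R) = (\<Sum>i. measure (Q n) (h -` A i \<inter> R))" for n
      unfolding eq by (rule sums_unique)
    have "(\<lambda>i. measure L (h -` A i \<inter> R)) sums measure L (\<Union>i. h -` A i \<inter> R)"
      using hR[OF A] dis by (intro L.finite_measure_UNION) auto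
    then have Ls: "measure L (h -` (\<Union>i. A i) \<inter> R) = (\<Sum>i. measure L (h -` A i \<inter> R))"
      unfolding eq by (rule sums_unique)
    have "measure (Q n) (h -` A i \<inter> R) \<le> measure \<mu> (A i)" for n i
    proof -
      have "measure (Q n) (h -` A i \<inter> R) \<le> measure (Q n) (h -` A i)"
        using hR(2)[OF A[of i]] sets by (intro Q.finite_measure_mono) auto
      then show ?thesis
        by (simp add: \<mu>[OF A])
    qed
    then have bound: "\<forall>\<^sub>F (i, n) in at_top \<times>\<^sub>F sequentially. norm (measure (Q n) (h -` A i \<inter> R)) \<le> measure \<mu> (A i)"
      by (intro always_eventually) auto
    have "summable (\<lambda>i. measure \<mu> (A i))"
      using finite_measure.finite_measure_UNION[OF fin\<mu>, of A] union(1) A sets\<mu> by (auto simp: sums_iff)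
    from tannerys_theorem[OF union.IH bound this] show ?case
      unfolding Qs Ls by simp
  qed
qed

text \<open>One factor is extended at a time: first all Borel \<open>A\<close> against
  \<open>B\<close> in the generator, then all Borel \<open>B\<close> against a fixed Borel
  \<open>A\<close>.\<close>

lemma tendsto_measure_Times:
  fixes Q :: "nat \<Rightarrow> ('a::topological_space \<times> 'b::topological_space) measure"
  assumes prob: "\<And>n. prob_space (Q n)" "prob_space L"
    and sets: "\<And>n. sets (Q n) = sets (borel \<Otimes>\<^sub>M borel)" "sets L = sets (borel \<Otimes>\<^sub>M borel)"
    and fst: "\<And>n. distr (Q n) borel fst = \<mu>" "distr L borel fst = \<mu>"
    and snd: "\<And>n. distr (Q n) borel snd = \<nu>" "distr L borel snd = \<nu>"
    and G: "Int_stable G" "sets borel = sigma_sets UNIV G" and H: "Int_stable H" "sets borel = sigma_sets UNIV H"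
    and conv: "\<And>A B. A \<in> G \<Longrightarrow> B \<in> H \<Longrightarrow> (\<lambda>n. measure (Q n) (A \<times> B)) \<longlonglongrightarrow> measure L (A \<times> B)"
    and A: "A \<in> sets borel" and B: "B \<in> sets borel"
  shows "(\<lambda>n. measure (Q n) (A \<times> B)) \<longlonglongrightarrow> measure L (A \<times> B)"
proof -
  have space: "space L = UNIV" "space (Q n) = UNIV" for n
    using sets_eq_imp_space_eq[OF sets(2)] sets_eq_imp_space_eq[OF sets(1), of n] by (simp_all add: space_pair_measure)
  have sets': "sets (Q n) = sets L" for n
    by (simp add: sets)
  have fst_m: "fst \<in> borel_measurable L" "fst \<in> borel_measurable (Q n)"
    and snd_m: "snd \<in> borel_measurable L" "snd \<in> borel_measurable (Q n)" for n
    by (auto simp: measurable_cong_sets[OF sets(2) refl] measurable_cong_sets[OF sets(1) refl])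
  have fstS: "fst -` A \<in> sets L" if "A \<in> sets borel" for A
    using measurable_sets[OF fst_m(1) that] space by simp
  have sndS: "snd -` B \<in> sets L" if "B \<in> sets borel" for B
    using measurable_sets[OF snd_m(1) that] space by simp
  have mfst: "measure (Q n) (fst -` A) = measure L (fst -` A)" if "A \<in> sets borel" for A n
    using measure_distr[OF fst_m(2) that, of n] measure_distr[OF fst_m(1) that] fst space by simp
  have msnd: "measure (Q n) (snd -` B) = measure L (snd -` B)" if "B \<in> sets borel" for B n
    using measure_distr[OF snd_m(2) that, of n] measure_distr[OF snd_m(1) that] snd space by simp
  have times: "A \<times> B = fst -` A \<inter> snd -` B" "A \<times> B = snd -` B \<inter> fst -` A" for A :: "'a set" and B :: "'b set"
    by auto
  have "(\<lambda>n. measure (Q n) (A \<times> B)) \<longlonglongrightarrow> measure L (A \<times> B)" if "B \<in> H" for B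
  proof -
    have B: "B \<in> sets borel"
      using that H(2) by auto
    show ?thesis
      unfolding times(1)
      by (rule tendsto_measure_vimage_inter[OF prob sets' space(1) fst_m(1) sndS[OF B] fst(1) G _ _ A])
         (simp add: msnd[OF B], use conv[OF _ that] in \<open>simp add: times(1)\<close>)
  qed
  then show ?thesis
    unfolding times(2)
    by (intro tendsto_measure_vimage_inter[OF prob sets' space(1) snd_m(1) fstS[OF A] snd(1) H _ _ B])
       (simp_all add: mfst[OF A])
qed

section \<open>From rectangles to bounded continuous test functions\<close>

lemma compact_finite_borel_partition:
  fixes K :: "'a::metric_space set"
  assumes K: "compact K" and \<delta>: "\<delta> > 0"
  shows "\<exists>n c. \<exists>A :: nat \<Rightarrow> 'a set. (\<forall>i<n. A i \<in> sets borel \<and> A i \<subseteq> ball (c i) \<delta> \<and> c i \<in> K) \<and>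
    disjoint_family_on A {..<n} \<and> (\<Union>i<n. A i) = K"
proof -
  obtain k where k: "finite k" "k \<subseteq> K" "K \<subseteq> (\<Union>x\<in>k. ball x \<delta>)"
    using compactE_image[OF K, of K "\<lambda>x. ball x \<delta>"] \<delta>
    by (metis UN_I centre_in_ball open_ball subsetI)
  obtain n and c :: "nat \<Rightarrow> 'a" where c: "k = c ` {..<n}"
    using finite_imp_nat_seg_image_inj_on[OF k(1)] by (auto simp: lessThan_def)
  define B where "B i = (if i < n then K \<inter> ball (c i) \<delta> else {})" for i
  have B: "range B \<subseteq> sets borel"
    using compact_imp_closed[OF K] by (auto simp: B_def)
  have "disjointed B i \<subseteq> B i" for i
    by (rule disjointed_subset)
  then have "disjointed B i \<subseteq> ball (c i) \<delta>" if "i < n" for i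
    using that by (fastforce simp: B_def)
  moreover have "(\<Union>i<n. disjointed B i) = K"
  proof -
    have "(\<Union>i. disjointed B i) = (\<Union>i. B i)"
      by (rule UN_disjointed_eq)
    also have "\<dots> = K"
      using k(3) unfolding c B_def by (auto split: if_splits)
    finally have "(\<Union>i. disjointed B i) = K" .
    moreover have "disjointed B i = {}" if "\<not> i < n" for i
      using \<open>disjointed B i \<subseteq> B i\<close> that by (simp add: B_def)
    then have "(\<Union>i. disjointed B i) = (\<Union>i<n. disjointed B i)"
      using UN_mono[of "{..<n}" UNIV "disjointed B" "disjointed B"]
    proof (intro equalityI UN_least)
      fix i show "disjointed B i \<subseteq> (\<Union>i<n. disjointed B i)"
        using \<open>\<And>i. \<not> i < n \<Longrightarrow> disjointed B i = {}\<close>[of i] by (cases "i < n") auto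
    qed auto
    ultimately show ?thesis
      by simp
  qed
  moreover have "disjoint_family_on (disjointed B) {..<n}"
    using disjoint_family_disjointed[of B] by (rule disjoint_family_on_mono[rotated]) simp
  moreover have "disjointed B i \<in> sets borel" for i
    using sets.range_disjointed_sets[OF B] by auto
  ultimately show ?thesis
    using k(2) c by (intro exI[of _ n] exI[of _ c] exI[of _ "disjointed B"]) auto
qed

text \<open>On a compact square \<open>f\<close> is uniformly close to a step function over finitely
  many rectangles, whose integrals converge. The square is chosen for \<open>L\<close> alone;
  convergence of its own mass makes it nearly full for the \<open>Q k\<close> too.\<close>

lemma integral_tendsto_if_Times_tendsto:
  fixes Q :: "nat \<Rightarrow> ('a::euclidean_space \<times> 'a) measure"
  assumes prob: "\<And>n. prob_space (Q n)" "prob_space L"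
    and sets: "\<And>n. sets (Q n) = sets (borel \<Otimes>\<^sub>M borel)" "sets L = sets (borel \<Otimes>\<^sub>M borel)"
    and conv: "\<And>A B. A \<in> sets borel \<Longrightarrow> B \<in> sets borel \<Longrightarrow> (\<lambda>n. measure (Q n) (A \<times> B)) \<longlonglongrightarrow> measure L (A \<times> B)"
    and f: "bdd_cont f"
  shows "(\<lambda>n. \<integral>z. f z \<partial>Q n) \<longlonglongrightarrow> (\<integral>z. f z \<partial>L)"
proof (rule LIMSEQ_I)
  fix e :: real assume e: "e > 0"
  obtain b where b: "\<And>z. \<bar>f z\<bar> \<le> b" and fc: "continuous_on UNIV f"
    using f by (auto simp: bdd_cont_def)
  have b0: "0 \<le> b"
    using b[of 0] by linarith
  \<comment> \<open>The mass allowed outside the compact square; \<open>b + 1\<close> keeps the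
    quotient meaningful when \<open>b\<close> is 0.\<close>
  define \<eta> where "\<eta> = e / (8 * (b + 1))"
  have \<eta>: "\<eta> > 0" "b * \<eta> \<le> e / 8"
    using e b0 by (auto simp: \<eta>_def field_simps)
  interpret L: prob_space L by (rule prob)
  have spaceL: "space L = UNIV"
    using sets_eq_imp_space_eq[OF sets(2)] by (simp add: space_pair_measure)
  have "(\<lambda>n. measure L (cball 0 (real n) \<times> cball 0 (real n))) \<longlonglongrightarrow> measure L (\<Union>n. cball 0 (real n) \<times> cball 0 (real n))"
    using sets by (intro L.finite_Lim_measure_incseq) (auto simp: incseq_def)
  also have "(\<Union>n. cball (0::'a) (real n) \<times> cball (0::'a) (real n)) = UNIV"
  proof safe
    fix x y :: 'a
    obtain n where "max (norm x) (norm y) \<le> real n"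
      using real_arch_simple by blast
    then show "(x, y) \<in> (\<Union>n. cball 0 (real n) \<times> cball 0 (real n))"
      by auto
  qed simp
  also have "measure L UNIV = 1"
    using L.prob_space spaceL by simp
  finally have "\<forall>\<^sub>F n in sequentially. 1 - \<eta> < measure L (cball 0 (real n) \<times> cball 0 (real n))"
    by (rule order_tendstoD) (use \<eta> in simp)
  then obtain r where r: "1 - \<eta> < measure L (cball 0 (real r) \<times> cball 0 (real r))"
    by (auto simp: eventually_sequentially)
  define K where "K = cball (0::'a) (real r)"
  have K: "compact K" "K \<in> sets borel"
    by (auto simp: K_def)
  have "uniformly_continuous_on (K \<times> K) f"
    using fc K by (intro compact_uniformly_continuous compact_Times) (auto intro: continuous_on_subset)
  from this[unfolded uniformly_continuous_on_def, THEN spec, of "e / 8"] e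
  obtain d where d: "d > 0" and "\<forall>z\<in>K \<times> K. \<forall>z'\<in>K \<times> K. dist z' z < d \<longrightarrow> dist (f z') (f z) < e / 8"
    by (auto simp del: mem_Sigma_iff)
  then have d2: "dist (f z') (f z) < e / 8" if "z \<in> K \<times> K" "z' \<in> K \<times> K" "dist z' z < d" for z z'
    using that by blast
  have "d / 2 > 0"
    using d by simp
  from compact_finite_borel_partition[OF K(1) this] obtain n c and A :: "nat \<Rightarrow> 'a set"
    where *: "\<forall>i<n. A i \<in> sets borel \<and> A i \<subseteq> ball (c i) (d / 2) \<and> c i \<in> K"
      and dis: "disjoint_family_on A {..<n}" and un: "(\<Union>i<n. A i) = K"
    by (elim exE conjE) (rule that)
  have A: "A i \<in> sets borel" "A i \<subseteq> ball (c i) (d / 2)" "c i \<in> K" if "i < n" for i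
    using * that by auto
  define g where "g z = (\<Sum>i<n. \<Sum>j<n. f (c i, c j) * indicator (A i \<times> A j) z)" for z
  have g_in: "g z = f (c i, c j)" if "z \<in> A i \<times> A j" "i < n" "j < n" for z i j
  proof -
    have "indicator (A i' \<times> A j') z = (if i' = i \<and> j' = j then 1 else 0 :: real)" if "i' < n" "j' < n" for i' j'
      using dis \<open>z \<in> A i \<times> A j\<close> that \<open>i < n\<close> \<open>j < n\<close> unfolding disjoint_family_on_def
      by (auto simp: indicator_def)
    then have "g z = (\<Sum>i'<n. \<Sum>j'<n. if i' = i \<and> j' = j then f (c i, c j) else 0)"
      unfolding g_def by (intro sum.cong) auto
    also have "\<dots> = (\<Sum>i'<n. if i' = i then f (c i, c j) else 0)"
      using that by (intro sum.cong) auto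
    also have "\<dots> = f (c i, c j)"
      using that by simp
    finally show ?thesis .
  qed
  have g_out: "g z = 0" if "z \<notin> K \<times> K" for z
    unfolding g_def using that un by (intro sum.neutral ballI) (auto simp: indicator_def)
  have fg: "\<bar>f z - g z\<bar> \<le> e / 8 + b * indicator (- (K \<times> K)) z" for z
  proof (cases "z \<in> K \<times> K")
    case True
    then obtain i j where ij: "z \<in> A i \<times> A j" "i < n" "j < n"
      using un by auto
    have "dist (fst z) (c i) < d / 2" "dist (snd z) (c j) < d / 2"
      using ij A(2)[of i] A(2)[of j] by (auto simp: dist_commute)
    then have "dist z (c i, c j) < d"
      unfolding dist_prod_def using sqrt_sum_squares_le_sum_abs[of "dist (fst z) (c i)" "dist (snd z) (c j)"]
      by auto
    then have "dist (f z) (f (c i, c j)) < e / 8"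
      using True ij A(3) by (intro d2) auto
    then show ?thesis
      using g_in[OF ij] True by (simp add: dist_real_def)
  next
    case False
    then show ?thesis
      using g_out[OF False] b[of z] e by simp
  qed
  have KK: "K \<times> K \<in> sets (borel \<Otimes>\<^sub>M borel)"
    using K by auto
  have approx: "\<bar>(\<integral>z. f z \<partial>R) - (\<integral>z. g z \<partial>R)\<bar> \<le> e / 8 + b * (1 - measure R (K \<times> K))"
    and g_int: "(\<integral>z. g z \<partial>R) = (\<Sum>i<n. \<Sum>j<n. f (c i, c j) * measure R (A i \<times> A j))"
    if R: "prob_space R" "sets R = sets (borel \<Otimes>\<^sub>M borel)" for R
  proof -
    interpret R: prob_space R by (rule R)
    have spaceR: "space R = UNIV"
      using sets_eq_imp_space_eq[OF R(2)] by (simp add: space_pair_measure)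
    have AA: "A i \<times> A j \<in> sets R" if "i < n" "j < n" for i j
      using A(1) that R(2) by auto
    have i: "integrable R (\<lambda>z. f (c i, c j) * indicator (A i \<times> A j) z)" if "i < n" "j < n" for i j
      using AA[OF that] by (intro integrable_mult_right integrable_real_indicator) (auto simp: less_top[symmetric])
    have gi: "integrable R g"
      unfolding g_def using i by (intro Bochner_Integration.integrable_sum) auto
    have "(\<integral>z. g z \<partial>R) = (\<Sum>i<n. \<integral>z. (\<Sum>j<n. f (c i, c j) * indicator (A i \<times> A j) z) \<partial>R)"
      unfolding g_def using i by (intro Bochner_Integration.integral_sum Bochner_Integration.integrable_sum) auto
    also have "\<dots> = (\<Sum>i<n. \<Sum>j<n. \<integral>z. f (c i, c j) * indicator (A i \<times> A j) z \<partial>R)"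
      using i by (intro sum.cong refl Bochner_Integration.integral_sum) auto
    also have "\<dots> = (\<Sum>i<n. \<Sum>j<n. f (c i, c j) * measure R (A i \<times> A j))"
      unfolding integral_mult_right_zero by (simp add: spaceR)
    finally show "(\<integral>z. g z \<partial>R) = (\<Sum>i<n. \<Sum>j<n. f (c i, c j) * measure R (A i \<times> A j))" .
    have "f \<in> borel_measurable R"
      using borel_measurable_continuous_onI[OF fc] by (simp add: measurable_cong_sets[OF R(2) refl] borel_prod)
    then have fi: "integrable R f"
      using b by (intro R.integrable_const_bound[where B=b]) auto
    have "- (K \<times> K) \<in> sets R"
      using KK R(2) sets.compl_sets[of "K \<times> K" R] spaceR by (simp add: Compl_eq_Diff_UNIV)
    then have ii: "integrable R (\<lambda>z. indicator (- (K \<times> K)) z :: real)"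
      by (intro integrable_real_indicator) (auto simp: less_top[symmetric])
    have "\<bar>(\<integral>z. f z \<partial>R) - (\<integral>z. g z \<partial>R)\<bar> = \<bar>\<integral>z. f z - g z \<partial>R\<bar>"
      using fi gi by simp
    also have "\<dots> \<le> (\<integral>z. \<bar>f z - g z\<bar> \<partial>R)"
      by (rule integral_abs_bound)
    also have "\<dots> \<le> (\<integral>z. e / 8 + b * indicator (- (K \<times> K)) z \<partial>R)"
      using fi gi ii fg by (intro integral_mono) auto
    also have "\<dots> = e / 8 + b * measure R (- (K \<times> K))"
      using ii by (simp add: spaceR R.prob_space[unfolded spaceR])
    also have "measure R (- (K \<times> K)) = 1 - measure R (K \<times> K)"
      using R.prob_compl[of "K \<times> K"] KK R(2) by (simp add: spaceR Compl_eq_Diff_UNIV)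
    finally show "\<bar>(\<integral>z. f z \<partial>R) - (\<integral>z. g z \<partial>R)\<bar> \<le> e / 8 + b * (1 - measure R (K \<times> K))" .
  qed
  have "(\<lambda>k. \<integral>z. g z \<partial>Q k) \<longlonglongrightarrow> (\<integral>z. g z \<partial>L)"
    unfolding g_int[OF prob(1) sets(1)] g_int[OF prob(2) sets(2)]
    using A(1) by (intro tendsto_sum tendsto_mult tendsto_const conv) auto
  then have "\<forall>\<^sub>F k in sequentially. dist (\<integral>z. g z \<partial>Q k) (\<integral>z. g z \<partial>L) < e / 8"
    using e by (intro tendstoD) auto
  moreover have "\<forall>\<^sub>F k in sequentially. 1 - \<eta> < measure (Q k) (K \<times> K)"
    using conv[OF K(2) K(2)] by (rule order_tendstoD) (use r in \<open>simp add: K_def\<close>)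
  ultimately have "\<forall>\<^sub>F k in sequentially. norm ((\<integral>z. f z \<partial>Q k) - (\<integral>z. f z \<partial>L)) < e"
  proof eventually_elim
    case (elim k)
    \<comment> \<open>Replacing \<open>f\<close> by \<open>g\<close> costs at most
      \<open>e / 8 + e / 8\<close> under each of the two measures and the integrals of
      \<open>g\<close> differ by less than \<open>e / 8\<close>, in total less than
      \<open>e\<close>.\<close>
    have "b * (1 - measure (Q k) (K \<times> K)) \<le> b * \<eta>" "b * (1 - measure L (K \<times> K)) \<le> b * \<eta>"
      using elim r b0 by (auto intro!: mult_left_mono simp: K_def)
    then show ?case
      using approx[OF prob(1) sets(1), of k] approx[OF prob(2) sets(2)] elim(1) \<eta>(2) e
      unfolding dist_real_def real_norm_def by linarith
  qed
  then show "\<exists>no. \<forall>n\<ge>no. norm ((\<integral>z. f z \<partial>Q n) - (\<integral>z. f z \<partial>L)) < e"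
    by (simp add: eventually_sequentially)
qed

section \<open>Grids, causality and change of coordinates\<close>

definition grid :: "nat \<Rightarrow> (real, 'n::finite) vec \<Rightarrow> 'n \<Rightarrow> int" where
  "grid m x = (\<lambda>j. \<lfloor>real m * x $ j\<rfloor>)"

lemma cells_UNIV_eq: "cells m UNIV C = grid m -` {C}"
  by (auto simp: cells_def grid_def fun_eq_iff)

lemma measurable_grid [measurable]: "grid m \<in> measurable borel (count_space UNIV)"
  unfolding measurable_count_space_eq_countable[OF countableI_type]
proof (intro conjI ballI)
  show "grid m -` {C} \<inter> space borel \<in> sets borel" for C :: "'a \<Rightarrow> int"
    using cells_sets[of m UNIV C] by (simp add: cells_UNIV_eq)
qed simp

text \<open>Nestedness is why the meshes are powers of 2: a union of cells of one level remains such
  a union at every finer level.\<close>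

lemma grid_refine:
  assumes "l \<le> k"
  shows "grid (2 ^ l) x = (\<lambda>j. grid (2 ^ k) x j div 2 ^ (k - l))"
proof
  fix j
  have "real (2 ^ l) * x $ j = real (2 ^ k) * x $ j / real_of_int (2 ^ (k - l))"
  proof -
    have "(2::real) ^ k = 2 ^ l * 2 ^ (k - l)"
      using assms by (simp flip: power_add)
    then show ?thesis
      by simp
  qed
  then have "\<lfloor>real (2 ^ l) * x $ j\<rfloor> = \<lfloor>real (2 ^ k) * x $ j / real_of_int (2 ^ (k - l))\<rfloor>"
    by (rule arg_cong)
  also have "\<dots> = \<lfloor>real (2 ^ k) * x $ j\<rfloor> div 2 ^ (k - l)"
    by (rule floor_divide_real_eq_div) simp
  finally show "grid (2 ^ l) x j = grid (2 ^ k) x j div 2 ^ (k - l)"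
    by (simp add: grid_def)
qed

text \<open>Arbitrary, possibly infinite, unions of cells of a single dyadic level. They form a
  generator stable under intersection, and from some level on the grid matching reproduces the mass
  of their products exactly.\<close>

definition grid_sets :: "(real, 'n::finite) vec set set" where
  "grid_sets = {grid (2 ^ l) -` S | l S. True}"

lemma grid_sets_refine:
  assumes "A \<in> grid_sets"
  shows "\<exists>l. \<forall>k\<ge>l. \<exists>S. A = grid (2 ^ k) -` S"
proof -
  obtain l S where A: "A = grid (2 ^ l) -` S"
    using assms by (auto simp: grid_sets_def)
  have "A = grid (2 ^ k) -` {C. (\<lambda>j. C j div 2 ^ (k - l)) \<in> S}" if "l \<le> k" for k
    using grid_refine[OF that] by (auto simp: A)
  then show ?thesis
    by blast
qed

lemma Int_stable_grid_sets: "Int_stable (grid_sets :: (real, 'n::finite) vec set set)"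
proof (rule Int_stableI)
  fix A B :: "(real, 'n) vec set" assume "A \<in> grid_sets" "B \<in> grid_sets"
  then obtain l l' where l: "\<forall>k\<ge>l. \<exists>S. A = grid (2 ^ k) -` S" "\<forall>k\<ge>l'. \<exists>S. B = grid (2 ^ k) -` S"
    using grid_sets_refine by metis
  obtain S S' where "A = grid (2 ^ max l l') -` S" "B = grid (2 ^ max l l') -` S'"
    using l by (meson max.cobounded1 max.cobounded2)
  then have "A \<inter> B = grid (2 ^ max l l') -` (S \<inter> S')"
    by auto
  then show "A \<inter> B \<in> grid_sets"
    unfolding grid_sets_def by blast
qed

text \<open>An open half-space is filled from inside by dyadic cells: \<open>x $ j < a\<close> holds
  iff at some level the cell of \<open>x\<close> has its upper end in direction \<open>j\<close> at
  most \<open>a\<close>.\<close>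

lemma sets_borel_grid_sets: "sets borel = sigma_sets UNIV (grid_sets :: (real, 'n::finite) vec set set)"
proof
  have "grid_sets \<subseteq> sets (borel :: (real, 'n) vec measure)"
  proof
    fix A :: "(real, 'n) vec set" assume "A \<in> grid_sets"
    then obtain l S where A: "A = grid (2 ^ l) -` S"
      by (auto simp: grid_sets_def)
    show "A \<in> sets borel"
      using measurable_sets[OF measurable_grid, of S "2 ^ l"] by (simp add: A)
  qed
  then show "sigma_sets UNIV grid_sets \<subseteq> sets (borel :: (real, 'n) vec measure)"
    using sets.sigma_sets_subset[of grid_sets "borel :: (real, 'n) vec measure"] by simp
  have half: "{x :: (real, 'n) vec. x $ j < a} \<in> sigma_sets UNIV grid_sets" for j a
  proof -
    have "x $ j < a \<longleftrightarrow> (\<exists>l. real_of_int (grid (2 ^ l) x j) + 1 \<le> 2 ^ l * a)" for x :: "(real, 'n) vec"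
    proof
      assume "x $ j < a"
      obtain l where "1 / (a - x $ j) < 2 ^ l"
        using real_arch_pow[of 2] by auto
      then have "1 \<le> 2 ^ l * (a - x $ j)"
        using \<open>x $ j < a\<close> by (simp add: field_simps)
      then have "real_of_int (grid (2 ^ l) x j) + 1 \<le> 2 ^ l * a"
        by (simp add: grid_def right_diff_distrib) linarith
      then show "\<exists>l. real_of_int (grid (2 ^ l) x j) + 1 \<le> 2 ^ l * a" ..
    next
      assume "\<exists>l. real_of_int (grid (2 ^ l) x j) + 1 \<le> 2 ^ l * a"
      then obtain l where "real_of_int (grid (2 ^ l) x j) + 1 \<le> 2 ^ l * a" ..
      moreover have "2 ^ l * x $ j < real_of_int \<lfloor>2 ^ l * x $ j\<rfloor> + 1"
        by linarith
      ultimately have "2 ^ l * x $ j < 2 ^ l * a"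
        by (simp only: grid_def of_nat_power of_nat_numeral)
      then show "x $ j < a"
        by simp
    qed
    then have "{x :: (real, 'n) vec. x $ j < a} = (\<Union>l. grid (2 ^ l) -` {C. real_of_int (C j) + 1 \<le> 2 ^ l * a})"
      by auto
    also have "\<dots> \<in> sigma_sets UNIV grid_sets"
      by (intro sigma_sets.Union sigma_sets.Basic) (unfold grid_sets_def, blast)
    finally show ?thesis .
  qed
  show "sets (borel :: (real, 'n) vec measure) \<subseteq> sigma_sets UNIV grid_sets"
    unfolding borel_eq_halfspace_less[where 'a="(real, 'n) vec"]
    by (subst sets_measure_of, simp, intro sigma_sets_mono)
       (auto simp: Basis_vec_def inner_axis half)
qed

text \<open>Pairs of cell indices form a countable type, so the image measures on them are
  determined by single points, that is, by products of cells.\<close>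

lemma measure_grid_Times_eq:
  fixes Q L :: "((real, 'n::finite) vec \<times> (real, 'n) vec) measure"
  assumes sets: "sets Q = sets (borel \<Otimes>\<^sub>M borel)" "sets L = sets (borel \<Otimes>\<^sub>M borel)"
    and eq: "\<And>C D. emeasure Q (cells m UNIV C \<times> cells m UNIV D) = emeasure L (cells m UNIV C \<times> cells m UNIV D)"
  shows "emeasure Q (grid m -` S \<times> grid m -` S') = emeasure L (grid m -` S \<times> grid m -` S')"
proof -
  define h where "h = (\<lambda>(x, y). (grid m x, grid m y) :: ('n \<Rightarrow> int) \<times> ('n \<Rightarrow> int))"
  have pre: "h -` {(C, D)} = cells m UNIV C \<times> cells m UNIV D" for C D
    by (auto simp: h_def cells_UNIV_eq)
  have h: "h \<in> measurable (borel \<Otimes>\<^sub>M borel) (count_space UNIV)"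
    unfolding measurable_count_space_eq_countable[OF countableI_type]
    by (auto simp: pre space_pair_measure)
  have hQ: "h \<in> measurable Q (count_space UNIV)" and hL: "h \<in> measurable L (count_space UNIV)"
    using h by (simp_all add: measurable_cong_sets[OF sets(1) refl] measurable_cong_sets[OF sets(2) refl])
  have space: "space Q = UNIV" "space L = UNIV"
    using sets_eq_imp_space_eq[OF sets(1)] sets_eq_imp_space_eq[OF sets(2)] by (simp_all add: space_pair_measure)
  have "distr Q (count_space UNIV) h = distr L (count_space UNIV) h"
  proof (rule measure_eqI_countable[where A=UNIV])
    fix a :: "('n \<Rightarrow> int) \<times> ('n \<Rightarrow> int)"
    show "emeasure (distr Q (count_space UNIV) h) {a} = emeasure (distr L (count_space UNIV) h) {a}"
      using eq[of "fst a" "snd a"] pre[of "fst a" "snd a"] by (simp add: emeasure_distr[OF hQ] emeasure_distr[OF hL] space)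
  qed auto
  then have "emeasure (distr Q (count_space UNIV) h) (S \<times> S') = emeasure (distr L (count_space UNIV) h) (S \<times> S')"
    by simp
  moreover have "h -` (S \<times> S') = grid m -` S \<times> grid m -` S'"
    by (auto simp: h_def)
  ultimately show ?thesis
    by (simp add: emeasure_distr[OF hQ] emeasure_distr[OF hL] space)
qed

section \<open>Causality under biadapted maps\<close>

lemma adapted_vimage_filt:
  assumes T: "T \<in> borel_measurable borel" "adapted T" and B: "B \<in> sets (filt i)"
  shows "T -` B \<in> sets (filt i)"
proof -
  have [measurable]: "T \<in> borel_measurable borel" "B \<in> sets borel"
    using T sets_filt_borel[OF B] by auto
  have "depends_upto i (\<lambda>x. T x \<in> B)"
    unfolding depends_upto_def
  proof (intro allI impI)
    fix x y :: "(real, 'a) vec" assume *: "\<forall>j\<le>i. x $ j = y $ j"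
    have "\<forall>j\<le>i. T x $ j = T y $ j"
      using T(2) * unfolding adapted_def by (meson order_trans)
    then show "(T x \<in> B) = (T y \<in> B)"
      using sets_filt_depends_upto[OF B] unfolding depends_upto_def by blast
  qed
  then have "Measurable.pred (filt i) (\<lambda>x. T x \<in> B)"
    by (intro measurable_filt_if_depends_upto) measurable
  then show ?thesis
    by (simp add: pred_def vimage_def)
qed

text \<open>The new kernel at \<open>u\<close> is the image under \<open>\<Psi>\<close> of the old
  kernel at \<open>inv \<Phi> u\<close>. It stays causal because \<open>\<Psi>\<close> pulls
  \<open>filt i\<close> back into itself and \<open>inv \<Phi>\<close>, being adapted, does so as
  well.\<close>

lemma causal_distr_biadapted:
  assumes causal: "causal \<pi> \<mu> \<nu>" and \<Phi>: "biadapted \<Phi>" and \<Psi>: "biadapted \<Psi>"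
  shows "causal (distr \<pi> (borel \<Otimes>\<^sub>M borel) (\<lambda>(x, y). (\<Phi> x, \<Psi> y))) (distr \<mu> borel \<Phi>) (distr \<nu> borel \<Psi>)"
proof -
  obtain \<kappa> where prob: "\<And>x. prob_on_borel (\<kappa> x)"
    and meas: "\<And>B. B \<in> sets borel \<Longrightarrow> (\<lambda>x. emeasure (\<kappa> x) B) \<in> borel_measurable borel"
    and dis: "\<And>A B. A \<in> sets borel \<Longrightarrow> B \<in> sets borel \<Longrightarrow>
      emeasure \<pi> (A \<times> B) = (\<integral>\<^sup>+ x. indicator A x * emeasure (\<kappa> x) B \<partial>\<mu>)"
    and filt: "\<And>i B. B \<in> sets (filt i) \<Longrightarrow> (\<lambda>x. emeasure (\<kappa> x) B) \<in> borel_measurable (filt i)"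
    and cpl: "\<pi> \<in> cpl \<mu> \<nu>"
    using causal unfolding causal_def by blast
  interpret \<pi>: prob_space \<pi> using cpl by (simp add: cpl_def)
  have sets [measurable_cong]: "sets \<pi> = sets (borel \<Otimes>\<^sub>M borel)"
    and \<mu>: "\<mu> = distr \<pi> borel fst" and \<nu>: "\<nu> = distr \<pi> borel snd"
    using cpl by (auto simp: cpl_def)
  have space: "space \<pi> = UNIV"
    using sets_eq_imp_space_eq[OF sets] by (simp add: space_pair_measure)
  have [measurable]: "\<Phi> \<in> borel_measurable borel" "\<Psi> \<in> borel_measurable borel" "inv \<Phi> \<in> borel_measurable borel"
    using \<Phi> \<Psi> by (auto simp: biadapted_def)
  have inv\<Phi>: "inv \<Phi> (\<Phi> x) = x" for x
    using \<Phi> by (simp add: biadapted_def bij_is_inj)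
  have \<Psi>B: "\<Psi> -` B \<in> sets borel" and \<Phi>B: "\<Phi> -` B \<in> sets borel" if "B \<in> sets borel" for B
    using measurable_sets[of \<Psi> borel borel B] measurable_sets[of \<Phi> borel borel B] that by auto
  have m: "(\<lambda>(x, y). (\<Phi> x, \<Psi> y)) \<in> measurable \<pi> (borel \<Otimes>\<^sub>M borel)"
    by measurable
  define \<kappa>' where "\<kappa>' u = distr (\<kappa> (inv \<Phi> u)) borel \<Psi>" for u
  have \<kappa>m: "\<Psi> \<in> borel_measurable (\<kappa> x)" for x
    using prob[of x] by (simp add: prob_on_borel_def cong: measurable_cong_sets)
  have \<kappa>space: "space (\<kappa> x) = UNIV" for x
    using prob[of x] sets_eq_imp_space_eq[of "\<kappa> x" borel] by (simp add: prob_on_borel_def)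
  have \<kappa>': "emeasure (\<kappa>' u) B = emeasure (\<kappa> (inv \<Phi> u)) (\<Psi> -` B)" if "B \<in> sets borel" for u B
    unfolding \<kappa>'_def using that by (subst emeasure_distr[OF \<kappa>m]) (auto simp: \<kappa>space)
  show ?thesis
    unfolding causal_def
  proof (intro conjI exI[of _ \<kappa>'] ballI allI)
    show "distr \<pi> (borel \<Otimes>\<^sub>M borel) (\<lambda>(x, y). (\<Phi> x, \<Psi> y)) \<in> cpl (distr \<mu> borel \<Phi>) (distr \<nu> borel \<Psi>)"
      unfolding cpl_def mem_Collect_eq
    proof (intro conjI)
      show "prob_space (distr \<pi> (borel \<Otimes>\<^sub>M borel) (\<lambda>(x, y). (\<Phi> x, \<Psi> y)))"
        by (rule \<pi>.prob_space_distr[OF m])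
      show "distr (distr \<pi> (borel \<Otimes>\<^sub>M borel) (\<lambda>(x, y). (\<Phi> x, \<Psi> y))) borel fst = distr \<mu> borel \<Phi>"
        unfolding \<mu> by (subst (1 2) distr_distr) (auto simp: o_def split_beta' intro!: distr_cong)
      show "distr (distr \<pi> (borel \<Otimes>\<^sub>M borel) (\<lambda>(x, y). (\<Phi> x, \<Psi> y))) borel snd = distr \<nu> borel \<Psi>"
        unfolding \<nu> by (subst (1 2) distr_distr) (auto simp: o_def split_beta' intro!: distr_cong)
    qed simp
    show "prob_on_borel (\<kappa>' u)" for u
      using prob[of "inv \<Phi> u"] prob_space.prob_space_distr[OF _ \<kappa>m] by (simp add: prob_on_borel_def \<kappa>'_def)
    show "(\<lambda>u. emeasure (\<kappa>' u) B) \<in> borel_measurable borel" if "B \<in> sets borel" for B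
      using measurable_compose[OF _ meas[OF \<Psi>B[OF that]], of "inv \<Phi>" borel] by (simp add: \<kappa>'[OF that])
    show "(\<lambda>u. emeasure (\<kappa>' u) B) \<in> borel_measurable (filt i)" if B: "B \<in> sets (filt i)" for i B
    proof -
      have "\<Psi> -` B \<in> sets (filt i)"
        using \<Psi> B by (intro adapted_vimage_filt) (auto simp: biadapted_def)
      moreover have "inv \<Phi> \<in> measurable (filt i) (filt i)"
        using \<Phi> by (intro measurableI) (auto simp: biadapted_def intro!: adapted_vimage_filt)
      ultimately show ?thesis
        using measurable_compose[OF _ filt] by (simp add: \<kappa>'[OF sets_filt_borel[OF B]])
    qed
    fix A B :: "(real, 'a) vec set" assume A [measurable]: "A \<in> sets borel" and B [measurable]: "B \<in> sets borel"
    have "emeasure (distr \<pi> (borel \<Otimes>\<^sub>M borel) (\<lambda>(x, y). (\<Phi> x, \<Psi> y))) (A \<times> B) = emeasure \<pi> (\<Phi> -` A \<times> \<Psi> -` B)"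
      by (subst emeasure_distr[OF m]) (auto simp: space intro!: arg_cong[where f="emeasure \<pi>"])
    also have "\<dots> = (\<integral>\<^sup>+x. indicator (\<Phi> -` A) x * emeasure (\<kappa> x) (\<Psi> -` B) \<partial>\<mu>)"
      by (intro dis \<Phi>B \<Psi>B A B)
    also have "\<dots> = (\<integral>\<^sup>+x. indicator A (\<Phi> x) * emeasure (\<kappa>' (\<Phi> x)) B \<partial>\<mu>)"
      by (intro nn_integral_cong) (simp add: \<kappa>'[OF B] inv\<Phi> indicator_def)
    also have "\<dots> = (\<integral>\<^sup>+u. indicator A u * emeasure (\<kappa>' u) B \<partial>distr \<mu> borel \<Phi>)"
      using measurable_compose[OF _ meas[OF \<Psi>B[OF B]], of "inv \<Phi>" borel]
      by (subst nn_integral_distr) (auto simp: \<mu> \<kappa>'[OF B])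
    finally show "emeasure (distr \<pi> (borel \<Otimes>\<^sub>M borel) (\<lambda>(x, y). (\<Phi> x, \<Psi> y))) (A \<times> B)
        = (\<integral>\<^sup>+u. indicator A u * emeasure (\<kappa>' u) B \<partial>distr \<mu> borel \<Phi>)" .
  qed
qed

section \<open>Monge and product couplings as members of \<open>cpl_bc\<close>\<close>

lemma monge_cpl_cpl:
  assumes \<mu>: "prob_on_borel \<mu>" and T [measurable]: "T \<in> borel_measurable borel"
  shows "monge_cpl \<mu> T \<in> cpl \<mu> (distr \<mu> borel T)"
proof -
  have [measurable_cong]: "sets \<mu> = sets borel" and "prob_space \<mu>"
    using \<mu> by (auto simp: prob_on_borel_def)
  have m: "(\<lambda>x. (x, T x)) \<in> measurable \<mu> (borel \<Otimes>\<^sub>M borel)"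
    by measurable
  have "distr (monge_cpl \<mu> T) borel fst = distr \<mu> borel (\<lambda>x. x)"
    unfolding monge_cpl_def by (subst distr_distr[OF _ m]) (auto simp: o_def)
  also have "\<dots> = \<mu>"
    using \<mu> by (intro distr_id2) (simp add: prob_on_borel_def)
  finally have "distr (monge_cpl \<mu> T) borel fst = \<mu>" .
  moreover have "distr (monge_cpl \<mu> T) borel snd = distr \<mu> borel T"
    unfolding monge_cpl_def by (subst distr_distr[OF _ m]) (auto simp: o_def)
  ultimately show ?thesis
    using prob_space.prob_space_distr[OF \<open>prob_space \<mu>\<close> m] by (auto simp: cpl_def monge_cpl_def)
qed

text \<open>The kernel is the Dirac mass at \<open>T x\<close>. Its value on \<open>B\<close> is the
  indicator of the preimage of \<open>B\<close> under \<open>T\<close>, which lies in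
  \<open>filt i\<close> since \<open>T\<close> is adapted.\<close>

lemma causal_monge_cpl:
  assumes \<mu>: "prob_on_borel \<mu>" and T [measurable]: "T \<in> borel_measurable borel" "adapted T"
  shows "causal (monge_cpl \<mu> T) \<mu> (distr \<mu> borel T)"
  unfolding causal_def
proof (intro conjI exI[of _ "\<lambda>x. return borel (T x)"] ballI allI)
  have [measurable_cong]: "sets \<mu> = sets borel" and space: "space \<mu> = UNIV"
    using \<mu> sets_eq_imp_space_eq[of \<mu> borel] by (auto simp: prob_on_borel_def)
  show "monge_cpl \<mu> T \<in> cpl \<mu> (distr \<mu> borel T)"
    by (rule monge_cpl_cpl[OF \<mu> T(1)])
  show "prob_on_borel (return borel (T x))" for x
    by (simp add: prob_on_borel_def prob_space_return)
  show "(\<lambda>x. emeasure (return borel (T x)) B) \<in> borel_measurable borel" if [measurable]: "B \<in> sets borel" for B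
    by simp
  show "(\<lambda>x. emeasure (return borel (T x)) B) \<in> borel_measurable (filt i)" if B: "B \<in> sets (filt i)" for i B
  proof -
    have "(\<lambda>x. indicator (T -` B) x :: ennreal) \<in> borel_measurable (filt i)"
      using adapted_vimage_filt[OF T B] by simp
    then show ?thesis
      using sets_filt_borel[OF B] by (simp add: indicator_def)
  qed
  fix A B :: "(real, 'a) vec set" assume [measurable]: "A \<in> sets borel" "B \<in> sets borel"
  have m: "(\<lambda>x. (x, T x)) \<in> measurable \<mu> (borel \<Otimes>\<^sub>M borel)"
    by measurable
  have "emeasure (monge_cpl \<mu> T) (A \<times> B) = emeasure \<mu> {x. x \<in> A \<and> T x \<in> B}"
    unfolding monge_cpl_def by (subst emeasure_distr[OF m]) (auto simp: space intro!: arg_cong[where f="emeasure \<mu>"])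
  also have "\<dots> = (\<integral>\<^sup>+x. indicator {x. x \<in> A \<and> T x \<in> B} x \<partial>\<mu>)"
    by (rule nn_integral_indicator[symmetric]) measurable
  also have "\<dots> = (\<integral>\<^sup>+x. indicator A x * emeasure (return borel (T x)) B \<partial>\<mu>)"
    by (intro nn_integral_cong) (auto simp: indicator_def)
  finally show "emeasure (monge_cpl \<mu> T) (A \<times> B) = (\<integral>\<^sup>+x. indicator A x * emeasure (return borel (T x)) B \<partial>\<mu>)" .
qed

text \<open>Swapping the components turns the Monge coupling of \<open>T\<close> into that of
  \<open>inv T\<close>, which is adapted too.\<close>

lemma monge_cpl_biadapted_cpl_bc:
  assumes \<mu>: "prob_on_borel \<mu>" and T: "biadapted T" and \<nu>: "distr \<mu> borel T = \<nu>"
  shows "monge_cpl \<mu> T \<in> cpl_bc \<mu> \<nu>"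
proof -
  have [measurable]: "T \<in> borel_measurable borel" "inv T \<in> borel_measurable borel"
    and ad: "adapted T" "adapted (inv T)" and inv: "\<And>x. inv T (T x) = x"
    using T by (auto simp: biadapted_def bij_is_inj)
  have [measurable_cong]: "sets \<mu> = sets borel" and "prob_space \<mu>"
    using \<mu> by (auto simp: prob_on_borel_def)
  have m: "(\<lambda>x. (x, T x)) \<in> measurable \<mu> (borel \<Otimes>\<^sub>M borel)"
    by measurable
  have \<nu>': "prob_on_borel \<nu>"
    using prob_space.prob_space_distr[OF \<open>prob_space \<mu>\<close>, of T borel] by (auto simp: prob_on_borel_def \<nu>[symmetric])
  have "distr \<nu> borel (inv T) = distr \<mu> borel (\<lambda>x. x)"
    unfolding \<nu>[symmetric] by (subst distr_distr) (auto simp: o_def inv)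
  also have "\<dots> = \<mu>"
    using \<mu> by (intro distr_id2) (simp add: prob_on_borel_def)
  finally have "distr \<nu> borel (inv T) = \<mu>" .
  then have "causal (monge_cpl \<nu> (inv T)) \<nu> \<mu>"
    using causal_monge_cpl[OF \<nu>', of "inv T"] ad by simp
  moreover have "distr (monge_cpl \<mu> T) (borel \<Otimes>\<^sub>M borel) (\<lambda>(x, y). (y, x)) = distr \<mu> (borel \<Otimes>\<^sub>M borel) (\<lambda>x. (T x, x))"
    unfolding monge_cpl_def by (subst distr_distr[OF _ m]) (auto simp: o_def)
  moreover have "monge_cpl \<nu> (inv T) = distr \<mu> (borel \<Otimes>\<^sub>M borel) (\<lambda>x. (T x, x))"
    unfolding monge_cpl_def \<nu>[symmetric] by (subst distr_distr) (auto simp: o_def inv)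
  moreover have "causal (monge_cpl \<mu> T) \<mu> \<nu>"
    using causal_monge_cpl[OF \<mu>, of T] ad \<nu> by simp
  ultimately show ?thesis
    by (simp add: cpl_bc_def)
qed

lemma causal_pair_measure:
  fixes \<mu> \<nu> :: "(real, 'n::{finite,linorder}) vec measure"
  assumes \<mu>: "prob_on_borel \<mu>" and \<nu>: "prob_on_borel \<nu>"
  shows "causal (\<mu> \<Otimes>\<^sub>M \<nu>) \<mu> \<nu>"
proof -
  interpret \<mu>: prob_space \<mu> using \<mu> by (simp add: prob_on_borel_def)
  interpret \<nu>: prob_space \<nu> using \<nu> by (simp add: prob_on_borel_def)
  have sets: "sets \<mu> = sets borel" "sets \<nu> = sets borel"
    using \<mu> \<nu> by (auto simp: prob_on_borel_def)
  have space: "space \<mu> = UNIV" "space \<nu> = UNIV"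
    using sets_eq_imp_space_eq[OF sets(1)] sets_eq_imp_space_eq[OF sets(2)] by simp_all
  have sets2: "sets (\<mu> \<Otimes>\<^sub>M \<nu>) = sets (borel \<Otimes>\<^sub>M borel)"
    by (rule sets_pair_measure_cong[OF sets])
  have box: "emeasure (\<mu> \<Otimes>\<^sub>M \<nu>) (A \<times> B) = emeasure \<mu> A * emeasure \<nu> B" if "A \<in> sets borel" "B \<in> sets borel" for A B
    using that sets by (intro \<nu>.emeasure_pair_measure_Times) auto
  have "distr (\<mu> \<Otimes>\<^sub>M \<nu>) borel fst = \<mu>"
  proof (rule measure_eqI)
    fix A assume "A \<in> sets (distr (\<mu> \<Otimes>\<^sub>M \<nu>) borel fst)"
    then have A: "A \<in> sets borel" by simp
    have "fst -` A \<inter> space (\<mu> \<Otimes>\<^sub>M \<nu>) = A \<times> UNIV"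
      by (auto simp: space_pair_measure space)
    then show "emeasure (distr (\<mu> \<Otimes>\<^sub>M \<nu>) borel fst) A = emeasure \<mu> A"
      using A box[OF A, of UNIV] \<nu>.emeasure_space_1 space
      by (subst emeasure_distr) (auto simp: measurable_cong_sets[OF sets2 refl])
  qed (use sets in simp)
  moreover have "distr (\<mu> \<Otimes>\<^sub>M \<nu>) borel snd = \<nu>"
  proof (rule measure_eqI)
    fix A assume "A \<in> sets (distr (\<mu> \<Otimes>\<^sub>M \<nu>) borel snd)"
    then have A: "A \<in> sets borel" by simp
    have "snd -` A \<inter> space (\<mu> \<Otimes>\<^sub>M \<nu>) = UNIV \<times> A"
      by (auto simp: space_pair_measure space)
    then show "emeasure (distr (\<mu> \<Otimes>\<^sub>M \<nu>) borel snd) A = emeasure \<nu> A"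
      using A box[of UNIV, OF _ A] \<mu>.emeasure_space_1 space
      by (subst emeasure_distr) (auto simp: measurable_cong_sets[OF sets2 refl])
  qed (use sets in simp)
  moreover have "prob_space (\<mu> \<Otimes>\<^sub>M \<nu>)"
    by (intro prob_space_pair \<mu>.prob_space_axioms \<nu>.prob_space_axioms)
  ultimately have "\<mu> \<Otimes>\<^sub>M \<nu> \<in> cpl \<mu> \<nu>"
    using sets2 by (simp add: cpl_def)
  moreover have "emeasure (\<mu> \<Otimes>\<^sub>M \<nu>) (A \<times> B) = (\<integral>\<^sup>+x. indicator A x * emeasure \<nu> B \<partial>\<mu>)"
    if "A \<in> sets borel" "B \<in> sets borel" for A B
    using that sets by (simp add: box nn_integral_multc)
  ultimately show ?thesis
    unfolding causal_def using \<nu> by (intro conjI exI[of _ "\<lambda>_. \<nu>"]) auto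
qed

text \<open>The product coupling is causal in both directions with a constant kernel. It witnesses
  that the infimum over \<open>cpl_bc \<mu> \<nu>\<close> is over a nonempty set.\<close>

lemma pair_measure_cpl_bc:
  fixes \<mu> \<nu> :: "(real, 'n::{finite,linorder}) vec measure"
  assumes \<mu>: "prob_on_borel \<mu>" and \<nu>: "prob_on_borel \<nu>"
  shows "\<mu> \<Otimes>\<^sub>M \<nu> \<in> cpl_bc \<mu> \<nu>"
proof -
  interpret \<mu>: prob_space \<mu> using \<mu> by (simp add: prob_on_borel_def)
  interpret \<nu>: prob_space \<nu> using \<nu> by (simp add: prob_on_borel_def)
  interpret pair_sigma_finite \<nu> \<mu> ..
  have "sets (\<nu> \<Otimes>\<^sub>M \<mu>) = sets (borel \<Otimes>\<^sub>M borel)"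
    using \<mu> \<nu> by (intro sets_pair_measure_cong) (auto simp: prob_on_borel_def)
  then have "distr (\<mu> \<Otimes>\<^sub>M \<nu>) (borel \<Otimes>\<^sub>M borel) (\<lambda>(x, y). (y, x)) = \<nu> \<Otimes>\<^sub>M \<mu>"
    by (subst distr_pair_swap) (intro distr_cong; simp)
  then show ?thesis
    using causal_pair_measure[OF \<mu> \<nu>] causal_pair_measure[OF \<nu> \<mu>] by (simp add: cpl_bc_def)
qed

section \<open>Density of biadapted Monge couplings\<close>

lemma distr_inv_biadapted:
  assumes "biadapted \<Phi>" and "distr \<gamma> borel \<Phi> = \<mu>" and sets: "sets \<gamma> = sets borel"
  shows "distr \<mu> borel (inv \<Phi>) = \<gamma>"
proof -
  have m: "\<Phi> \<in> borel_measurable \<gamma>" "inv \<Phi> \<in> borel_measurable borel"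
    and inv: "inv \<Phi> \<circ> \<Phi> = (\<lambda>x. x)"
    using assms(1) by (auto simp: biadapted_def measurable_cong_sets[OF sets refl] o_def bij_is_inj)
  show ?thesis
    unfolding assms(2)[symmetric] distr_distr[OF m(2,1)] inv by (rule distr_id2) (simp add: sets)
qed

text \<open>The coupling is pulled back to the cube, matched there at mesh \<open>1 / 2 ^ k\<close>
  by \<open>S k\<close>, and carried back, giving the map
  \<open>\<Psi> \<circ> S k \<circ> inv \<Phi>\<close>. A single sequence serves all test functions
  at once.\<close>

theorem biadapted_monge_dense:
  fixes \<mu> \<nu> :: "(real, 'n::{finite,linorder}) vec measure"
  assumes \<mu>: "prob_on_borel \<mu>" and \<nu>: "prob_on_borel \<nu>"
    and ac: "absolutely_continuous lborel \<mu>" "absolutely_continuous lborel \<nu>"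
    and \<pi>: "\<pi> \<in> cpl_bc \<mu> \<nu>"
  shows "\<exists>T. \<forall>k::nat. biadapted (T k) \<and> distr \<mu> borel (T k) = \<nu> \<and>
    (\<forall>f. bdd_cont f \<longrightarrow> (\<lambda>k. \<integral>z. f z \<partial>monge_cpl \<mu> (T k)) \<longlonglongrightarrow> (\<integral>z. f z \<partial>\<pi>))"
proof -
  define \<gamma> :: "(real, 'n) vec measure" where "\<gamma> = vec_PiM unif01"
  have \<gamma>: "prob_on_borel \<gamma>"
    using prob_space_vec_PiM[OF real_distribution_unif01] by (simp add: prob_on_borel_def \<gamma>_def)
  have sets\<gamma>: "sets \<gamma> = sets borel"
    by (simp add: \<gamma>_def)
  obtain \<Phi> \<Psi> where \<Phi>: "biadapted \<Phi>" "distr \<gamma> borel \<Phi> = \<mu>" and \<Psi>: "biadapted \<Psi>" "distr \<gamma> borel \<Psi> = \<nu>"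
    using knothe_rosenblatt_biadapted[OF \<mu> ac(1)] knothe_rosenblatt_biadapted[OF \<nu> ac(2)] unfolding \<gamma>_def by blast
  have [measurable]: "\<Phi> \<in> borel_measurable borel" "\<Psi> \<in> borel_measurable borel"
    "inv \<Phi> \<in> borel_measurable borel" "inv \<Psi> \<in> borel_measurable borel"
    using \<Phi> \<Psi> by (auto simp: biadapted_def)
  have inv: "\<And>x. inv \<Phi> (\<Phi> x) = x" "\<And>x. \<Phi> (inv \<Phi> x) = x" "\<And>x. \<Psi> (inv \<Psi> x) = x"
    using \<Phi> \<Psi> by (auto simp: biadapted_def bij_is_inj bij_is_surj surj_f_inv_f)
  note inv\<mu> = distr_inv_biadapted[OF \<Phi> sets\<gamma>] and inv\<nu> = distr_inv_biadapted[OF \<Psi> sets\<gamma>]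
  define \<pi>' where "\<pi>' = distr \<pi> (borel \<Otimes>\<^sub>M borel) (\<lambda>(x, y). (inv \<Phi> x, inv \<Psi> y))"
  have c: "causal \<pi> \<mu> \<nu>" "causal (distr \<pi> (borel \<Otimes>\<^sub>M borel) (\<lambda>(x, y). (y, x))) \<nu> \<mu>"
    using \<pi> by (auto simp: cpl_bc_def)
  have sets\<pi> [measurable_cong]: "sets \<pi> = sets (borel \<Otimes>\<^sub>M borel)" and prob\<pi>: "prob_space \<pi>"
    using c(1) by (auto simp: causal_def cpl_def)
  have c1: "causal \<pi>' \<gamma> \<gamma>"
    using causal_distr_biadapted[OF c(1) biadapted_inv[OF \<Phi>(1)] biadapted_inv[OF \<Psi>(1)]]
    by (simp add: inv\<mu> inv\<nu> \<pi>'_def)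
  have "distr \<pi>' (borel \<Otimes>\<^sub>M borel) (\<lambda>(x, y). (y, x))
      = distr (distr \<pi> (borel \<Otimes>\<^sub>M borel) (\<lambda>(x, y). (y, x))) (borel \<Otimes>\<^sub>M borel) (\<lambda>(x, y). (inv \<Psi> x, inv \<Phi> y))"
    unfolding \<pi>'_def by (subst (1 2) distr_distr) (auto simp: o_def split_beta' intro!: distr_cong)
  then have c2: "causal (distr \<pi>' (borel \<Otimes>\<^sub>M borel) (\<lambda>(x, y). (y, x))) \<gamma> \<gamma>"
    using causal_distr_biadapted[OF c(2) biadapted_inv[OF \<Psi>(1)] biadapted_inv[OF \<Phi>(1)]]
    by (simp add: inv\<mu> inv\<nu>)
  have cpl': "\<pi>' \<in> cpl \<gamma> \<gamma>"
    using c1 by (simp add: causal_def)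
  have sets' [measurable_cong]: "sets \<pi>' = sets (borel \<Otimes>\<^sub>M borel)"
    by (simp add: \<pi>'_def)
  define good where "good k T \<longleftrightarrow> biadapted T \<and> distr \<gamma> borel T = \<gamma> \<and>
    (\<forall>C D. emeasure \<gamma> {x \<in> cells (2 ^ k) UNIV C. T x \<in> cells (2 ^ k) UNIV D}
      = emeasure \<pi>' (cells (2 ^ k) UNIV C \<times> cells (2 ^ k) UNIV D))" for k :: nat and T
  have "\<exists>T. good k T" for k
    unfolding good_def \<gamma>_def by (rule grid_matching_biadapted) (use c1 c2 in \<open>auto simp: \<gamma>_def\<close>)
  then obtain S where "\<And>k. good k (S k)"
    by metis
  then have S: "\<And>k. biadapted (S k)" "\<And>k. distr \<gamma> borel (S k) = \<gamma>"
    and mass: "\<And>k C D. emeasure \<gamma> {x \<in> cells (2 ^ k) UNIV C. S k x \<in> cells (2 ^ k) UNIV D}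
      = emeasure \<pi>' (cells (2 ^ k) UNIV C \<times> cells (2 ^ k) UNIV D)"
    unfolding good_def by blast+
  have Sm [measurable]: "S k \<in> borel_measurable borel" for k
    using S(1)[of k] by (auto simp: biadapted_def)
  define Q where "Q k = monge_cpl \<gamma> (S k)" for k
  have Q_cpl: "Q k \<in> cpl \<gamma> \<gamma>" for k
    using monge_cpl_cpl[OF \<gamma> Sm[of k]] by (simp add: S(2) Q_def)
  have setsQ: "sets (Q k) = sets (borel \<Otimes>\<^sub>M borel)" for k
    by (simp add: Q_def monge_cpl_def)
  have Q_emeasure: "emeasure (Q k) (A \<times> B) = emeasure \<gamma> {x \<in> A. S k x \<in> B}" if "A \<in> sets borel" "B \<in> sets borel" for k A B
  proof -
    have "(\<lambda>x. (x, S k x)) \<in> measurable \<gamma> (borel \<Otimes>\<^sub>M borel)"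
      by (simp add: measurable_cong_sets[OF sets\<gamma> refl])
    then show ?thesis
      unfolding Q_def monge_cpl_def using that
      by (subst emeasure_distr) (auto simp: \<gamma>_def intro!: arg_cong[where f="emeasure (vec_PiM unif01)"])
  qed
  have rect: "(\<lambda>k. measure (Q k) (A \<times> B)) \<longlonglongrightarrow> measure \<pi>' (A \<times> B)" if "A \<in> sets borel" "B \<in> sets borel" for A B
  proof (rule tendsto_measure_Times[where G=grid_sets and H=grid_sets and \<mu>=\<gamma> and \<nu>=\<gamma>])
    fix A B :: "(real, 'n) vec set" assume "A \<in> grid_sets" "B \<in> grid_sets"
    then obtain l l' where l: "\<And>k. k \<ge> l \<Longrightarrow> \<exists>S. A = grid (2 ^ k) -` S" "\<And>k. k \<ge> l' \<Longrightarrow> \<exists>S. B = grid (2 ^ k) -` S"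
      using grid_sets_refine by metis
    \<comment> \<open>From the level at which both sets are unions of cells, the two masses are
      equal; convergence on the generator is eventual equality.\<close>
    have "measure (Q k) (A \<times> B) = measure \<pi>' (A \<times> B)" if k: "k \<ge> max l l'" for k
    proof -
      obtain V W where VW: "A = grid (2 ^ k) -` V" "B = grid (2 ^ k) -` W"
        using l[of k] k by auto
      have "emeasure (Q k) (A \<times> B) = emeasure \<pi>' (A \<times> B)"
        unfolding VW by (rule measure_grid_Times_eq[OF setsQ sets']) (simp add: Q_emeasure mass)
      then show ?thesis
        by (simp add: measure_def)
    qed
    then show "(\<lambda>k. measure (Q k) (A \<times> B)) \<longlonglongrightarrow> measure \<pi>' (A \<times> B)"
      by (intro tendsto_eventually eventually_sequentiallyI[of "max l l'"])
  qed (use that Q_cpl cpl' in \<open>auto simp: cpl_def Int_stable_grid_sets sets_borel_grid_sets[symmetric]\<close>)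
  define T where "T k = \<Psi> \<circ> S k \<circ> inv \<Phi>" for k
  have bi: "biadapted (T k)" for k
    unfolding T_def using \<Phi>(1) \<Psi>(1) S(1) by (intro biadapted_compose biadapted_inv)
  then have Tm [measurable]: "T k \<in> borel_measurable borel" for k
    by (auto simp: biadapted_def)
  have sets\<mu>: "sets \<mu> = sets borel"
    using \<mu> by (simp add: prob_on_borel_def)
  have push: "distr \<mu> borel (T k) = \<nu>" for k
  proof -
    have "distr \<mu> borel (T k) = distr (distr (distr \<mu> borel (inv \<Phi>)) borel (S k)) borel \<Psi>"
      by (subst (1 2) distr_distr) (auto simp: T_def measurable_cong_sets[OF sets\<mu> refl] o_assoc)
    then show ?thesis
      by (simp add: inv\<mu> S(2) \<Psi>(2))
  qed
  have monge: "monge_cpl \<mu> (T k) = distr (Q k) (borel \<Otimes>\<^sub>M borel) (\<lambda>(x, y). (\<Phi> x, \<Psi> y))" for k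
  proof -
    have m: "(\<lambda>x. (x, S k x)) \<in> measurable \<gamma> (borel \<Otimes>\<^sub>M borel)" "\<Phi> \<in> borel_measurable \<gamma>"
      by (simp_all add: measurable_cong_sets[OF sets\<gamma> refl])
    have "monge_cpl \<mu> (T k) = distr \<gamma> (borel \<Otimes>\<^sub>M borel) (\<lambda>x. (\<Phi> x, \<Psi> (S k x)))"
      unfolding monge_cpl_def \<Phi>(2)[symmetric] by (subst distr_distr[OF _ m(2)]) (auto simp: o_def T_def inv)
    also have "\<dots> = distr (Q k) (borel \<Otimes>\<^sub>M borel) (\<lambda>(x, y). (\<Phi> x, \<Psi> y))"
      unfolding Q_def monge_cpl_def by (subst distr_distr[OF _ m(1)]) (auto simp: o_def)
    finally show ?thesis .
  qed
  have \<pi>_eq: "\<pi> = distr \<pi>' (borel \<Otimes>\<^sub>M borel) (\<lambda>(x, y). (\<Phi> x, \<Psi> y))"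
  proof -
    have "distr \<pi>' (borel \<Otimes>\<^sub>M borel) (\<lambda>(x, y). (\<Phi> x, \<Psi> y)) = distr \<pi> (borel \<Otimes>\<^sub>M borel) (\<lambda>z. z)"
      unfolding \<pi>'_def by (subst distr_distr) (auto simp: o_def split_beta' inv)
    also have "\<dots> = \<pi>"
      by (rule distr_id2) (simp add: sets\<pi>)
    finally show ?thesis ..
  qed
  have m2: "(\<lambda>(x, y). (\<Phi> x, \<Psi> y)) \<in> measurable R (borel \<Otimes>\<^sub>M borel)" if "sets R = sets (borel \<Otimes>\<^sub>M borel)" for R
    by (simp add: measurable_cong_sets[OF that refl])
  have m2_times: "measure (distr R (borel \<Otimes>\<^sub>M borel) (\<lambda>(x, y). (\<Phi> x, \<Psi> y))) (A \<times> B) = measure R (\<Phi> -` A \<times> \<Psi> -` B)"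
    if R: "sets R = sets (borel \<Otimes>\<^sub>M borel)" and "A \<in> sets borel" "B \<in> sets borel" for R A B
    using that sets_eq_imp_space_eq[OF R]
    by (subst measure_distr[OF m2]) (auto simp: space_pair_measure intro!: arg_cong[where f="measure R"])
  have rect': "(\<lambda>k. measure (monge_cpl \<mu> (T k)) (A \<times> B)) \<longlonglongrightarrow> measure \<pi> (A \<times> B)"
    if AB [measurable]: "A \<in> sets borel" "B \<in> sets borel" for A B
  proof -
    have "\<Phi> -` A \<in> sets borel" "\<Psi> -` B \<in> sets borel"
      using measurable_sets[of \<Phi> borel borel A] measurable_sets[of \<Psi> borel borel B] by auto
    from rect[OF this] show ?thesis
      by (subst \<pi>_eq) (simp add: monge m2_times[OF setsQ AB] m2_times[OF sets' AB])
  qed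
  have "(\<lambda>k. \<integral>z. f z \<partial>monge_cpl \<mu> (T k)) \<longlonglongrightarrow> (\<integral>z. f z \<partial>\<pi>)" if "bdd_cont f" for f
    using monge_cpl_cpl[OF \<mu> Tm] prob\<pi> sets\<pi> rect' that
    by (intro integral_tendsto_if_Times_tendsto) (auto simp: cpl_def)
  then show ?thesis
    using bi push by blast
qed

text \<open>Finitely many bounded continuous functions and an \<open>\<epsilon>\<close> describe a
  basic neighbourhood in the weak topology, so the first half is density. A sequence whose integrals
  all converge enters each such neighbourhood.\<close>

theorem theorem1p4:
  fixes \<mu> \<nu> :: "(real ^ 'n::{finite,linorder}) measure"
  assumes "prob_on_borel \<mu>" and "prob_on_borel \<nu>"
    and "absolutely_continuous lborel \<mu>" and "absolutely_continuous lborel \<nu>"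
  shows "(\<forall>\<pi>\<in>cpl_bc \<mu> \<nu>. \<forall>F \<epsilon>. finite F \<and> (\<forall>f\<in>F. bdd_cont f) \<and> \<epsilon> > 0 \<longrightarrow>
            (\<exists>T. biadapted T \<and> distr \<mu> borel T = \<nu> \<and>
                 (\<forall>f\<in>F. \<bar>(\<integral>z. f z \<partial>monge_cpl \<mu> T) - (\<integral>z. f z \<partial>\<pi>)\<bar> < \<epsilon>)))
         \<and> (\<forall>c :: (real ^ ('n::{finite,linorder})) \<times> (real ^ ('n::{finite,linorder})) \<Rightarrow> real. bdd_cont c \<longrightarrow>
            Inf ((\<lambda>\<pi>. \<integral>z. c z \<partial>\<pi>) ` cpl_bc \<mu> \<nu>)
            = Inf ((\<lambda>T. \<integral>x. c (x, T x) \<partial>\<mu>) ` {T. biadapted T \<and> distr \<mu> borel T = \<nu>}))"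
proof (intro conjI ballI allI impI)
  fix \<pi> and F :: "((real, 'n) vec \<times> (real, 'n) vec \<Rightarrow> real) set" and \<epsilon> :: real
  assume \<pi>: "\<pi> \<in> cpl_bc \<mu> \<nu>" and F: "finite F \<and> (\<forall>f\<in>F. bdd_cont f) \<and> \<epsilon> > 0"
  obtain T where T: "\<And>k::nat. biadapted (T k)" "\<And>k. distr \<mu> borel (T k) = \<nu>"
    and lim: "\<And>f. bdd_cont f \<Longrightarrow> (\<lambda>k. \<integral>z. f z \<partial>monge_cpl \<mu> (T k)) \<longlonglongrightarrow> (\<integral>z. f z \<partial>\<pi>)"
    using biadapted_monge_dense[OF assms \<pi>] by blast
  have "\<forall>\<^sub>F k in sequentially. \<forall>f\<in>F. dist (\<integral>z. f z \<partial>monge_cpl \<mu> (T k)) (\<integral>z. f z \<partial>\<pi>) < \<epsilon>"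
    using F lim by (intro eventually_ball_finite ballI tendstoD) auto
  then obtain k where "\<forall>f\<in>F. dist (\<integral>z. f z \<partial>monge_cpl \<mu> (T k)) (\<integral>z. f z \<partial>\<pi>) < \<epsilon>"
    by (auto simp: eventually_sequentially)
  then show "\<exists>T. biadapted T \<and> distr \<mu> borel T = \<nu> \<and>
      (\<forall>f\<in>F. \<bar>(\<integral>z. f z \<partial>monge_cpl \<mu> T) - (\<integral>z. f z \<partial>\<pi>)\<bar> < \<epsilon>)"
    using T by (intro exI[of _ "T k"]) (auto simp: dist_real_def)
next
  fix c :: "(real, 'n) vec \<times> (real, 'n) vec \<Rightarrow> real" assume c: "bdd_cont c"
  obtain b where b: "\<And>z. \<bar>c z\<bar> \<le> b"
    using c by (auto simp: bdd_cont_def)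
  let ?I = "\<lambda>\<pi>. \<integral>z. c z \<partial>\<pi>" and ?J = "\<lambda>T. \<integral>x. c (x, T x) \<partial>\<mu>"
  let ?TT = "{T. biadapted T \<and> distr \<mu> borel T = \<nu>}"
  have cm: "c \<in> borel_measurable (borel \<Otimes>\<^sub>M borel)"
    using c borel_measurable_continuous_onI[of c] by (simp add: bdd_cont_def borel_prod)
  have J: "?J T = ?I (monge_cpl \<mu> T)" if "biadapted T" for T
  proof -
    have "sets \<mu> = sets borel" and [measurable]: "T \<in> borel_measurable borel"
      using assms(1) that by (auto simp: prob_on_borel_def biadapted_def)
    then have "(\<lambda>x. (x, T x)) \<in> measurable \<mu> (borel \<Otimes>\<^sub>M borel)"
      by (simp cong: measurable_cong_sets)
    then show ?thesis
      unfolding monge_cpl_def using cm by (simp add: integral_distr)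
  qed
  \<comment> \<open>Over the reals \<open>Inf\<close> is meaningful only for nonempty sets that are
    bounded below; this bound covers both sides because of the inclusion \<open>sub\<close>.\<close>
  have lower: "- b \<le> ?I \<pi>" if "\<pi> \<in> cpl_bc \<mu> \<nu>" for \<pi>
  proof -
    interpret prob_space \<pi>
      using that by (auto simp: cpl_bc_def causal_def cpl_def)
    have "sets \<pi> = sets (borel \<Otimes>\<^sub>M borel)"
      using that by (auto simp: cpl_bc_def causal_def cpl_def)
    then have [measurable]: "c \<in> borel_measurable \<pi>"
      using cm by (simp cong: measurable_cong_sets)
    have "\<bar>?I \<pi>\<bar> \<le> (\<integral>z. \<bar>c z\<bar> \<partial>\<pi>)"
      by (rule integral_abs_bound)
    also have "\<dots> \<le> b"
      using b b[of undefined] by (intro integral_le_const) (auto intro!: integrable_const_bound[where B=b])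
    finally show ?thesis
      by linarith
  qed
  have bdd: "bdd_below (?I ` cpl_bc \<mu> \<nu>)"
    using lower by (auto intro!: bdd_belowI)
  have sub: "?J ` ?TT \<subseteq> ?I ` cpl_bc \<mu> \<nu>"
    using J monge_cpl_biadapted_cpl_bc[OF assms(1)] by auto
  have ex: "\<exists>t \<in> ?TT. ?J t < ?I \<pi> + e" if \<pi>: "\<pi> \<in> cpl_bc \<mu> \<nu>" and e: "e > 0" for \<pi> e
  proof -
    obtain T where T: "\<And>k::nat. biadapted (T k)" "\<And>k. distr \<mu> borel (T k) = \<nu>"
      and lim: "(\<lambda>k. ?I (monge_cpl \<mu> (T k))) \<longlonglongrightarrow> ?I \<pi>"
      using biadapted_monge_dense[OF assms \<pi>] c by blast
    have "\<forall>\<^sub>F k in sequentially. ?I (monge_cpl \<mu> (T k)) < ?I \<pi> + e"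
      using lim by (rule order_tendstoD) (use e in simp)
    then obtain k where "?I (monge_cpl \<mu> (T k)) < ?I \<pi> + e"
      by (auto simp: eventually_sequentially)
    then show ?thesis
      using T J by (intro bexI[of _ "T k"]) auto
  qed
  have ne: "cpl_bc \<mu> \<nu> \<noteq> {}"
    using pair_measure_cpl_bc[OF assms(1,2)] by blast
  \<comment> \<open>A biadapted transport map exists because the product coupling can be
    approximated by Monge couplings.\<close>
  then have ne': "?TT \<noteq> {}"
    using ex[of _ 1] by fastforce
  show "Inf (?I ` cpl_bc \<mu> \<nu>) = Inf (?J ` ?TT)"
  proof (rule antisym)
    show "Inf (?I ` cpl_bc \<mu> \<nu>) \<le> Inf (?J ` ?TT)"
      using ne' by (intro cInf_superset_mono bdd sub) simp
    show "Inf (?J ` ?TT) \<le> Inf (?I ` cpl_bc \<mu> \<nu>)"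
    proof (rule cInf_greatest)
      show "?I ` cpl_bc \<mu> \<nu> \<noteq> {}"
        using ne by simp
      fix r assume "r \<in> ?I ` cpl_bc \<mu> \<nu>"
      then obtain \<pi> where \<pi>: "\<pi> \<in> cpl_bc \<mu> \<nu>" and r: "r = ?I \<pi>"
        by blast
      show "Inf (?J ` ?TT) \<le> r"
      proof (rule field_le_epsilon)
        fix e :: real assume "e > 0"
        then obtain t where "t \<in> ?TT" "?J t < ?I \<pi> + e"
          using ex[OF \<pi>] by blast
        moreover have "Inf (?J ` ?TT) \<le> ?J t"
          using \<open>t \<in> ?TT\<close> bdd_below_mono[OF bdd sub] by (rule cINF_lower[rotated])
        ultimately show "Inf (?J ` ?TT) \<le> r + e"
          by (simp add: r)
      qed
    qed
  qed
qed

end
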